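(* Let $\mathfrak{s}\in\mathfrak{sh}_*$ be a symbol representing (via $\mathfrak{ev}_*$) a map from a tensor product of Heegaard Floer chain complexes $\widehat{CF}$ to another Heegaard Floer chain complex $\widehat{CF}$, and let $P\in\mathbb{P}(\mathcal{G})$. If $\mathfrak{s}$ has property $P$, i.e. $P(\mathfrak{s})=0$ in $\mathfrak{sh}_*$, then the map $\mathfrak{F}_{U;*}(\mathfrak{s})\in\mathfrak{sh}_{U,*}$ between the corresponding knot Floer chain complexes $CFK^{\bullet,-}$ has the property $P_{\mathfrak{F}_U}$, i.e. $P_{\mathfrak{F}_U}(\mathfrak{F}_{U;*}(\mathfrak{s}))=0$ in $\mathfrak{sh}_{U,*}$.
   Context: **Moduli spaces.** $\Sigma$ is a closed oriented genus-$g$ surface, $z\in\Sigma$ a base point, $B$ a finite set whose elements are sets of attaching circles on $\Sigma\setminus\{z\}$ (a set of attaching circles $\alpha$ consists of $g$ pairwise disjoint simple closed curves linearly independent in $H_1(\Sigma;\mathbb{Z})$; $\mathbb{T}_\alpha=\alpha_1\times\dots\times\alpha_g\subset\mathrm{Sym}^g(\Sigma)$). The usual analytic set-up of Heegaard Floer theory is fixed (path $\mathcal{J}_s$ of almost complex structures on $\mathrm{Sym}^g(\Sigma)$ with $\{z\}\times\mathrm{Sym}^{g-1}(\Sigma)$ complex, moduli spaces are Gromov compact manifolds, diagrams admissible). A boundary condition $B'=[(a_1,\dots,a_n)]$, $2\le n\le|B|$, is an element of $B^{\times n}\setminus\Delta_n$ ($\Delta_n$ the diagonal) up to rotation. $\mathcal{M}^\mu_{B'}$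 is the moduli space of unparametrized holomorphic Whitney $n$-gons $\phi\colon D^2\to\mathrm{Sym}^g(\Sigma)$ with vertices $p_1,\dots,p_n\in\partial D^2$, the edge $p_ip_{i+1}$ mapped to $\mathbb{T}_{a_i}$ (indices cyclic), Maslov index $\mu$ and $n_z(\phi)=0$ ($n_p$ = intersection number with $\{p\}\times\mathrm{Sym}^{g-1}(\Sigma)$). The vertex passed when going, in the boundary orientation, from edge $a_i$ to edge $a_{i+1}$ is denoted $(a_i,a_{i+1})$. A pointing is a set $\{(a_i,a_{i+1}),q\}$ with slot point $q\in\mathbb{T}_{a_i}\cap\mathbb{T}_{a_{i+1}}$. **Pre-generators.** A symbol $\mathcal{A}=A_{(P^\bullet,F^\downarrow,F^\uparrow)}$ consists of $A=\mathcal{M}^\mu_{B'}$ ($\mu\le2$ if $n=2$, $\mu\le1$ otherwise), sets $P^\bullet$ (pointings) and $F^\uparrow$ (flow-out vertices) of pointings of $A$, and a set $F^\downarrow$ (flow-in vertices) of vertices of $A$, each vertex appearing at most once in each set. It is a pre-generator if every vertex is pointed, flow-in or flow-out; a generator if moreover $\#F^\downarrow>0$ and $\#F^\uparrow=1$; fully pointed if $F^\downarrow=F^\uparrow=\emptyset$. $\pi(\mathcal{A})$ is the moduli space obtained from $A$ by imposing the slot points in $P^\bullet,F^\uparrow$ at the corresponding vertices. $\mathcal{G}$ is the set of generators. **Algebras.** $\mathbb{F}$ is the free commutative polynomial $\mathbb{Z}_2$-algebra (product $\bullet$) on fully pointed pre-generators modulo $\mathcal{A}=0$ if $\pi(\mathcal{A})=\emptyset$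 and $\mathcal{A}=1$ if $\pi(\mathcal{A})\neq\emptyset$ and $A$ consists of bigons of Maslov index $0$. $\mathcal{T}$ is the free non-commutative $\mathbb{F}$-algebra (sum $+$, product $\times$) on the not fully pointed pre-generators modulo $\mathcal{A}=0$ if $\pi(\mathcal{A})=\emptyset$; $\widehat{\mathcal{T}}=\mathcal{T}\cup\{\widehat\Omega\}$. For a set $Q$ of pointings let $\mathfrak{D}(Q)$ be its set of vertices, $\mathcal{K}^{\downarrow,Q}(P^\bullet,F^\downarrow,F^\uparrow)=(P^\bullet\cup Q,F^\downarrow\setminus\mathfrak{D}(Q),F^\uparrow)$, $\mathcal{K}^\uparrow(P^\bullet,F^\downarrow,F^\uparrow)=(P^\bullet\cup F^\uparrow,F^\downarrow,\emptyset)$, acting on pre-generators through their data; when a flow-out vertex of one polygon is compared with a flow-in vertex of another, $(a,b)$ is identified with $(b,a)$. For a product $\mathcal{C}=\mathcal{C}_1\times\dots\times\mathcal{C}_k$ of pre-generators and a vertex $s$, $\mathfrak{m}^{\mathcal{C}}(s)$ (resp. $\mathfrak{m}_{\mathcal{C}}(s)$) is the number of occurrences of $s$ in $\bigsqcup_iF^\downarrow(\mathcal{C}_i)$ (resp. $\bigsqcup_i\mathfrak{D}(F^\uparrow(\mathcal{C}_i))$). *Sum:* $\widehat\Omega$ is absorbing; for products $\mathcal{R},\mathcal{C}$ of pre-generators and $f,g\in\mathbb{F}$, $f\bullet\mathcal{R}\boxplus g\bullet\mathcal{C}=f\bullet\mathcal{R}+g\bullet\mathcal{C}$ if $\mathfrak{m}^{\mathcal{C}}\equiv\mathfrak{m}^{\mathcal{R}}$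 and $\mathfrak{m}_{\mathcal{C}}\equiv\mathfrak{m}_{\mathcal{R}}$, and $=\widehat\Omega$ otherwise; for general elements, the $\boxplus$-sum of all summands. *Product:* $\widehat\Omega$ is absorbing; for pre-generators, if $\mathfrak{D}(F^\uparrow(\mathcal{A}))\subset F^\downarrow(\mathcal{B})$ then $(f\bullet\mathcal{A})\boxtimes(g\bullet\mathcal{B})=(f\bullet\mathcal{K}^\uparrow(\mathcal{A}))\times(g\bullet\mathcal{K}^{\downarrow,F^\uparrow(\mathcal{A})}(\mathcal{B}))$, with $\times$ replaced by $\bullet$ if a factor lies in $\mathbb{F}$; otherwise it is $\widehat\Omega$. For products, $(f\bullet\mathcal{R}_1\times\dots\times\mathcal{R}_l)\boxtimes(g\bullet\mathcal{C}_1\times\dots\times\mathcal{C}_k)=(fg)\bullet\mathcal{R}_1\times\dots\times\mathcal{R}_{l-1}\times(\mathcal{R}_l\boxtimes\mathcal{C}_1)\times\mathcal{C}_2\times\dots\times\mathcal{C}_k$ (with $\bullet$ instead of $\times$ next to elements of $\mathbb{F}$); extended by $\mathcal{A}\boxtimes(\mathcal{B}+\mathcal{C})=(\mathcal{A}\boxtimes\mathcal{B})\boxplus(\mathcal{A}\boxtimes\mathcal{C})$ and likewise on the other side. The symbol algebra $\widehat{\mathcal{S}}$ is the $\mathbb{F}$-subsemialgebra of $(\widehat{\mathcal{T}},\boxplus,\boxtimes)$ generated by $\mathcal{G}$. **Differential and symbol homology.** For a generator $\mathcal{A}$, the codimension-1 boundary of $\pi(\mathcal{A})$ is the disjoint union,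 over pairs of edges $a\ne b$ (ordered so that starting from the flow-out vertex in the boundary direction one meets $b$ first, then $a$) and $q\in\mathbb{T}_a\cap\mathbb{T}_b$, of products $A_1^{ab;q}\times A_2^{ab;q}$, obtained by pinching an arc from edge $a$ to edge $b$; the piece $A_i$ has one new vertex $v_i$, mapped to $q$, and $A_2$ contains the flow-out vertex. Old vertices keep their decorations. If $A_1$ has a flow-in vertex ($(a,b)$ is nice), $v_1$ becomes the flow-out vertex $\{(a,b),q\}$ and $v_2$ the flow-in vertex $(b,a)$; otherwise $v_1,v_2$ become pointed with slot point $q$ (so $\mathcal{A}_1^{ab;q}\in\mathbb{F}$). Then $\partial_{\mathfrak{sh}}\mathcal{A}$ is the $\boxplus$-sum of all $\mathcal{A}_1^{ab;q}\boxtimes\mathcal{A}_2^{ab;q}$ ($(a,b)$ nice) and all $\mathcal{A}_1^{ab;q}\bullet\mathcal{A}_2^{ab;q}$ ($(a,b)$ not nice). In the same way $\partial_{\mathbb{F}}\mathcal{A}=\sum\mathcal{A}_1^{ab;q}\bullet\mathcal{A}_2^{ab;q}$ for fully pointed $\mathcal{A}$, extended to $\mathbb{F}$ linearly with the Leibniz rule. $\partial_{\mathfrak{sh}}$ extends to $\widehat{\mathcal{S}}$ by $\partial_{\mathfrak{sh}}\widehat\Omega=0$, $\boxplus$-additivity, and the Leibniz rules $\partial_{\mathfrak{sh}}(f\bullet\mathcal{A})=\partial_{\mathbb{F}}(f)\bullet\mathcal{A}\boxplus f\bullet\partial_{\mathfrak{sh}}\mathcal{A}$, $\partial_{\mathfrak{sh}}(\mathcal{A}_1\boxtimes\mathcal{A}_2)=\partial_{\mathfrak{sh}}\mathcal{A}_1\boxtimes\mathcal{A}_2\boxplus\mathcal{A}_1\boxtimes\partial_{\mathfrak{sh}}\mathcal{A}_2$.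 The symbol homology $\mathfrak{sh}_*$ is the homology of $(\widehat{\mathcal{S}},\partial_{\mathfrak{sh}})$, with induced operations $\boxplus,\boxtimes$. **Symbols as maps.** $\mathfrak{ev}$ sends a generator $\mathcal{A}$ with slot points $\underline q$ in $P^\bullet$ and $r$ in $F^\uparrow$ to the $\mathbb{Z}_2$-linear map from the tensor product of the chain modules $\widehat{CF}(a,b)$ over the flow-in vertices to that of the flow-out vertex, $\underline x\mapsto\#A(\underline x,\underline q,r)\cdot r$ (mod 2 count of $0$-dimensional components); coefficients in $\mathbb{F}$ go to $\mathbb{Z}_2$ by the algebra morphism $\mathcal{A}\mapsto\#\pi(\mathcal{A})$, $\boxplus$ to sum of maps, and $\mathcal{A}_1\boxtimes\mathcal{A}_2$ to the composition of $\mathfrak{ev}(\mathcal{A}_1)$ followed by $\mathfrak{ev}(\mathcal{A}_2)$ (inserted in the corresponding tensor factor). It descends to $\mathfrak{ev}_*$ on $\mathfrak{sh}_*$. **$U$-equivariant version.** Let $w\in\Sigma$ be a second base point in the complement of all attaching circles, and let $\mathcal{J}_s$ be $w$-respectful ($\{w\}\times\mathrm{Sym}^{g-1}(\Sigma)$ is complex). Put $\mathcal{M}^{\mu;i}_{B'}=\{\phi\in\mathcal{M}^\mu_{B'}\mid n_w(\phi)=i\}$. Repeat the construction with the spaces $\mathcal{M}^{\mu;i}_{B'}$, using the polynomial ring $\mathbb{F}[U]$ over the resulting coefficient algebra in place of $\mathbb{F}$, and with $U$ satisfying $(U\bullet\mathcal{A})\boxplus(U\bullet\mathcal{B})=U\bullet(\mathcal{A}\boxplus\mathcal{B})$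 and $(U\bullet\mathcal{A})\boxtimes\mathcal{B}=U\bullet(\mathcal{A}\boxtimes\mathcal{B})=\mathcal{A}\boxtimes(U\bullet\mathcal{B})$. The result is a symbol algebra $\widehat{\mathcal{S}}_U$ with homology $\mathfrak{sh}_{U,*}$; its elements are interpreted, in the same way, as maps between the complexes $CFK^{\bullet,-}$ (free $\mathbb{Z}_2[U]$-modules on intersection points, differential counting disks with $n_z=0$ weighted by $U^{n_w}$). The morphism of semialgebras $\mathfrak{F}_U\colon\widehat{\mathcal{S}}\to\widehat{\mathcal{S}}_U$ is determined by $\mathfrak{F}_U(\widehat\Omega)=\widehat\Omega$ and, for a generator $\mathcal{A}=(\mathcal{M}^\mu_{B'})_{(P^\bullet,F^\downarrow,F^\uparrow)}$, $\mathfrak{F}_U(\mathcal{A})=\boxplus_i\,U^i\bullet\mathcal{A}^i$ with $\mathcal{A}^i=(\mathcal{M}^{\mu;i}_{B'})_{(P^\bullet,F^\downarrow,F^\uparrow)}$ (a finite sum; similarly on fully pointed pre-generators). It induces $\mathfrak{F}_{U;*}\colon\mathfrak{sh}_*\to\mathfrak{sh}_{U,*}$. **Properties.** $\mathfrak{sh}_*\{X\}$ is the non-commutative polynomial algebra in one variable $X$ over $\mathfrak{sh}_*$, formed with $\boxplus$ and $\boxtimes$; $\mathbb{P}(\mathcal{G})$ is its set of polynomials of degree at least one. $\mathfrak{s}$ (and also the map $\mathfrak{ev}(\mathfrak{s})$) has property $P$ if $P(\mathfrak{s})=0$. $P_{\mathfrak{F}_U}$ is obtained from $P$ by applying $\mathfrak{F}_{U;*}$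 to all coefficients, with $X\mapsto X$. *)

theory Defs
  imports
    "HOL-Complex_Analysis.Complex_Analysis"
    "HOL-Homology.Homology"
    "HOL-Library.Poly_Mapping"
    "HOL-Library.Z2"
    "HOL-Library.Multiset"
    "HOL-Computational_Algebra.Polynomial"
begin

section \<open>Surfaces, attaching circles, symmetric products\<close>

text \<open>
  A set of attaching circles is a set of subsets of the surface; a point of the \<open>g\<close>-fold
  symmetric product is a multiset of size \<open>g\<close>.  A vertex \<open>(a, b)\<close> is the one passed when going
  from edge \<open>a\<close> to edge \<open>b\<close> in the boundary orientation.  A marked polygon \<open>(as, \<phi>, ps)\<close>
  consists of a boundary condition, a map on the closed unit disk and the vertices: the edge
  from \<open>ps ! i\<close> to \<open>ps ! (i + 1)\<close> carries \<open>as ! i\<close>.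
\<close>

type_synonym 'a circles = "'a set set"
type_synonym 'a vertex = "'a circles \<times> 'a circles"
type_synonym 'a pointing = "'a vertex \<times> 'a multiset"
type_synonym 'a polygon = "'a circles list \<times> (complex \<Rightarrow> 'a multiset) \<times> complex list"

text \<open>
  The fields \<open>pseudo_hol\<close> and \<open>maslov\<close> are the analytic part of the set-up, which is fixed once
  and for all: being a solution of the Cauchy-Riemann equation given by the chosen path of almost
  complex structures, and the Maslov index.  The holomorphic atlas \<open>charts\<close> encodes the
  orientation (and the complex structure) of the surface.
\<close>

record 'a heegaard =
  surf :: "'a topology"
  charts :: "('a set \<times> ('a \<Rightarrow> complex)) set"
  genus :: nat
  circle_sets :: "'a circles set"
  z_pt :: 'a
  w_pt :: 'a
  pseudo_hol :: "'a polygon \<Rightarrow> bool"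
  maslov :: "'a polygon \<Rightarrow> int"

definition closed_oriented_surface ::
  "'a topology \<Rightarrow> ('a set \<times> ('a \<Rightarrow> complex)) set \<Rightarrow> nat \<Rightarrow> bool" where
  "closed_oriented_surface X C g \<longleftrightarrow>
     compact_space X \<and> Hausdorff_space X \<and> connected_space X \<and> topspace X \<noteq> {} \<and>
     (\<forall>(V, f)\<in>C. openin X V \<and> open (f ` V) \<and>
        homeomorphic_map (subtopology X V) (top_of_set (f ` V)) f) \<and>
     (\<Union>(V, f)\<in>C. V) = topspace X \<and>
     (\<forall>(V, f)\<in>C. \<forall>(W, h)\<in>C. (h \<circ> inv_into V f) holomorphic_on f ` (V \<inter> W)) \<and>
     homology_group 1 X \<cong> free_Abelian_group {..<2 * g}"

text \<open>
  Linear independence in first homology: the class of the circle parametrised by \<open>\<gamma> c\<close> is the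
  image of a generator of the first homology group of the standard circle.
\<close>

definition attaching_circles :: "'a topology \<Rightarrow> nat \<Rightarrow> 'a circles \<Rightarrow> bool" where
  "attaching_circles X g \<alpha> \<longleftrightarrow>
     finite \<alpha> \<and> card \<alpha> = g \<and> pairwise disjnt \<alpha> \<and>
     (\<exists>\<gamma>. (\<forall>c\<in>\<alpha>. embedding_map (nsphere 1) X (\<gamma> c) \<and> \<gamma> c ` topspace (nsphere 1) = c) \<and>
        (\<forall>e\<in>carrier (homology_group 1 (nsphere 1)).
           generate (homology_group 1 (nsphere 1)) {e} = carrier (homology_group 1 (nsphere 1)) \<longrightarrow>
           (\<forall>k :: 'a set \<Rightarrow> int.
              finprod (homology_group 1 X)
                (\<lambda>c. hom_induced 1 (nsphere 1) {} X {} (\<gamma> c) e [^]\<^bsub>homology_group 1 X\<^esub> k c) \<alpha>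
                = \<one>\<^bsub>homology_group 1 X\<^esub>
              \<longrightarrow> (\<forall>c\<in>\<alpha>. k c = 0))))"

definition sym_space :: "'a topology \<Rightarrow> nat \<Rightarrow> 'a multiset set" where
  "sym_space X g = {D. set_mset D \<subseteq> topspace X \<and> size D = g}"

definition sym_topology :: "'a topology \<Rightarrow> nat \<Rightarrow> 'a multiset topology" where
  "sym_topology X g = topology (\<lambda>W. W \<subseteq> sym_space X g \<and>
     openin (product_topology (\<lambda>_. X) {..<g})
       {x \<in> topspace (product_topology (\<lambda>_. X) {..<g}). image_mset x (mset_set {..<g}) \<in> W})"

lemma openin_sym_topology:
  "openin (sym_topology X g) W \<longleftrightarrow> W \<subseteq> sym_space X g \<and>
     openin (product_topology (\<lambda>_. X) {..<g})
       {x \<in> topspace (product_topology (\<lambda>_. X) {..<g}). image_mset x (mset_set {..<g}) \<in> W}"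
proof -
  let ?Y = "product_topology (\<lambda>_. X) {..<g}"
  let ?pre = "\<lambda>W. {x \<in> topspace ?Y. image_mset x (mset_set {..<g}) \<in> W}"
  have "istopology (\<lambda>W. W \<subseteq> sym_space X g \<and> openin ?Y (?pre W))"
    unfolding istopology_def
  proof (intro conjI allI impI)
    fix S T assume "S \<subseteq> sym_space X g \<and> openin ?Y (?pre S)"
      and "T \<subseteq> sym_space X g \<and> openin ?Y (?pre T)"
    moreover have "?pre (S \<inter> T) = ?pre S \<inter> ?pre T" by blast
    ultimately show "S \<inter> T \<subseteq> sym_space X g" "openin ?Y (?pre (S \<inter> T))"
      by auto
  next
    fix K assume K: "\<forall>W\<in>K. W \<subseteq> sym_space X g \<and> openin ?Y (?pre W)"
    then show "\<Union>K \<subseteq> sym_space X g" by blast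
    have "?pre (\<Union>K) = \<Union>(?pre ` K)" by blast
    then show "openin ?Y (?pre (\<Union>K))" using K by auto
  qed
  then show ?thesis by (simp add: sym_topology_def)
qed

definition torus :: "'a circles \<Rightarrow> 'a multiset set" where
  "torus \<alpha> = {image_mset x (mset_set \<alpha>) | x. \<forall>c\<in>\<alpha>. x c \<in> c}"

section \<open>Whitney polygons and moduli spaces\<close>

definition whitney_polygon :: "'a heegaard \<Rightarrow> 'a polygon \<Rightarrow> bool" where
  "whitney_polygon H = (\<lambda>(as, \<phi>, ps).
     length ps = length as \<and>
     (\<forall>y. y \<notin> cball 0 1 \<longrightarrow> \<phi> y = {#}) \<and>
     continuous_map (top_of_set (cball 0 1)) (sym_topology (surf H) (genus H)) \<phi> \<and>
     (\<exists>\<theta> :: nat \<Rightarrow> real.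
        (\<forall>i<length as. ps ! i = cis (\<theta> i) \<and> \<theta> i < \<theta> (Suc i)) \<and>
        \<theta> (length as) = \<theta> 0 + 2 * pi \<and>
        (\<forall>i<length as. \<forall>t\<in>{\<theta> i..\<theta> (Suc i)}. \<phi> (cis t) \<in> torus (as ! i))))"

text \<open>
  The intersection number with the divisor of all multisets containing \<open>p\<close> is the sum of the
  local ones.  Near \<open>y\<close> the divisor is the zero set of the product of \<open>f x - f p\<close> over the points
  \<open>x\<close> in a small neighbourhood \<open>W\<close> of \<open>p\<close>, where \<open>f\<close> is a chart, so the local intersection number
  is the winding number of this product along small circles around \<open>y\<close>.
\<close>

definition local_intersection :: "'a heegaard \<Rightarrow> 'a \<Rightarrow> (complex \<Rightarrow> 'a multiset) \<Rightarrow> complex \<Rightarrow> int" where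
  "local_intersection H p \<phi> y = (THE k. \<exists>V f W. (V, f) \<in> charts H \<and>
     openin (surf H) W \<and> p \<in> W \<and> W \<subseteq> V \<and>
     (\<forall>x\<in>#\<phi> y. x \<in> surf H closure_of W \<longrightarrow> x = p) \<and>
     (\<forall>\<^sub>F r in at_right 0.
        winding_number
          ((\<lambda>y'. \<Prod>x\<in>#filter_mset (\<lambda>x. x \<in> W) (\<phi> y'). f x - f p) \<circ> circlepath y r) 0 = of_int k))"

definition intersection_number :: "'a heegaard \<Rightarrow> 'a \<Rightarrow> 'a polygon \<Rightarrow> int" where
  "intersection_number H p = (\<lambda>(as, \<phi>, ps).
     \<Sum>y\<in>{y \<in> ball 0 1. p \<in># \<phi> y}. local_intersection H p \<phi> y)"

definition disk_automorphism :: "(complex \<Rightarrow> complex) \<Rightarrow> bool" where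
  "disk_automorphism \<psi> \<longleftrightarrow> continuous_on (cball 0 1) \<psi> \<and> \<psi> holomorphic_on ball 0 1 \<and>
     bij_betw \<psi> (cball 0 1) (cball 0 1) \<and> bij_betw \<psi> (ball 0 1) (ball 0 1)"

fun reparametrization :: "'a polygon \<Rightarrow> 'a polygon \<Rightarrow> bool" where
  "reparametrization (as, \<phi>, ps) (as', \<phi>', ps') \<longleftrightarrow> (\<exists>k \<psi>. disk_automorphism \<psi> \<and>
     as' = rotate k as \<and> length ps' = length ps \<and> set ps' \<subseteq> cball 0 1 \<and> map \<psi> ps' = rotate k ps \<and>
     \<phi>' = (\<lambda>y. if y \<in> cball 0 1 then \<phi> (\<psi> y) else {#}))"

definition unparametrized :: "'a polygon \<Rightarrow> 'a polygon set" where
  "unparametrized p = {p'. reparametrization p p'}"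

text \<open>A boundary condition up to rotation is the set of all rotations of a list.\<close>

definition rot_class :: "'b list \<Rightarrow> 'b list set" where
  "rot_class xs = {rotate k xs | k. True}"

definition cyclic_pairs :: "'b list \<Rightarrow> ('b \<times> 'b) set" where
  "cyclic_pairs xs = set (zip xs (rotate1 xs))"

definition linear_pairs :: "'b list \<Rightarrow> ('b \<times> 'b) set" where
  "linear_pairs xs = set (zip xs (tl xs))"

text \<open>The polygon maps its vertex \<open>v\<close> to \<open>q\<close>; the vertex after edge \<open>i\<close> is \<open>ps ! (i + 1)\<close>.\<close>

definition vertex_at :: "'a polygon \<Rightarrow> 'a vertex \<Rightarrow> 'a multiset \<Rightarrow> bool" where
  "vertex_at = (\<lambda>(as, \<phi>, ps) v q.
     \<exists>i<length as. v = (as ! i, rotate1 as ! i) \<and> \<phi> (rotate1 ps ! i) = q)"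

section \<open>Symbols\<close>

text \<open>
  \<open>Symb B' \<mu> i P F G\<close> is the moduli space with boundary condition \<open>B'\<close> and Maslov index \<open>\<mu>\<close>,
  decorated with pointings \<open>P\<close>, flow-in vertices \<open>F\<close> and flow-out vertices \<open>G\<close>.  The weight \<open>i\<close> is
  \<open>None\<close> if there is no condition on the intersection number at \<open>w\<close>, and \<open>Some j\<close> for the
  subspace where it equals \<open>j\<close>; the plain and the equivariant theory use the first and the second
  kind of symbols and are otherwise given by the same construction.
\<close>

datatype 'a symb =
  Symb (bdry: "'a circles list set") (index: int) (weight: "nat option")
    (pointed: "'a pointing set") (flow_in: "'a vertex set") (flow_out: "'a pointing set")

datatype version = Plain | Equivariant

fun weights :: "version \<Rightarrow> nat option set" where
  "weights Plain = {None}"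
| "weights Equivariant = range Some"

definition vertices :: "'a symb \<Rightarrow> 'a vertex set" where
  "vertices A = (\<Union>as\<in>bdry A. cyclic_pairs as)"

definition arity :: "'a symb \<Rightarrow> nat" where
  "arity A = card (vertices A)"

definition param_moduli :: "'a heegaard \<Rightarrow> 'a circles list set \<Rightarrow> int \<Rightarrow> nat option \<Rightarrow> 'a polygon set" where
  "param_moduli H B' \<mu> i = {p. fst p \<in> B' \<and> whitney_polygon H p \<and> pseudo_hol H p \<and>
     maslov H p = \<mu> \<and> intersection_number H (z_pt H) p = 0 \<and>
     (\<forall>j. i = Some j \<longrightarrow> intersection_number H (w_pt H) p = int j)}"

definition moduli :: "'a heegaard \<Rightarrow> 'a circles list set \<Rightarrow> int \<Rightarrow> nat option \<Rightarrow> 'a polygon set set" where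
  "moduli H B' \<mu> i = unparametrized ` param_moduli H B' \<mu> i"

definition slot_moduli :: "'a heegaard \<Rightarrow> 'a symb \<Rightarrow> 'a polygon set set" where
  "slot_moduli H A = unparametrized ` {p \<in> param_moduli H (bdry A) (index A) (weight A).
     \<forall>(v, q)\<in>pointed A \<union> flow_out A. vertex_at p v q}"

definition boundary_condition :: "'a heegaard \<Rightarrow> 'a circles list set \<Rightarrow> bool" where
  "boundary_condition H B' \<longleftrightarrow> (\<exists>as. B' = rot_class as \<and> set as \<subseteq> circle_sets H \<and>
     distinct as \<and> 2 \<le> length as \<and> length as \<le> card (circle_sets H))"

definition pointings :: "'a symb \<Rightarrow> 'a pointing set \<Rightarrow> bool" where
  "pointings A Q \<longleftrightarrow> inj_on fst Q \<and>
     (\<forall>((a, b), q)\<in>Q. (a, b) \<in> vertices A \<and> q \<in> torus a \<inter> torus b)"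

definition pre_generator :: "'a heegaard \<Rightarrow> version \<Rightarrow> 'a symb \<Rightarrow> bool" where
  "pre_generator H ver A \<longleftrightarrow>
     boundary_condition H (bdry A) \<and> index A \<le> (if arity A = 2 then 2 else 1) \<and>
     weight A \<in> weights ver \<and>
     pointings A (pointed A) \<and> flow_in A \<subseteq> vertices A \<and> pointings A (flow_out A) \<and>
     fst ` pointed A \<union> flow_in A \<union> fst ` flow_out A = vertices A \<and>
     fst ` pointed A \<inter> flow_in A = {} \<and> fst ` pointed A \<inter> fst ` flow_out A = {} \<and>
     flow_in A \<inter> fst ` flow_out A = {}"

definition generator :: "'a heegaard \<Rightarrow> version \<Rightarrow> 'a symb \<Rightarrow> bool" where
  "generator H ver A \<longleftrightarrow> pre_generator H ver A \<and> flow_in A \<noteq> {} \<and> card (flow_out A) = 1"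

definition fully_pointed :: "'a symb \<Rightarrow> bool" where
  "fully_pointed A \<longleftrightarrow> flow_in A = {} \<and> flow_out A = {}"

text \<open>In \<open>Kdown\<close> the pointings in \<open>Q\<close> are named by the vertices of \<open>A\<close> itself.\<close>

definition Kup :: "'a symb \<Rightarrow> 'a symb" where
  "Kup A = Symb (bdry A) (index A) (weight A) (pointed A \<union> flow_out A) (flow_in A) {}"

definition Kdown :: "'a pointing set \<Rightarrow> 'a symb \<Rightarrow> 'a symb" where
  "Kdown Q A = Symb (bdry A) (index A) (weight A) (pointed A \<union> Q) (flow_in A - fst ` Q) (flow_out A)"

section \<open>The algebras\<close>

text \<open>
  Variables of the coefficient algebra are \<open>Some A\<close> for fully pointed symbols \<open>A\<close>, and \<open>None\<close> for
  the variable \<open>U\<close> of the equivariant theory.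
\<close>

type_synonym 'a coef = "('a symb option \<Rightarrow>\<^sub>0 nat) \<Rightarrow>\<^sub>0 bit"

text \<open>The free monoid, as an additive one, so that \<open>poly_mapping\<close> yields its monoid algebra.\<close>

datatype 'b fword = FWord (letters: "'b list")

instantiation fword :: (type) monoid_add
begin
definition zero_fword :: "'a fword" where "0 = FWord []"
definition plus_fword :: "'a fword \<Rightarrow> 'a fword \<Rightarrow> 'a fword" where
  "u + v = FWord (letters u @ letters v)"
instance by standard (simp_all add: zero_fword_def plus_fword_def)
end

type_synonym 'a talg = "'a symb fword \<Rightarrow>\<^sub>0 'a coef"

text \<open>\<open>None\<close> is the absorbing element that is adjoined to the tensor algebra.\<close>

type_synonym 'a that = "'a talg option"

abbreviation Omega :: "'a that" where "Omega \<equiv> None"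

definition word :: "'a symb list \<Rightarrow> 'a talg" where
  "word As = Poly_Mapping.single (FWord As) 1"

definition scal :: "'a coef \<Rightarrow> 'a talg" where
  "scal f = Poly_Mapping.single 0 f"

definition coef_scale :: "'a coef \<Rightarrow> 'a that \<Rightarrow> 'a that" where
  "coef_scale f = map_option (\<lambda>x. scal f * x)"

text \<open>
  Quotients of free algebras in which some variables become 0 or 1 are represented by normal
  forms: \<open>coef_of\<close> and \<open>talg_of\<close> give the normal form of a single pre-generator.
\<close>

definition coef_of :: "'a heegaard \<Rightarrow> 'a symb \<Rightarrow> 'a coef" where
  "coef_of H A = (if slot_moduli H A = {} then 0
     else if arity A = 2 \<and> index A = 0 then 1
     else Poly_Mapping.single (Poly_Mapping.single (Some A) 1) 1)"

definition U_coef :: "'a coef" where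
  "U_coef = Poly_Mapping.single (Poly_Mapping.single None 1) 1"

definition talg_of :: "'a heegaard \<Rightarrow> 'a symb \<Rightarrow> 'a talg" where
  "talg_of H A = (if fully_pointed A then scal (coef_of H A)
     else if slot_moduli H A = {} then 0 else word [A])"

text \<open>The algebra \<open>\<bbbF>\<close>, respectively \<open>\<bbbF>[U]\<close>.\<close>

inductive_set coef_alg :: "'a heegaard \<Rightarrow> version \<Rightarrow> 'a coef set" for H ver where
  "0 \<in> coef_alg H ver"
| "1 \<in> coef_alg H ver"
| "pre_generator H ver A \<Longrightarrow> fully_pointed A \<Longrightarrow> coef_of H A \<in> coef_alg H ver"
| "ver = Equivariant \<Longrightarrow> U_coef \<in> coef_alg H ver"
| "f \<in> coef_alg H ver \<Longrightarrow> g \<in> coef_alg H ver \<Longrightarrow> f + g \<in> coef_alg H ver"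
| "f \<in> coef_alg H ver \<Longrightarrow> g \<in> coef_alg H ver \<Longrightarrow> f * g \<in> coef_alg H ver"

text \<open>The multiplicities of flow-in and of flow-out vertices of a product of pre-generators.\<close>

definition flow_type :: "'a symb fword \<Rightarrow> ('a vertex \<Rightarrow> nat) \<times> ('a vertex \<Rightarrow> nat)" where
  "flow_type u = ((\<lambda>s. length (filter (\<lambda>A. s \<in> flow_in A) (letters u))),
     (\<lambda>s. length (filter (\<lambda>A. s \<in> fst ` flow_out A) (letters u))))"

text \<open>The \<open>\<boxplus>\<close>-sum of all summands of a finite family of elements.\<close>

definition boxsum :: "('i \<Rightarrow> 'a that) \<Rightarrow> 'i set \<Rightarrow> 'a that" where
  "boxsum x I = (if (\<exists>i\<in>I. x i = Omega) \<or>
       (\<exists>i\<in>I. \<exists>j\<in>I. \<exists>u\<in>Poly_Mapping.keys (the (x i)). \<exists>v\<in>Poly_Mapping.keys (the (x j)).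
          flow_type u \<noteq> flow_type v)
     then Omega else Some (\<Sum>i\<in>I. the (x i)))"

definition boxplus :: "'a that \<Rightarrow> 'a that \<Rightarrow> 'a that" (infixl \<open>\<boxplus>\<close> 65) where
  "x \<boxplus> y = boxsum (\<lambda>b. if b then x else y) UNIV"

text \<open>
  A flow-out vertex \<open>(a, b)\<close> is compared with the flow-in vertex \<open>(b, a)\<close>.  Since \<open>talg_of\<close>
  takes values in scalars on fully pointed symbols, the multiplication of the tensor algebra
  covers both products.
\<close>

definition swap_pointings :: "'a pointing set \<Rightarrow> 'a pointing set" where
  "swap_pointings Q = map_prod prod.swap id ` Q"

definition boxtimes_words :: "'a heegaard \<Rightarrow> 'a symb fword \<Rightarrow> 'a symb fword \<Rightarrow> 'a that" where
  "boxtimes_words H u v =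
     (if u = 0 \<or> v = 0 then Some (word (letters (u + v)))
      else let R = last (letters u); C = hd (letters v); Q = swap_pointings (flow_out R) in
        if fst ` Q \<subseteq> flow_in C
        then Some (word (butlast (letters u)) * talg_of H (Kup R) * talg_of H (Kdown Q C)
                   * word (tl (letters v)))
        else Omega)"

definition boxtimes :: "'a heegaard \<Rightarrow> 'a that \<Rightarrow> 'a that \<Rightarrow> 'a that" where
  "boxtimes H x y = (case (x, y) of
     (Some a, Some b) \<Rightarrow>
        boxsum (\<lambda>(u, v). coef_scale (Poly_Mapping.lookup a u * Poly_Mapping.lookup b v) (boxtimes_words H u v))
          (Poly_Mapping.keys a \<times> Poly_Mapping.keys b)
   | _ \<Rightarrow> Omega)"

inductive_set symbol_algebra :: "'a heegaard \<Rightarrow> version \<Rightarrow> 'a that set" for H ver where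
  "generator H ver A \<Longrightarrow> Some (talg_of H A) \<in> symbol_algebra H ver"
| "Some 0 \<in> symbol_algebra H ver"
| "Omega \<in> symbol_algebra H ver"
| "x \<in> symbol_algebra H ver \<Longrightarrow> y \<in> symbol_algebra H ver \<Longrightarrow> x \<boxplus> y \<in> symbol_algebra H ver"
| "x \<in> symbol_algebra H ver \<Longrightarrow> y \<in> symbol_algebra H ver \<Longrightarrow> boxtimes H x y \<in> symbol_algebra H ver"
| "f \<in> coef_alg H ver \<Longrightarrow> x \<in> symbol_algebra H ver \<Longrightarrow> coef_scale f x \<in> symbol_algebra H ver"

section \<open>The differential\<close>

text \<open>
  The index is normalised so that the expected dimension of an unparametrized moduli space
  (including the variation of the conformal structure) is \<open>\<mu> - 1\<close> for bigons and \<open>\<mu>\<close> otherwise.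
\<close>

definition expected_dim :: "'a symb \<Rightarrow> int" where
  "expected_dim A = (if arity A = 2 then index A - 1 else index A)"

text \<open>
  \<open>edge_arc A a b\<close> lists the edges met when walking from edge \<open>a\<close> to edge \<open>b\<close>, both included.  Pinching
  an arc from edge \<open>a\<close> to edge \<open>b\<close> produces the polygon with edges \<open>edge_arc A b a\<close>, whose new vertex is
  \<open>(a, b)\<close>, and the polygon with edges \<open>edge_arc A a b\<close>, whose new vertex is \<open>(b, a)\<close>.  The order of the
  pair is fixed by requiring that the flow-out vertex belongs to the second one; for fully pointed
  symbols an arbitrary vertex plays this role, so that every unordered pair occurs once.
\<close>

definition edge_arc :: "'a symb \<Rightarrow> 'a circles \<Rightarrow> 'a circles \<Rightarrow> 'a circles list" where
  "edge_arc A a b = (THE es. \<exists>us vs. es = a # us @ [b] \<and> a # us @ b # vs \<in> bdry A)"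

definition base_vertex :: "'a symb \<Rightarrow> 'a vertex" where
  "base_vertex A = (if flow_out A = {} then SOME r. r \<in> vertices A else SOME r. r \<in> fst ` flow_out A)"

definition cuts :: "'a symb \<Rightarrow> ('a circles \<times> 'a circles \<times> 'a multiset) set" where
  "cuts A = {(a, b, q). (\<exists>us vs. a # us @ b # vs \<in> bdry A) \<and>
     base_vertex A \<in> linear_pairs (edge_arc A a b) \<and> q \<in> torus a \<inter> torus b}"

fun weight_splits :: "nat option \<Rightarrow> (nat option \<times> nat option) set" where
  "weight_splits None = {(None, None)}"
| "weight_splits (Some i) = {(Some j, Some k) | j k. j + k = i}"

definition nice :: "'a symb \<Rightarrow> 'a circles \<Rightarrow> 'a circles \<Rightarrow> bool" where
  "nice A a b \<longleftrightarrow> flow_in A \<inter> linear_pairs (edge_arc A b a) \<noteq> {}"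

text \<open>In a one-dimensional moduli space the pieces of the boundary are zero-dimensional.\<close>

definition rigid_index :: "'a circles list \<Rightarrow> int" where
  "rigid_index es = (if length es = 2 then 1 else 0)"

definition piece1 :: "'a symb \<Rightarrow> 'a circles \<Rightarrow> 'a circles \<Rightarrow> 'a multiset \<Rightarrow> nat option \<Rightarrow> 'a symb" where
  "piece1 A a b q j = (let es = edge_arc A b a; old = linear_pairs es in
     Symb (rot_class es) (rigid_index es) j
       ({(v, p) \<in> pointed A. v \<in> old} \<union> (if nice A a b then {} else {((a, b), q)}))
       (flow_in A \<inter> old)
       (if nice A a b then {((a, b), q)} else {}))"

definition piece2 :: "'a symb \<Rightarrow> 'a circles \<Rightarrow> 'a circles \<Rightarrow> 'a multiset \<Rightarrow> nat option \<Rightarrow> 'a symb" where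
  "piece2 A a b q k = (let es = edge_arc A a b; old = linear_pairs es in
     Symb (rot_class es) (rigid_index es) k
       ({(v, p) \<in> pointed A. v \<in> old} \<union> (if nice A a b then {} else {((b, a), q)}))
       (flow_in A \<inter> old \<union> (if nice A a b then {(b, a)} else {}))
       {(v, p) \<in> flow_out A. v \<in> old})"

definition boundary_gen :: "'a heegaard \<Rightarrow> 'a symb \<Rightarrow> 'a that" where
  "boundary_gen H A = (if expected_dim A = 1 then
     boxsum (\<lambda>((a, b, q), (j, k)).
        if nice A a b
        then boxtimes H (Some (talg_of H (piece1 A a b q j))) (Some (talg_of H (piece2 A a b q k)))
        else coef_scale (coef_of H (piece1 A a b q j)) (Some (talg_of H (piece2 A a b q k))))
       (cuts A \<times> weight_splits (weight A))
     else Some 0)"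

definition boundary_pointed :: "'a heegaard \<Rightarrow> 'a symb \<Rightarrow> 'a coef" where
  "boundary_pointed H A = (if expected_dim A = 1 then
     (\<Sum>((a, b, q), (j, k))\<in>cuts A \<times> weight_splits (weight A).
        coef_of H (piece1 A a b q j) * coef_of H (piece2 A a b q k))
     else 0)"

text \<open>
  The differentials are given by their graphs: the smallest relations closed under the defining
  rules.  Additivity and the Leibniz rule only make sense for sums and products different from
  \<open>\<Omega>\<close>, since the differential of \<open>\<Omega>\<close> is 0.
\<close>

inductive diff_coef :: "'a heegaard \<Rightarrow> version \<Rightarrow> 'a coef \<Rightarrow> 'a coef \<Rightarrow> bool" for H ver where
  "diff_coef H ver 0 0"
| "diff_coef H ver 1 0"
| "pre_generator H ver A \<Longrightarrow> fully_pointed A \<Longrightarrow> diff_coef H ver (coef_of H A) (boundary_pointed H A)"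
| "ver = Equivariant \<Longrightarrow> diff_coef H ver U_coef 0"
| "diff_coef H ver f f' \<Longrightarrow> diff_coef H ver g g' \<Longrightarrow> diff_coef H ver (f + g) (f' + g')"
| "diff_coef H ver f f' \<Longrightarrow> diff_coef H ver g g' \<Longrightarrow> diff_coef H ver (f * g) (f' * g + f * g')"

inductive sh_diff :: "'a heegaard \<Rightarrow> version \<Rightarrow> 'a that \<Rightarrow> 'a that \<Rightarrow> bool" for H ver where
  "generator H ver A \<Longrightarrow> sh_diff H ver (Some (talg_of H A)) (boundary_gen H A)"
| "sh_diff H ver (Some 0) (Some 0)"
| "sh_diff H ver Omega (Some 0)"
| "sh_diff H ver x x' \<Longrightarrow> sh_diff H ver y y' \<Longrightarrow> x \<boxplus> y \<noteq> Omega \<Longrightarrow> sh_diff H ver (x \<boxplus> y) (x' \<boxplus> y')"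
| "sh_diff H ver x x' \<Longrightarrow> sh_diff H ver y y' \<Longrightarrow> boxtimes H x y \<noteq> Omega \<Longrightarrow>
     sh_diff H ver (boxtimes H x y) (boxtimes H x' y \<boxplus> boxtimes H x y')"
| "diff_coef H ver f f' \<Longrightarrow> sh_diff H ver x x' \<Longrightarrow> x \<noteq> Omega \<Longrightarrow>
     sh_diff H ver (coef_scale f x) (coef_scale f' x \<boxplus> coef_scale f x')"

section \<open>Symbol homology\<close>

definition cycles :: "'a heegaard \<Rightarrow> version \<Rightarrow> 'a that set" where
  "cycles H ver = {x. sh_diff H ver x (Some 0)}"

text \<open>
  Homology is the quotient of the cycles by the boundaries, with induced operations.  The operations
  are regarded as partial, \<open>\<Omega>\<close> marking undefined values: the equivalence is the congruence of this
  partial algebra that is generated by identifying boundaries with 0.  (For cycles of equal type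
  it contains the usual relation, because \<open>y = x \<boxplus> b\<close> for the boundary \<open>b = x \<boxplus> y\<close>.)  A sum or
  product of classes is defined if it is defined for some representatives, and is the class of
  \<open>\<Omega>\<close> otherwise.
\<close>

inductive homologous :: "'a heegaard \<Rightarrow> version \<Rightarrow> 'a that \<Rightarrow> 'a that \<Rightarrow> bool" for H ver where
  boundary: "b \<in> cycles H ver \<Longrightarrow> sh_diff H ver c b \<Longrightarrow> b \<noteq> Omega \<Longrightarrow> homologous H ver b (Some 0)"
| refl: "x \<in> cycles H ver \<Longrightarrow> homologous H ver x x"
| sym: "homologous H ver x y \<Longrightarrow> homologous H ver y x"
| trans: "homologous H ver x y \<Longrightarrow> homologous H ver y z \<Longrightarrow> homologous H ver x z"
| plus: "homologous H ver x x' \<Longrightarrow> homologous H ver y y' \<Longrightarrow> x \<boxplus> y \<noteq> Omega \<Longrightarrow> x' \<boxplus> y' \<noteq> Omega \<Longrightarrow>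
     homologous H ver (x \<boxplus> y) (x' \<boxplus> y')"
| times: "homologous H ver x x' \<Longrightarrow> homologous H ver y y' \<Longrightarrow>
     boxtimes H x y \<noteq> Omega \<Longrightarrow> boxtimes H x' y' \<noteq> Omega \<Longrightarrow>
     homologous H ver (boxtimes H x y) (boxtimes H x' y')"

definition hclass :: "'a heegaard \<Rightarrow> version \<Rightarrow> 'a that \<Rightarrow> 'a that set" where
  "hclass H ver x = {y. homologous H ver x y}"

definition symbol_homology :: "'a heegaard \<Rightarrow> version \<Rightarrow> 'a that set set" where
  "symbol_homology H ver = hclass H ver ` cycles H ver"

definition induced_op ::
  "'a heegaard \<Rightarrow> version \<Rightarrow> ('a that \<Rightarrow> 'a that \<Rightarrow> 'a that) \<Rightarrow> 'a that set \<Rightarrow> 'a that set \<Rightarrow> 'a that set" where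
  "induced_op H ver opr X Y =
     (if \<exists>x\<in>X. \<exists>y\<in>Y. opr x y \<noteq> Omega
      then \<Union>{hclass H ver (opr x y) | x y. x \<in> X \<and> y \<in> Y \<and> opr x y \<noteq> Omega}
      else hclass H ver Omega)"

text \<open>
  Non-commutative polynomials in one variable, as formal expressions: the induced operations need
  not be associative when intermediate results are 0 or \<open>\<Omega>\<close>, so all bracketings are kept apart.
\<close>

datatype 'c npoly = Coef 'c | Var | NSum "'c npoly" "'c npoly" | NProd "'c npoly" "'c npoly"

fun npoly_degree :: "'c npoly \<Rightarrow> nat" where
  "npoly_degree (Coef c) = 0"
| "npoly_degree Var = 1"
| "npoly_degree (NSum p q) = max (npoly_degree p) (npoly_degree q)"
| "npoly_degree (NProd p q) = npoly_degree p + npoly_degree q"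

definition property_polys :: "'a heegaard \<Rightarrow> version \<Rightarrow> 'a that set npoly set" where
  "property_polys H ver = {P. set_npoly P \<subseteq> symbol_homology H ver \<and> 1 \<le> npoly_degree P}"

fun npoly_value :: "'a heegaard \<Rightarrow> version \<Rightarrow> 'a that set npoly \<Rightarrow> 'a that set \<Rightarrow> 'a that set" where
  "npoly_value H ver (Coef c) s = c"
| "npoly_value H ver Var s = s"
| "npoly_value H ver (NSum p q) s =
     induced_op H ver (\<boxplus>) (npoly_value H ver p s) (npoly_value H ver q s)"
| "npoly_value H ver (NProd p q) s =
     induced_op H ver (boxtimes H) (npoly_value H ver p s) (npoly_value H ver q s)"

definition has_property :: "'a heegaard \<Rightarrow> version \<Rightarrow> 'a that set npoly \<Rightarrow> 'a that set \<Rightarrow> bool" where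
  "has_property H ver P s \<longleftrightarrow> npoly_value H ver P s = hclass H ver (Some 0)"

section \<open>Symbols as maps\<close>

text \<open>
  Maps between tensor products of Floer chain modules are given by their matrices with respect
  to the bases of intersection points.  A basis vector of the source is a function \<open>x\<close>, where
  \<open>x s m\<close> is the entry in the tensor factor of the \<open>m\<close>-th occurrence of the flow-in vertex \<open>s\<close>.
  Matrix entries are polynomials in \<open>U\<close>, which are constant in the plain theory.
\<close>

type_synonym 'a floer_map = "('a vertex \<Rightarrow> nat \<Rightarrow> 'a multiset) \<Rightarrow> 'a multiset \<Rightarrow> bit poly"

text \<open>Constant bigons (index 0) count as rigid.\<close>

definition symb_count :: "'a heegaard \<Rightarrow> 'a symb \<Rightarrow> ('a vertex \<Rightarrow> 'a multiset) \<Rightarrow> bit" where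
  "symb_count H A x =
     (if expected_dim A = 0 \<or> (arity A = 2 \<and> index A = 0)
      then of_nat (card (unparametrized ` {p \<in> param_moduli H (bdry A) (index A) (weight A).
        (\<forall>(v, q)\<in>pointed A \<union> flow_out A. vertex_at p v q) \<and> (\<forall>v\<in>flow_in A. vertex_at p v (x v))}))
      else 0)"

definition ev_coef :: "'a heegaard \<Rightarrow> 'a coef \<Rightarrow> bit poly" where
  "ev_coef H f = (\<Sum>m\<in>Poly_Mapping.keys f. [:Poly_Mapping.lookup f m:] *
     (\<Prod>v\<in>Poly_Mapping.keys m. (case v of None \<Rightarrow> [:0, 1:] | Some A \<Rightarrow> [:symb_count H A (\<lambda>_. {#}):])
        ^ Poly_Mapping.lookup m v))"

definition ev_word :: "'a heegaard \<Rightarrow> 'a symb fword \<Rightarrow> 'a floer_map" where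
  "ev_word H u x r = (let As = letters u in
     if As \<noteq> [] \<and> (\<exists>v. flow_out (last As) = {(v, r)})
     then \<Prod>i<length As. [:symb_count H (As ! i)
            (\<lambda>s. x s (length (filter (\<lambda>A. s \<in> flow_in A) (take i As)))):]
     else 0)"

definition ev :: "'a heegaard \<Rightarrow> 'a talg \<Rightarrow> 'a floer_map" where
  "ev H a x r = (\<Sum>u\<in>Poly_Mapping.keys a. ev_coef H (Poly_Mapping.lookup a u) * ev_word H u x r)"

text \<open>
  The symbol \<open>s\<close> represents the map \<open>f\<close>, whose source and target modules are given by the flow type
  \<open>D\<close>.
\<close>

definition represents_map ::
  "'a heegaard \<Rightarrow> 'a that set \<Rightarrow> ('a vertex \<Rightarrow> nat) \<times> ('a vertex \<Rightarrow> nat) \<Rightarrow> 'a floer_map \<Rightarrow> bool" where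
  "represents_map H s D f \<longleftrightarrow> (\<exists>a. Some a \<in> s \<and> (\<forall>u\<in>Poly_Mapping.keys a. flow_type u = D) \<and> f = ev H a)"

section \<open>The morphism to the equivariant theory\<close>

definition set_weight :: "nat \<Rightarrow> 'a symb \<Rightarrow> 'a symb" where
  "set_weight i A = Symb (bdry A) (index A) (Some i) (pointed A) (flow_in A) (flow_out A)"

definition nonempty_weights :: "'a heegaard \<Rightarrow> 'a symb \<Rightarrow> nat set" where
  "nonempty_weights H A = {i. slot_moduli H (set_weight i A) \<noteq> {}}"

definition FU_coef :: "'a heegaard \<Rightarrow> 'a coef \<Rightarrow> 'a coef" where
  "FU_coef H f = (\<Sum>m\<in>Poly_Mapping.keys f. Poly_Mapping.single 0 (Poly_Mapping.lookup f m) *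
     (\<Prod>v\<in>Poly_Mapping.keys m. (case v of None \<Rightarrow> U_coef
        | Some A \<Rightarrow> \<Sum>i\<in>nonempty_weights H A. U_coef ^ i * coef_of H (set_weight i A))
        ^ Poly_Mapping.lookup m v))"

definition FU_talg :: "'a heegaard \<Rightarrow> 'a talg \<Rightarrow> 'a talg" where
  "FU_talg H a = (\<Sum>u\<in>Poly_Mapping.keys a. scal (FU_coef H (Poly_Mapping.lookup a u)) *
     prod_list (map (\<lambda>A. \<Sum>i\<in>nonempty_weights H A. scal (U_coef ^ i) * talg_of H (set_weight i A))
       (letters u)))"

definition FU :: "'a heegaard \<Rightarrow> 'a that \<Rightarrow> 'a that" where
  "FU H = map_option (FU_talg H)"

definition FU_homology :: "'a heegaard \<Rightarrow> 'a that set \<Rightarrow> 'a that set" where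
  "FU_homology H X = (\<Union>x\<in>X. hclass H Equivariant (FU H x))"

section \<open>The standing assumptions\<close>

text \<open>
  The analytic conditions: invariance of holomorphicity and of the index under reparametrization;
  transversality (intersections of tori are finite and holomorphic bigons of index 0 are
  constant); positivity of intersection with the divisors at \<open>z\<close> and \<open>w\<close>, which are complex;
  Gromov compactness and admissibility (rigid moduli spaces are finite and only finitely many
  intersection numbers at \<open>w\<close> occur in each moduli space); gluing: if both factors of a piece of
  the codimension-1 boundary are nonempty, then so is the moduli space itself.
\<close>

definition heegaard_setup :: "'a heegaard \<Rightarrow> bool" where
  "heegaard_setup H \<longleftrightarrow>
     closed_oriented_surface (surf H) (charts H) (genus H) \<and>
     finite (circle_sets H) \<and>
     (\<forall>\<alpha>\<in>circle_sets H. attaching_circles (surf H) (genus H) \<alpha>) \<and>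
     z_pt H \<in> topspace (surf H) - \<Union>(\<Union>(circle_sets H)) \<and>
     w_pt H \<in> topspace (surf H) - \<Union>(\<Union>(circle_sets H)) \<and>
     (\<forall>p p'. whitney_polygon H p \<longrightarrow> reparametrization p p' \<longrightarrow>
        pseudo_hol H p' = pseudo_hol H p \<and> maslov H p' = maslov H p) \<and>
     (\<forall>\<alpha>\<in>circle_sets H. \<forall>\<beta>\<in>circle_sets H. \<alpha> \<noteq> \<beta> \<longrightarrow> finite (torus \<alpha> \<inter> torus \<beta>)) \<and>
     (\<forall>as \<phi> ps. boundary_condition H (rot_class as) \<longrightarrow> length as = 2 \<longrightarrow>
        whitney_polygon H (as, \<phi>, ps) \<longrightarrow> pseudo_hol H (as, \<phi>, ps) \<longrightarrow> maslov H (as, \<phi>, ps) = 0 \<longrightarrow>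
        \<phi> constant_on cball 0 1) \<and>
     (\<forall>p. boundary_condition H (rot_class (fst p)) \<longrightarrow> whitney_polygon H p \<longrightarrow> pseudo_hol H p \<longrightarrow>
        0 \<le> intersection_number H (z_pt H) p \<and> 0 \<le> intersection_number H (w_pt H) p) \<and>
     (\<forall>as. boundary_condition H (rot_class as) \<longrightarrow> finite (moduli H (rot_class as) (rigid_index as) None)) \<and>
     (\<forall>B' \<mu>. boundary_condition H B' \<longrightarrow>
        finite (intersection_number H (w_pt H) ` param_moduli H B' \<mu> None)) \<and>
     (\<forall>ver A a b q j k. generator H ver A \<or> pre_generator H ver A \<and> fully_pointed A \<longrightarrow>
        expected_dim A = 1 \<longrightarrow> (a, b, q) \<in> cuts A \<longrightarrow>
        (j, k) \<in> weight_splits (weight A) \<longrightarrow> slot_moduli H (piece1 A a b q j) \<noteq> {} \<longrightarrow>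
        slot_moduli H (Kdown {((b, a), q)} (piece2 A a b q k)) \<noteq> {} \<longrightarrow> slot_moduli H A \<noteq> {})"

end

theory Submission
  imports Defs
begin

text \<open>
  On normal forms of the plain theory the morphism to the equivariant theory replaces each variable
  and each letter by the sum, over the finitely many weights \<open>i\<close> that occur, of \<open>U ^ i\<close> times its
  weighted version.  Setting \<open>U\<close> to 1 and keeping the smallest weight only is a left inverse, so the
  morphism is injective and preserves the set of flow types of the summands.  Hence it is compatible
  with \<open>\<boxplus>\<close> and \<open>\<boxtimes>\<close>, including the cases where the result is \<open>\<Omega>\<close>.  It is a chain map because the
  weights of the two factors of a boundary piece add up, and every such sum is a weight of the whole
  moduli space by gluing.  It therefore induces a map on homology which commutes with all defined
  operations; since \<open>\<Omega>\<close> is absorbing, a polynomial with value 0 has no undefined subexpression.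
\<close>

section \<open>Polynomial mappings\<close>

text \<open>The delicate point is the absorbing value. The rules for the differential require
  \<open>x \<boxplus> y\<close> to be defined, but not the sum \<open>x' \<boxplus> y'\<close> of
  the differentials, and definedness of a sum is read off the words that occur in its normal form.
  The morphism must therefore neither create nor destroy a flow type: a nonzero coefficient sent to
  0 could turn an undefined sum into a defined one. This is what injectivity is for, and it is
  claimed only on normal forms of the plain theory: the left inverse recovers neither
  \<open>U\<close> nor a plain symbol with empty moduli space. Hence the sets
  \<open>plain_coefs\<close> and \<open>plain_talgs\<close>, membership in which is carried through
  the inductions over the differentials. These differentials are relations generated by rules, so
  the chain map property is a rule induction; its substantial cases are a single generator and, for
  coefficients, a single fully pointed pre-generator.\<close>

lemma poly_mapping_sum_single: "(\<Sum>k\<in>Poly_Mapping.keys p. Poly_Mapping.single k (Poly_Mapping.lookup p k)) = p"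
proof (rule poly_mapping_eqI)
  fix k
  have "Poly_Mapping.lookup (\<Sum>k\<in>Poly_Mapping.keys p. Poly_Mapping.single k (Poly_Mapping.lookup p k)) k
      = (\<Sum>j\<in>Poly_Mapping.keys p. if j = k then Poly_Mapping.lookup p j else 0)"
    by (simp add: lookup_sum lookup_single when_def)
  also have "\<dots> = Poly_Mapping.lookup p k"
    by (simp add: in_keys_iff)
  finally show "Poly_Mapping.lookup (\<Sum>k\<in>Poly_Mapping.keys p. Poly_Mapping.single k (Poly_Mapping.lookup p k)) k
      = Poly_Mapping.lookup p k" .
qed

lemma poly_mapping_mult_sum_single:
  "a * b = (\<Sum>m\<in>Poly_Mapping.keys a. \<Sum>n\<in>Poly_Mapping.keys b.
     Poly_Mapping.single (m + n) (Poly_Mapping.lookup a m * Poly_Mapping.lookup b n))"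
proof -
  have "a * b = (\<Sum>m\<in>Poly_Mapping.keys a. Poly_Mapping.single m (Poly_Mapping.lookup a m)) *
      (\<Sum>n\<in>Poly_Mapping.keys b. Poly_Mapping.single n (Poly_Mapping.lookup b n))"
    by (simp only: poly_mapping_sum_single)
  then show ?thesis
    by (simp add: sum_product mult_single)
qed

text \<open>Cancellation makes the shift of exponents by \<open>m\<close> injective, so no two
  coefficients of \<open>f\<close> are added up. Applied to powers of \<open>U\<close> and to
  coefficients that are single monomials.\<close>

lemma mult_single_eq_0_iff:
  fixes f :: "'b::cancel_comm_monoid_add \<Rightarrow>\<^sub>0 'c::semiring_1"
  shows "f * Poly_Mapping.single m 1 = 0 \<longleftrightarrow> f = 0"
proof
  assume *: "f * Poly_Mapping.single m 1 = 0"
  show "f = 0"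
  proof (rule poly_mapping_eqI)
    fix k
    have "f * Poly_Mapping.single m 1 =
        (\<Sum>j\<in>Poly_Mapping.keys f. Poly_Mapping.single (j + m) (Poly_Mapping.lookup f j))"
      by (subst poly_mapping_sum_single[of f, symmetric])
        (simp add: sum_distrib_right mult_single)
    then have "Poly_Mapping.lookup (f * Poly_Mapping.single m 1) (k + m) =
        (\<Sum>j\<in>Poly_Mapping.keys f. if j = k then Poly_Mapping.lookup f j else 0)"
      by (simp add: lookup_sum lookup_single when_def)
    also have "\<dots> = Poly_Mapping.lookup f k"
      by (simp add: in_keys_iff)
    finally show "Poly_Mapping.lookup f k = Poly_Mapping.lookup 0 k"
      using * by simp
  qed
qed simp

section \<open>Linear extension from the basis of a monoid algebra\<close>

definition lin_ext :: "('c::zero \<Rightarrow> 'r::semiring_1) \<Rightarrow> ('m \<Rightarrow> 'r) \<Rightarrow> ('m \<Rightarrow>\<^sub>0 'c) \<Rightarrow> 'r" where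
  "lin_ext h \<phi> a = (\<Sum>m\<in>Poly_Mapping.keys a. h (Poly_Mapping.lookup a m) * \<phi> m)"

locale coefficient_hom =
  fixes h :: "'c::semiring_1 \<Rightarrow> 'r::semiring_1"
  assumes hom_zero [simp]: "h 0 = 0" and hom_one [simp]: "h 1 = 1"
    and hom_add: "h (c + d) = h c + h d" and hom_mult: "h (c * d) = h c * h d"
begin

lemma lin_ext_superset:
  "finite S \<Longrightarrow> Poly_Mapping.keys a \<subseteq> S \<Longrightarrow> lin_ext h \<phi> a = (\<Sum>m\<in>S. h (Poly_Mapping.lookup a m) * \<phi> m)"
  unfolding lin_ext_def by (rule sum.mono_neutral_left) (auto simp: in_keys_iff)

lemma lin_ext_zero [simp]: "lin_ext h \<phi> 0 = 0"
  by (simp add: lin_ext_def)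

lemma lin_ext_single [simp]: "lin_ext h \<phi> (Poly_Mapping.single m c) = h c * \<phi> m"
  by (cases "c = 0") (simp_all add: lin_ext_def)

lemma lin_ext_add: "lin_ext h \<phi> (a + b) = lin_ext h \<phi> a + lin_ext h \<phi> b"
proof -
  let ?S = "Poly_Mapping.keys a \<union> Poly_Mapping.keys b"
  have "lin_ext h \<phi> (a + b) = (\<Sum>m\<in>?S. h (Poly_Mapping.lookup (a + b) m) * \<phi> m)"
    using Poly_Mapping.keys_add[of a b] by (intro lin_ext_superset) auto
  also have "\<dots> = (\<Sum>m\<in>?S. h (Poly_Mapping.lookup a m) * \<phi> m) + (\<Sum>m\<in>?S. h (Poly_Mapping.lookup b m) * \<phi> m)"
    by (simp add: lookup_add hom_add distrib_right sum.distrib)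
  also have "\<dots> = lin_ext h \<phi> a + lin_ext h \<phi> b"
    by (subst (1 2) lin_ext_superset[where S = ?S]) auto
  finally show ?thesis .
qed

lemma lin_ext_sum: "lin_ext h \<phi> (sum a I) = (\<Sum>i\<in>I. lin_ext h \<phi> (a i))"
  by (induction I rule: infinite_finite_induct) (simp_all add: lin_ext_add)

lemma lin_ext_one:
  "\<phi> 0 = 1 \<Longrightarrow> lin_ext h \<phi> (1 :: 'm::monoid_add \<Rightarrow>\<^sub>0 'c) = 1"
  using lin_ext_single[of \<phi> 0 1] by simp

text \<open>The target may be non-commutative: the second assumption moves the scalar of the right
  factor past the basis image of the left one. For the tensor algebra it is the centrality of
  scalars.\<close>

lemma lin_ext_mult:
  fixes a b :: "'m::monoid_add \<Rightarrow>\<^sub>0 'c"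
  assumes "\<And>m n. \<phi> (m + n) = \<phi> m * \<phi> n" and "\<And>m c. \<phi> m * h c = h c * \<phi> m"
  shows "lin_ext h \<phi> (a * b) = lin_ext h \<phi> a * lin_ext h \<phi> b"
proof -
  have comm: "h c * \<phi> m * (h d * \<phi> n) = h (c * d) * \<phi> (m + n)" for c d m n
    using assms(2)[of m d] by (metis assms(1) hom_mult mult.assoc)
  have "lin_ext h \<phi> (a * b) = (\<Sum>m\<in>Poly_Mapping.keys a. \<Sum>n\<in>Poly_Mapping.keys b.
      h (Poly_Mapping.lookup a m * Poly_Mapping.lookup b n) * \<phi> (m + n))"
    by (subst poly_mapping_mult_sum_single) (simp add: lin_ext_sum)
  also have "\<dots> = lin_ext h \<phi> a * lin_ext h \<phi> b"
    by (simp add: lin_ext_def sum_product comm)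
  finally show ?thesis .
qed

end

section \<open>Evaluation and substitution of commutative polynomials\<close>

definition monom_eval :: "('v \<Rightarrow> 'r::comm_semiring_1) \<Rightarrow> ('v \<Rightarrow>\<^sub>0 nat) \<Rightarrow> 'r" where
  "monom_eval \<phi> m = (\<Prod>v\<in>Poly_Mapping.keys m. \<phi> v ^ Poly_Mapping.lookup m v)"

lemma monom_eval_superset:
  "finite S \<Longrightarrow> Poly_Mapping.keys m \<subseteq> S \<Longrightarrow> monom_eval \<phi> m = (\<Prod>v\<in>S. \<phi> v ^ Poly_Mapping.lookup m v)"
  unfolding monom_eval_def by (rule prod.mono_neutral_left) (auto simp: in_keys_iff)

lemma monom_eval_zero [simp]: "monom_eval \<phi> 0 = 1"
  by (simp add: monom_eval_def)

lemma monom_eval_single [simp]: "monom_eval \<phi> (Poly_Mapping.single v k) = \<phi> v ^ k"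
  by (cases "k = 0") (simp_all add: monom_eval_def)

lemma monom_eval_add: "monom_eval \<phi> (m + n) = monom_eval \<phi> m * monom_eval \<phi> n"
proof -
  let ?S = "Poly_Mapping.keys m \<union> Poly_Mapping.keys n"
  have "monom_eval \<phi> (m + n) = (\<Prod>v\<in>?S. \<phi> v ^ Poly_Mapping.lookup (m + n) v)"
    using Poly_Mapping.keys_add[of m n] by (intro monom_eval_superset) auto
  also have "\<dots> = (\<Prod>v\<in>?S. \<phi> v ^ Poly_Mapping.lookup m v) * (\<Prod>v\<in>?S. \<phi> v ^ Poly_Mapping.lookup n v)"
    by (simp add: lookup_add power_add prod.distrib)
  also have "\<dots> = monom_eval \<phi> m * monom_eval \<phi> n"
    by (subst (1 2) monom_eval_superset[where S = ?S]) auto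
  finally show ?thesis .
qed

abbreviation poly_var :: "'v \<Rightarrow> ('v \<Rightarrow>\<^sub>0 nat) \<Rightarrow>\<^sub>0 'c::comm_semiring_1" where
  "poly_var v \<equiv> Poly_Mapping.single (Poly_Mapping.single v 1) 1"

lemma single_power: "Poly_Mapping.single (Poly_Mapping.single v 1) (1::'c::comm_semiring_1) ^ k
    = Poly_Mapping.single (Poly_Mapping.single v k) 1"
  by (induction k) (simp_all add: mult_single flip: single_add)

lemma prod_single_one:
  fixes m :: "'i \<Rightarrow> 'm::comm_monoid_add"
  shows "(\<Prod>i\<in>I. Poly_Mapping.single (m i) (1::'c::comm_semiring_1)) = Poly_Mapping.single (\<Sum>i\<in>I. m i) 1"
  by (induction I rule: infinite_finite_induct) (simp_all add: mult_single)

lemma monom_eval_poly_var: "monom_eval poly_var m = Poly_Mapping.single m (1::'c::comm_semiring_1)"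
  by (simp add: monom_eval_def single_power prod_single_one poly_mapping_sum_single flip: One_nat_def)

text \<open>The universal property of the polynomial algebra as an explicit map: the morphism that
  extends \<open>\<phi>\<close> and fixes constants.\<close>

definition poly_subst ::
  "('v \<Rightarrow> ('w \<Rightarrow>\<^sub>0 nat) \<Rightarrow>\<^sub>0 'c::comm_semiring_1) \<Rightarrow> (('v \<Rightarrow>\<^sub>0 nat) \<Rightarrow>\<^sub>0 'c) \<Rightarrow> ('w \<Rightarrow>\<^sub>0 nat) \<Rightarrow>\<^sub>0 'c" where
  "poly_subst \<phi> = lin_ext (Poly_Mapping.single 0) (monom_eval \<phi>)"

interpretation const_coef: coefficient_hom
  "Poly_Mapping.single 0 :: 'c::comm_semiring_1 \<Rightarrow> ('m::comm_monoid_add \<Rightarrow>\<^sub>0 'c)"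
  by unfold_locales (simp_all add: single_add mult_single)

lemma poly_subst_zero [simp]: "poly_subst \<phi> 0 = 0"
  by (simp add: poly_subst_def)

lemma poly_subst_one [simp]: "poly_subst \<phi> 1 = 1"
  by (simp add: poly_subst_def const_coef.lin_ext_one)

lemma poly_subst_add: "poly_subst \<phi> (f + g) = poly_subst \<phi> f + poly_subst \<phi> g"
  by (simp add: poly_subst_def const_coef.lin_ext_add)

lemma poly_subst_sum: "poly_subst \<phi> (sum f I) = (\<Sum>i\<in>I. poly_subst \<phi> (f i))"
  by (simp add: poly_subst_def const_coef.lin_ext_sum)

lemma poly_subst_mult: "poly_subst \<phi> (f * g) = poly_subst \<phi> f * poly_subst \<phi> g"
  unfolding poly_subst_def
  by (rule const_coef.lin_ext_mult) (simp_all add: monom_eval_add mult.commute)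

lemma poly_subst_power: "poly_subst \<phi> (f ^ k) = poly_subst \<phi> f ^ k"
  by (induction k) (simp_all add: poly_subst_mult)

lemma poly_subst_prod: "poly_subst \<phi> (prod f I) = (\<Prod>i\<in>I. poly_subst \<phi> (f i))"
  by (induction I rule: infinite_finite_induct) (simp_all add: poly_subst_mult)

lemma poly_subst_const [simp]: "poly_subst \<phi> (Poly_Mapping.single 0 c) = Poly_Mapping.single 0 c"
  by (simp add: poly_subst_def)

lemma poly_subst_var [simp]: "poly_subst \<phi> (poly_var v) = \<phi> v"
  by (simp add: poly_subst_def)

text \<open>A composite of substitutions is determined by its effect on variables. Only the
  variables occurring in \<open>f\<close> are tested, because in the application the identity fails
  on others, such as \<open>U\<close>.\<close>

lemma poly_subst_left_inverse:
  assumes "\<And>m v. m \<in> Poly_Mapping.keys f \<Longrightarrow> v \<in> Poly_Mapping.keys m \<Longrightarrow> poly_subst \<psi> (\<phi> v) = poly_var v"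
  shows "poly_subst \<psi> (poly_subst \<phi> f) = f"
proof -
  have "poly_subst \<psi> (poly_subst \<phi> f) = (\<Sum>m\<in>Poly_Mapping.keys f.
      Poly_Mapping.single 0 (Poly_Mapping.lookup f m) * poly_subst \<psi> (monom_eval \<phi> m))"
    by (simp add: poly_subst_def[of \<phi>] lin_ext_def poly_subst_sum poly_subst_mult)
  also have "\<dots> = (\<Sum>m\<in>Poly_Mapping.keys f.
      Poly_Mapping.single 0 (Poly_Mapping.lookup f m) * monom_eval poly_var m)"
    by (rule sum.cong)
      (auto simp: monom_eval_def poly_subst_prod poly_subst_power assms intro!: arg_cong[where f = "\<lambda>x. _ * x"] prod.cong)
  also have "\<dots> = f"
    by (simp only: monom_eval_poly_var mult_single) (simp add: poly_mapping_sum_single)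
  finally show ?thesis .
qed

section \<open>Scalars and words\<close>

lemma scal_zero [simp]: "scal 0 = 0"
  by (simp add: scal_def)

lemma scal_one [simp]: "scal 1 = 1"
  by (simp add: scal_def)

lemma scal_add: "scal (f + g) = scal f + scal g"
  by (simp add: scal_def single_add)

lemma scal_mult: "scal (f * g) = scal f * scal g"
  by (simp add: scal_def mult_single)

lemma scal_sum: "scal (sum f I) = (\<Sum>i\<in>I. scal (f i))"
  by (induction I rule: infinite_finite_induct) (simp_all add: scal_add)

text \<open>Scalars sit at the empty word and the coefficients commute, so scalars are central; this
  is checked on monomials and summed.\<close>

lemma scal_commute: "x * scal f = scal f * x"
proof -
  have "Poly_Mapping.single u c * scal f = scal f * Poly_Mapping.single u c" for u :: "'a symb fword" and c
    by (simp add: scal_def mult_single mult.commute)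
  then have "(\<Sum>u\<in>Poly_Mapping.keys x. Poly_Mapping.single u (Poly_Mapping.lookup x u)) * scal f =
      scal f * (\<Sum>u\<in>Poly_Mapping.keys x. Poly_Mapping.single u (Poly_Mapping.lookup x u))"
    by (simp add: sum_distrib_left sum_distrib_right)
  then show ?thesis
    by (simp add: poly_mapping_sum_single)
qed

lemma scal_left_commute: "x * (scal f * y) = scal f * (x * y)"
  by (metis mult.assoc scal_commute)

lemma scal_mult_single: "scal f * Poly_Mapping.single u c = Poly_Mapping.single u (f * c)"
  by (simp add: scal_def mult_single)

lemma word_append: "word (As @ Bs) = word As * word Bs"
  by (simp add: word_def mult_single plus_fword_def)

lemma word_Nil [simp]: "word [] = 1"
  by (simp add: word_def flip: zero_fword_def)

lemma letters_zero [simp]: "letters 0 = []"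
  by (simp add: zero_fword_def)

lemma letters_plus [simp]: "letters (u + v) = letters u @ letters v"
  by (simp add: plus_fword_def)

lemma letters_eq_Nil_iff [simp]: "letters u = [] \<longleftrightarrow> u = 0"
  by (cases u) (simp add: zero_fword_def)

section \<open>Forgetting and adding weights\<close>

definition forget_weight :: "'a symb \<Rightarrow> 'a symb" where
  "forget_weight A = Symb (bdry A) (index A) None (pointed A) (flow_in A) (flow_out A)"

lemma set_weight_sel [simp]:
  "bdry (set_weight i A) = bdry A" "index (set_weight i A) = index A"
  "weight (set_weight i A) = Some i" "pointed (set_weight i A) = pointed A"
  "flow_in (set_weight i A) = flow_in A" "flow_out (set_weight i A) = flow_out A"
  by (simp_all add: set_weight_def)

lemma set_weight_invariant [simp]:
  "vertices (set_weight i A) = vertices A" "arity (set_weight i A) = arity A"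
  "expected_dim (set_weight i A) = expected_dim A"
  "fully_pointed (set_weight i A) = fully_pointed A"
  by (simp_all add: vertices_def arity_def expected_dim_def fully_pointed_def)

lemma set_weight_set_weight [simp]: "set_weight i (set_weight j A) = set_weight i A"
  by (simp add: set_weight_def)

lemma Kup_sel [simp]:
  "bdry (Kup A) = bdry A" "index (Kup A) = index A" "weight (Kup A) = weight A"
  "pointed (Kup A) = pointed A \<union> flow_out A" "flow_in (Kup A) = flow_in A" "flow_out (Kup A) = {}"
  by (simp_all add: Kup_def)

lemma Kdown_sel [simp]:
  "bdry (Kdown Q A) = bdry A" "index (Kdown Q A) = index A" "weight (Kdown Q A) = weight A"
  "pointed (Kdown Q A) = pointed A \<union> Q" "flow_in (Kdown Q A) = flow_in A - fst ` Q"
  "flow_out (Kdown Q A) = flow_out A"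
  by (simp_all add: Kdown_def)

lemma Kup_set_weight [simp]: "Kup (set_weight i A) = set_weight i (Kup A)"
  by (simp add: Kup_def set_weight_def)

lemma Kdown_set_weight [simp]: "Kdown Q (set_weight i A) = set_weight i (Kdown Q A)"
  by (simp add: Kdown_def set_weight_def)

lemma forget_weight_set_weight: "weight A = None \<Longrightarrow> forget_weight (set_weight i A) = A"
  by (cases A) (simp add: forget_weight_def)

text \<open>\<open>slot_moduli\<close> imposes the slot points of pointings and of flow-out vertices
  alike, so turning the latter into the former changes nothing. \<open>Kdown\<close>, in contrast,
  adds conditions.\<close>

lemma slot_moduli_Kup [simp]: "slot_moduli H (Kup A) = slot_moduli H A"
  by (simp add: slot_moduli_def Un_ac)

lemma slot_moduli_Kdown_subset: "slot_moduli H (Kdown Q A) \<subseteq> slot_moduli H A"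
  unfolding slot_moduli_def by auto

lemma nonempty_weights_Kup [simp]: "nonempty_weights H (Kup A) = nonempty_weights H A"
  by (simp add: nonempty_weights_def flip: Kup_set_weight)

lemma nonempty_weights_Kdown_subset: "nonempty_weights H (Kdown Q A) \<subseteq> nonempty_weights H A"
proof
  fix i assume "i \<in> nonempty_weights H (Kdown Q A)"
  then have "slot_moduli H (Kdown Q (set_weight i A)) \<noteq> {}"
    by (simp add: nonempty_weights_def)
  then have "slot_moduli H (set_weight i A) \<noteq> {}"
    using slot_moduli_Kdown_subset[of H Q "set_weight i A"] by blast
  then show "i \<in> nonempty_weights H A"
    by (simp add: nonempty_weights_def)
qed

lemma rot_class_rotate: "bs \<in> rot_class as \<Longrightarrow> rot_class bs = rot_class as"
proof -
  assume "bs \<in> rot_class as"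
  then obtain k where k: "bs = rotate k as" by (auto simp: rot_class_def)
  have "\<exists>j. rotate i as = rotate j (rotate k as)" for i
  proof -
    let ?n = "length as"
    \<comment> \<open>A class is an orbit: rotating by \<open>?n - k mod ?n\<close> undoes the
      rotation by \<open>k\<close>, up to a full turn.\<close>
    have "rotate (i + (?n - k mod ?n)) (rotate k as) = rotate (i + (?n - k mod ?n) + k mod ?n) as"
      using rotate_conv_mod[of k as] by (simp add: rotate_rotate)
    also have "\<dots> = rotate (i + ?n) as"
    proof (cases "as = []")
      case False
      then have "k mod ?n \<le> ?n" by (simp add: less_imp_le_nat)
      then show ?thesis by simp
    qed simp
    also have "\<dots> = rotate i as"
      by (metis mod_add_self2 rotate_conv_mod)
    finally show ?thesis by metis
  qed
  then show ?thesis
    unfolding k rot_class_def by (auto simp: rotate_rotate)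
qed

lemma self_in_rot_class: "as \<in> rot_class as"
  unfolding rot_class_def by (metis (mono_tags, lifting) CollectI rotate0 id_apply)

lemma rot_classD: "bs \<in> rot_class as \<Longrightarrow> length bs = length as \<and> set bs = set as \<and> distinct bs = distinct as"
  by (auto simp: rot_class_def)

lemma boundary_conditionD:
  "boundary_condition H B' \<Longrightarrow> as \<in> B' \<Longrightarrow>
    B' = rot_class as \<and> set as \<subseteq> circle_sets H \<and> distinct as \<and> 2 \<le> length as \<and> length as \<le> card (circle_sets H)"
  unfolding boundary_condition_def using rot_class_rotate rot_classD by metis

lemma cyclic_pairs_rotate: "cyclic_pairs (rotate k as) = cyclic_pairs (as :: 'b list)"
proof (induction k)
  case (Suc k)
  have "zip (rotate1 xs) (rotate1 (rotate1 xs)) = rotate1 (zip xs (rotate1 xs))" for xs :: "'b list"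
  proof (cases xs)
    case (Cons x ys)
    then show ?thesis
      using zip_append[of "y # zs" "zs @ [x]" "[x]" "[y]" for y zs] by (cases ys) simp_all
  qed simp
  then show ?case
    using Suc by (simp add: cyclic_pairs_def)
qed simp

lemma vertices_rot_class:
  assumes "bdry A = rot_class as" shows "vertices A = cyclic_pairs as"
proof -
  have "cyclic_pairs bs = cyclic_pairs as" if "bs \<in> rot_class as" for bs
    using that by (auto simp: rot_class_def cyclic_pairs_rotate)
  then have "(\<Union>bs\<in>rot_class as. cyclic_pairs bs) = (\<Union>bs\<in>rot_class as. cyclic_pairs as)"
    by (intro SUP_cong) auto
  then show ?thesis
    using self_in_rot_class[of as] by (auto simp: vertices_def assms)
qed

text \<open>Since the edges are distinct, the vertices already differ in their first components, so
  none is lost in passing from the list to the set.\<close>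

lemma arity_eq_length:
  assumes "boundary_condition H (bdry A)" "as \<in> bdry A"
  shows "arity A = length as"
proof -
  from boundary_conditionD[OF assms] have "bdry A = rot_class as" "distinct as"
    by auto
  then show ?thesis
    by (simp add: arity_def vertices_rot_class cyclic_pairs_def distinct_card distinct_zipI1)
qed

text \<open>Weaker than being a plain pre-generator: it is all that the lemmas on weights require,
  and it passes easily to the pieces of a cut and to \<open>Kup\<close> and
  \<open>Kdown\<close>.\<close>

definition plain_symb :: "'a heegaard \<Rightarrow> 'a symb \<Rightarrow> bool" where
  "plain_symb H A \<longleftrightarrow> boundary_condition H (bdry A) \<and> weight A = None"

lemma plain_symb_Kup [simp]: "plain_symb H (Kup A) = plain_symb H A"
  and plain_symb_Kdown [simp]: "plain_symb H (Kdown Q A) = plain_symb H A"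
  by (simp_all add: plain_symb_def)

section \<open>Normal forms\<close>

text \<open>Excludes \<open>U\<close> and exactly those plain symbols that \<open>coef_of\<close>
  replaces by 0 or 1.\<close>

definition plain_variable :: "'a heegaard \<Rightarrow> 'a symb option \<Rightarrow> bool" where
  "plain_variable H v \<longleftrightarrow> (\<exists>A. v = Some A \<and> plain_symb H A \<and> slot_moduli H A \<noteq> {} \<and>
     \<not> (arity A = 2 \<and> index A = 0))"

definition plain_coefs :: "'a heegaard \<Rightarrow> 'a coef set" where
  "plain_coefs H = {f. \<forall>m\<in>Poly_Mapping.keys f. \<forall>v\<in>Poly_Mapping.keys m. plain_variable H v}"

text \<open>The symbols that survive in \<open>talg_of\<close> as letters: fully pointed ones move
  to the coefficients and those with empty moduli space become 0.\<close>

definition plain_letter :: "'a heegaard \<Rightarrow> 'a symb \<Rightarrow> bool" where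
  "plain_letter H A \<longleftrightarrow> plain_symb H A \<and> slot_moduli H A \<noteq> {} \<and> \<not> fully_pointed A"

definition plain_talgs :: "'a heegaard \<Rightarrow> 'a talg set" where
  "plain_talgs H = {a. \<forall>u\<in>Poly_Mapping.keys a.
     Poly_Mapping.lookup a u \<in> plain_coefs H \<and> (\<forall>A\<in>set (letters u). plain_letter H A)}"

lemma plain_coefs_zero [simp]: "0 \<in> plain_coefs H"
  and plain_coefs_one [simp]: "1 \<in> plain_coefs H"
  by (auto simp: plain_coefs_def)

lemma plain_coefs_add: "f \<in> plain_coefs H \<Longrightarrow> g \<in> plain_coefs H \<Longrightarrow> f + g \<in> plain_coefs H"
  using Poly_Mapping.keys_add[of f g] by (auto simp: plain_coefs_def)

lemma plain_coefs_mult: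
  assumes "f \<in> plain_coefs H" "g \<in> plain_coefs H"
  shows "f * g \<in> plain_coefs H"
  unfolding plain_coefs_def
proof clarify
  fix m v assume "m \<in> Poly_Mapping.keys (f * g)" and v: "v \<in> Poly_Mapping.keys m"
  then obtain k l where "k \<in> Poly_Mapping.keys f" "l \<in> Poly_Mapping.keys g" "m = k + l"
    using keys_mult[of f g] by auto
  moreover from this have "v \<in> Poly_Mapping.keys k \<union> Poly_Mapping.keys l"
    using v Poly_Mapping.keys_add[of k l] by auto
  ultimately show "plain_variable H v"
    using assms by (auto simp: plain_coefs_def)
qed

lemma plain_coefs_sum: "(\<And>i. i \<in> I \<Longrightarrow> f i \<in> plain_coefs H) \<Longrightarrow> sum f I \<in> plain_coefs H"
  by (induction I rule: infinite_finite_induct) (auto simp: plain_coefs_add)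

lemma plain_coefs_coef_of: "plain_symb H A \<Longrightarrow> coef_of H A \<in> plain_coefs H"
  by (auto simp: coef_of_def plain_coefs_def plain_variable_def)

lemma plain_talgs_zero [simp]: "0 \<in> plain_talgs H"
  by (simp add: plain_talgs_def)

lemma plain_talgs_add: "a \<in> plain_talgs H \<Longrightarrow> b \<in> plain_talgs H \<Longrightarrow> a + b \<in> plain_talgs H"
proof -
  assume *: "a \<in> plain_talgs H" "b \<in> plain_talgs H"
  then have "Poly_Mapping.lookup a u \<in> plain_coefs H" "Poly_Mapping.lookup b u \<in> plain_coefs H" for u
    by (cases "u \<in> Poly_Mapping.keys a"; cases "u \<in> Poly_Mapping.keys b";
        simp add: plain_talgs_def not_in_keys_iff_lookup_eq_zero)+
  then show ?thesis
    using * Poly_Mapping.keys_add[of a b]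
    by (fastforce simp: plain_talgs_def lookup_add intro: plain_coefs_add)
qed

lemma plain_talgs_sum: "(\<And>i. i \<in> I \<Longrightarrow> a i \<in> plain_talgs H) \<Longrightarrow> sum a I \<in> plain_talgs H"
  by (induction I rule: infinite_finite_induct) (auto simp: plain_talgs_add)

lemma plain_talgs_single:
  "f \<in> plain_coefs H \<Longrightarrow> (\<And>A. A \<in> set (letters u) \<Longrightarrow> plain_letter H A) \<Longrightarrow>
    Poly_Mapping.single u f \<in> plain_talgs H"
  by (auto simp: plain_talgs_def)

lemma plain_talgs_mult:
  assumes "a \<in> plain_talgs H" "b \<in> plain_talgs H"
  shows "a * b \<in> plain_talgs H"
proof (subst poly_mapping_mult_sum_single, intro plain_talgs_sum plain_talgs_single plain_coefs_mult)
qed (use assms in \<open>auto simp: plain_talgs_def\<close>)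

lemma plain_talgs_scal: "f \<in> plain_coefs H \<Longrightarrow> scal f \<in> plain_talgs H"
  unfolding scal_def by (rule plain_talgs_single) simp_all

lemma plain_talgs_word: "(\<And>A. A \<in> set As \<Longrightarrow> plain_letter H A) \<Longrightarrow> word As \<in> plain_talgs H"
  unfolding word_def by (rule plain_talgs_single) simp_all

lemma plain_talgs_talg_of: "plain_symb H A \<Longrightarrow> talg_of H A \<in> plain_talgs H"
  unfolding talg_of_def
  by (auto simp: plain_letter_def intro!: plain_coefs_coef_of plain_talgs_scal plain_talgs_word)

section \<open>The morphism on the free algebras\<close>

definition variable_FU :: "'a heegaard \<Rightarrow> 'a symb option \<Rightarrow> 'a coef" where
  "variable_FU H v = (case v of None \<Rightarrow> U_coef
     | Some A \<Rightarrow> \<Sum>i\<in>nonempty_weights H A. U_coef ^ i * coef_of H (set_weight i A))"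

lemma FU_coef_eq_poly_subst: "FU_coef H = poly_subst (variable_FU H)"
  by (rule ext) (simp add: FU_coef_def poly_subst_def lin_ext_def monom_eval_def variable_FU_def)

lemma FU_coef_zero [simp]: "FU_coef H 0 = 0"
  and FU_coef_one [simp]: "FU_coef H 1 = 1"
  and FU_coef_add: "FU_coef H (f + g) = FU_coef H f + FU_coef H g"
  and FU_coef_mult: "FU_coef H (f * g) = FU_coef H f * FU_coef H g"
  and FU_coef_sum: "FU_coef H (sum h I) = (\<Sum>i\<in>I. FU_coef H (h i))"
  by (simp_all add: FU_coef_eq_poly_subst poly_subst_add poly_subst_mult poly_subst_sum)

definition FU_word :: "'a heegaard \<Rightarrow> 'a symb list \<Rightarrow> 'a talg" where
  "FU_word H As = prod_list (map (\<lambda>A. \<Sum>i\<in>nonempty_weights H A.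
     scal (U_coef ^ i) * talg_of H (set_weight i A)) As)"

interpretation FU_scal: coefficient_hom "\<lambda>f. scal (FU_coef H f)"
  by unfold_locales (simp_all add: FU_coef_add FU_coef_mult scal_add scal_mult)

lemma FU_talg_eq_lin_ext: "FU_talg H = lin_ext (\<lambda>f. scal (FU_coef H f)) (\<lambda>u. FU_word H (letters u))"
  by (rule ext) (simp add: FU_talg_def lin_ext_def FU_word_def)

lemma FU_talg_zero [simp]: "FU_talg H 0 = 0"
  and FU_talg_add: "FU_talg H (a + b) = FU_talg H a + FU_talg H b"
  and FU_talg_sum: "FU_talg H (sum c I) = (\<Sum>i\<in>I. FU_talg H (c i))"
  by (simp_all add: FU_talg_eq_lin_ext FU_scal.lin_ext_add FU_scal.lin_ext_sum)

lemma FU_word_Nil [simp]: "FU_word H [] = 1"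
  and FU_word_append: "FU_word H (As @ Bs) = FU_word H As * FU_word H Bs"
  by (simp_all add: FU_word_def)

lemma FU_talg_scal: "FU_talg H (scal f) = scal (FU_coef H f)"
  unfolding FU_talg_eq_lin_ext scal_def[of f] by (subst FU_scal.lin_ext_single) simp

lemma FU_talg_word: "FU_talg H (word As) = FU_word H As"
  unfolding FU_talg_eq_lin_ext word_def by (subst FU_scal.lin_ext_single) simp

lemma FU_talg_mult: "FU_talg H (a * b) = FU_talg H a * FU_talg H b"
  unfolding FU_talg_eq_lin_ext
  by (rule FU_scal.lin_ext_mult) (simp add: FU_word_append, rule scal_commute)

locale heegaard_theory =
  fixes H :: "'a heegaard"
  assumes heegaard: "heegaard_setup H"
begin

section \<open>The weights of a moduli space\<close>

lemma
  shows w_not_on_circles: "w_pt H \<notin> \<Union>(\<Union>(circle_sets H))"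
    and bigon_index_0_constant: "boundary_condition H (rot_class as) \<Longrightarrow> length as = 2 \<Longrightarrow>
      whitney_polygon H (as, \<phi>, ps) \<Longrightarrow> pseudo_hol H (as, \<phi>, ps) \<Longrightarrow> maslov H (as, \<phi>, ps) = 0 \<Longrightarrow>
      \<phi> constant_on cball 0 1"
    and w_intersection_nonneg: "boundary_condition H (rot_class (fst p)) \<Longrightarrow> whitney_polygon H p \<Longrightarrow>
      pseudo_hol H p \<Longrightarrow> 0 \<le> intersection_number H (w_pt H) p"
    and finite_w_intersections: "boundary_condition H B' \<Longrightarrow>
      finite (intersection_number H (w_pt H) ` param_moduli H B' \<mu> None)"
    and gluing: "generator H ver A \<or> pre_generator H ver A \<and> fully_pointed A \<Longrightarrow>
      expected_dim A = 1 \<Longrightarrow> (a, b, q) \<in> cuts A \<Longrightarrow> (j, k) \<in> weight_splits (weight A) \<Longrightarrow>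
      slot_moduli H (piece1 A a b q j) \<noteq> {} \<Longrightarrow>
      slot_moduli H (Kdown {((b, a), q)} (piece2 A a b q k)) \<noteq> {} \<Longrightarrow> slot_moduli H A \<noteq> {}"
proof -
  note conjuncts = heegaard[unfolded heegaard_setup_def]
  \<comment> \<open>\<open>tl5\<close>, \<open>tl7\<close> and \<open>tl9\<close> are the remainders
    of the set-up from its fifth conjunct (position of \<open>w\<close>), seventh (finite
    intersections of tori) and ninth (positivity) on.\<close>
  note tl5 = conjuncts[THEN conjunct2, THEN conjunct2, THEN conjunct2, THEN conjunct2]
  note tl7 = tl5[THEN conjunct2, THEN conjunct2]
  note tl9 = tl7[THEN conjunct2, THEN conjunct2]
  show "w_pt H \<notin> \<Union>(\<Union>(circle_sets H))"
    using tl5[THEN conjunct1] by blast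
  show "boundary_condition H (rot_class as) \<Longrightarrow> length as = 2 \<Longrightarrow>
      whitney_polygon H (as, \<phi>, ps) \<Longrightarrow> pseudo_hol H (as, \<phi>, ps) \<Longrightarrow> maslov H (as, \<phi>, ps) = 0 \<Longrightarrow>
      \<phi> constant_on cball 0 1"
    using tl7[THEN conjunct2, THEN conjunct1] by blast
  show "boundary_condition H (rot_class (fst p)) \<Longrightarrow> whitney_polygon H p \<Longrightarrow>
      pseudo_hol H p \<Longrightarrow> 0 \<le> intersection_number H (w_pt H) p"
    using tl9[THEN conjunct1] by blast
  show "boundary_condition H B' \<Longrightarrow>
      finite (intersection_number H (w_pt H) ` param_moduli H B' \<mu> None)"
    using tl9[THEN conjunct2, THEN conjunct2, THEN conjunct1] by blast
  show "generator H ver A \<or> pre_generator H ver A \<and> fully_pointed A \<Longrightarrow>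
      expected_dim A = 1 \<Longrightarrow> (a, b, q) \<in> cuts A \<Longrightarrow> (j, k) \<in> weight_splits (weight A) \<Longrightarrow>
      slot_moduli H (piece1 A a b q j) \<noteq> {} \<Longrightarrow>
      slot_moduli H (Kdown {((b, a), q)} (piece2 A a b q k)) \<noteq> {} \<Longrightarrow> slot_moduli H A \<noteq> {}"
    using tl9[THEN conjunct2, THEN conjunct2, THEN conjunct2] by blast
qed

lemma param_moduli_Some:
  "param_moduli H B' \<mu> (Some i) =
    {p \<in> param_moduli H B' \<mu> None. intersection_number H (w_pt H) p = int i}"
  by (auto simp: param_moduli_def)

text \<open>Positivity of intersection with the divisor at \<open>w\<close> makes the intersection
  number a natural number, hence a weight.\<close>

lemma param_moduli_weight:
  assumes "boundary_condition H B'" "p \<in> param_moduli H B' \<mu> None"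
  shows "\<exists>i. p \<in> param_moduli H B' \<mu> (Some i)"
proof -
  have "boundary_condition H (rot_class (fst p))"
    using assms boundary_conditionD[of H B' "fst p"] by (auto simp: param_moduli_def)
  then have "0 \<le> intersection_number H (w_pt H) p"
    using assms(2) w_intersection_nonneg by (auto simp: param_moduli_def)
  then have "p \<in> param_moduli H B' \<mu> (Some (nat (intersection_number H (w_pt H) p)))"
    using assms(2) by (simp add: param_moduli_Some)
  then show ?thesis by blast
qed

lemma slot_moduli_set_weight_subset: "weight A = None \<Longrightarrow> slot_moduli H (set_weight i A) \<subseteq> slot_moduli H A"
  by (auto simp: slot_moduli_def param_moduli_Some)

text \<open>By positivity the moduli space is the union of its weighted subspaces, and the slot
  conditions do not involve the weight.\<close>

lemma nonempty_weights_eq_empty_iff: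
  assumes "plain_symb H A"
  shows "nonempty_weights H A = {} \<longleftrightarrow> slot_moduli H A = {}"
proof -
  have "\<exists>i. slot_moduli H (set_weight i A) \<noteq> {}" if "slot_moduli H A \<noteq> {}"
  proof -
    from that obtain p where p: "p \<in> param_moduli H (bdry A) (index A) None"
        "\<forall>(v, q)\<in>pointed A \<union> flow_out A. vertex_at p v q"
      using assms by (auto simp: slot_moduli_def plain_symb_def)
    then obtain i where "p \<in> param_moduli H (bdry A) (index A) (Some i)"
      using param_moduli_weight assms unfolding plain_symb_def by blast
    then have "p \<in> {p \<in> param_moduli H (bdry A) (index A) (Some i).
        \<forall>(v, q)\<in>pointed A \<union> flow_out A. vertex_at p v q}"
      using p(2) by blast
    then have "slot_moduli H (set_weight i A) \<noteq> {}"
      unfolding slot_moduli_def set_weight_sel by blast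
    then show ?thesis ..
  qed
  moreover have "slot_moduli H (set_weight i A) \<subseteq> slot_moduli H A" for i
    using assms slot_moduli_set_weight_subset by (simp add: plain_symb_def)
  ultimately show ?thesis
    unfolding nonempty_weights_def by blast
qed

text \<open>Every weight that occurs is an intersection number at \<open>w\<close> of some polygon
  in the unconstrained moduli space, and the compactness assumption leaves only finitely many of
  these.\<close>

lemma finite_nonempty_weights:
  assumes "plain_symb H A" shows "finite (nonempty_weights H A)"
proof (rule finite_subset)
  show "nonempty_weights H A \<subseteq>
      nat ` intersection_number H (w_pt H) ` param_moduli H (bdry A) (index A) None"
    unfolding nonempty_weights_def slot_moduli_def by (force simp: param_moduli_Some)
  show "finite (nat ` intersection_number H (w_pt H) ` param_moduli H (bdry A) (index A) None)"
    using assms finite_w_intersections by (simp add: plain_symb_def)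
qed

text \<open>The constant value of an index 0 bigon lies on two tori, away from the divisor at \<open>w\<close>.\<close>

lemma bigon_index_0_weight:
  assumes "boundary_condition H B'" "p \<in> param_moduli H B' 0 None" "length (fst p) = 2"
  shows "intersection_number H (w_pt H) p = 0"
proof -
  obtain as \<phi> ps where p: "p = (as, \<phi>, ps)" by (cases p)
  have as: "as \<in> B'" "length as = 2" and wp: "whitney_polygon H (as, \<phi>, ps)"
    and hol: "pseudo_hol H (as, \<phi>, ps)" "maslov H (as, \<phi>, ps) = 0"
    using assms(2,3) by (auto simp: p param_moduli_def)
  have B': "B' = rot_class as" "set as \<subseteq> circle_sets H"
    using boundary_conditionD[OF assms(1) as(1)] by auto
  obtain c where c: "\<And>y. y \<in> cball 0 1 \<Longrightarrow> \<phi> y = c"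
    using bigon_index_0_constant[OF _ as(2) wp hol] assms(1) B' unfolding constant_on_def by auto
  obtain \<theta> where \<theta>: "\<And>i t. i < length as \<Longrightarrow> t \<in> {\<theta> i..\<theta> (Suc i)} \<Longrightarrow> \<phi> (cis t) \<in> torus (as ! i)"
      "\<And>i. i < length as \<Longrightarrow> \<theta> i < \<theta> (Suc i)"
    using wp unfolding whitney_polygon_def prod.case by blast
  have "\<phi> (cis (\<theta> 0)) \<in> torus (as ! 0)"
    using \<theta>(1)[of 0 "\<theta> 0"] \<theta>(2)[of 0] as(2) by simp
  then have "c \<in> torus (as ! 0)"
    using c[of "cis (\<theta> 0)"] by simp
  then obtain x where x: "c = image_mset x (mset_set (as ! 0))" "\<forall>d\<in>as ! 0. x d \<in> d"
    unfolding torus_def by auto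
  have "set_mset c \<subseteq> x ` (as ! 0)"
    unfolding x(1) by (cases "finite (as ! 0)") auto
  moreover have "as ! 0 \<in> circle_sets H"
    using B'(2) as(2) nth_mem[of 0 as] by auto
  ultimately have "set_mset c \<subseteq> \<Union>(\<Union>(circle_sets H))"
    using x(2) by blast
  then have "w_pt H \<notin># c"
    using w_not_on_circles by auto
  then have "{y \<in> ball 0 1. w_pt H \<in># \<phi> y} = {}"
    using c by auto
  then show ?thesis
    unfolding intersection_number_def p by (simp only: prod.case sum.empty)
qed

text \<open>This makes the relation that sets nonempty spaces of index 0 bigons equal to 1
  compatible with the morphism: such a symbol contributes only \<open>U ^ 0\<close>.\<close>

lemma nonempty_weights_bigon_index_0:
  assumes "plain_symb H A" "arity A = 2" "index A = 0" "slot_moduli H A \<noteq> {}"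
  shows "nonempty_weights H A = {0}"
proof -
  have bc: "boundary_condition H (bdry A)"
    using assms(1) by (simp add: plain_symb_def)
  have "i = 0" if "i \<in> nonempty_weights H A" for i
  proof -
    from that obtain p where "p \<in> param_moduli H (bdry A) 0 (Some i)"
      unfolding nonempty_weights_def slot_moduli_def using assms(3) by auto
    then have p: "p \<in> param_moduli H (bdry A) 0 None" "intersection_number H (w_pt H) p = int i"
      by (auto simp: param_moduli_Some)
    then have "length (fst p) = 2"
      using arity_eq_length[OF bc, of "fst p"] assms(2) by (simp add: param_moduli_def)
    then show "i = 0"
      using bigon_index_0_weight[OF bc p(1)] p(2) by simp
  qed
  then show ?thesis
    using nonempty_weights_eq_empty_iff[OF assms(1)] assms(4) by blast
qed

lemma coef_of_set_weight:
  "i \<in> nonempty_weights H A \<Longrightarrow>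
    coef_of H (set_weight i A) = (if arity A = 2 \<and> index A = 0 then 1 else poly_var (Some (set_weight i A)))"
  by (simp add: coef_of_def nonempty_weights_def)

lemma talg_of_set_weight:
  "i \<in> nonempty_weights H A \<Longrightarrow> \<not> fully_pointed A \<Longrightarrow> talg_of H (set_weight i A) = word [set_weight i A]"
  by (simp add: talg_of_def nonempty_weights_def)

text \<open>The morphism is given on variables, so the two degenerate normal forms need an argument:
  an empty space has no weights, which gives 0, and an index 0 bigon has only the weight 0, which
  gives 1.\<close>

lemma FU_coef_coef_of:
  assumes "plain_symb H A"
  shows "FU_coef H (coef_of H A) = (\<Sum>i\<in>nonempty_weights H A. U_coef ^ i * coef_of H (set_weight i A))"
proof (cases "slot_moduli H A = {}")
  case True
  then show ?thesis
    using nonempty_weights_eq_empty_iff[OF assms] by (simp add: coef_of_def)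
next
  case False
  show ?thesis
  proof (cases "arity A = 2 \<and> index A = 0")
    case True
    then have *: "nonempty_weights H A = {0}"
      using nonempty_weights_bigon_index_0[OF assms] False by blast
    then have "coef_of H (set_weight 0 A) = 1"
      using True by (simp add: coef_of_set_weight)
    then show ?thesis
      using True False * by (simp add: coef_of_def)
  next
    case nb: False
    have "FU_coef H (coef_of H A) = poly_subst (variable_FU H) (poly_var (Some A))"
      unfolding coef_of_def FU_coef_eq_poly_subst using False nb by (simp only: if_False)
    then show ?thesis
      unfolding poly_subst_var by (simp add: variable_FU_def)
  qed
qed

lemma FU_talg_talg_of:
  assumes "plain_symb H A"
  shows "FU_talg H (talg_of H A) = (\<Sum>i\<in>nonempty_weights H A. scal (U_coef ^ i) * talg_of H (set_weight i A))"
proof (cases "fully_pointed A")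
  case True
  then show ?thesis
    by (simp add: talg_of_def FU_talg_scal FU_coef_coef_of[OF assms] scal_sum scal_mult)
next
  case False
  then show ?thesis
    using nonempty_weights_eq_empty_iff[OF assms]
    by (cases "slot_moduli H A = {}") (simp_all add: talg_of_def[of H A] FU_talg_word FU_word_def)
qed

section \<open>Injectivity\<close>

text \<open>A left inverse sets \<open>U\<close> to 1 and keeps only the smallest weight of each symbol.\<close>

definition lowest_weight_variable :: "'a symb option \<Rightarrow> 'a coef" where
  "lowest_weight_variable v = (case v of None \<Rightarrow> 1
     | Some B \<Rightarrow> if weight B = Some (LEAST i. i \<in> nonempty_weights H (forget_weight B))
                 then poly_var (Some (forget_weight B)) else 0)"

lemma FU_coef_eq_0_iff:
  assumes "f \<in> plain_coefs H"
  shows "FU_coef H f = 0 \<longleftrightarrow> f = 0"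
proof -
  have "poly_subst lowest_weight_variable (FU_coef H f) = f"
    unfolding FU_coef_eq_poly_subst
  proof (rule poly_subst_left_inverse)
    fix m v assume "m \<in> Poly_Mapping.keys f" "v \<in> Poly_Mapping.keys m"
    then have "plain_variable H v"
      using assms by (auto simp: plain_coefs_def)
    then obtain A where A: "v = Some A" "plain_symb H A" "slot_moduli H A \<noteq> {}"
        "\<not> (arity A = 2 \<and> index A = 0)"
      by (auto simp: plain_variable_def)
    let ?W = "nonempty_weights H A"
    have U: "poly_subst lowest_weight_variable U_coef = 1"
      unfolding U_coef_def poly_subst_var by (simp add: lowest_weight_variable_def)
    have fw: "forget_weight (set_weight i A) = A" for i
      using A(2) by (simp add: forget_weight_set_weight plain_symb_def)
    have least: "(LEAST i. i \<in> ?W) \<in> ?W"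
      using A(2,3) nonempty_weights_eq_empty_iff by (metis LeastI_ex all_not_in_conv)
    \<comment> \<open>\<open>A\<close> is not a bigon of index 0, so each weighted version is a
      genuine variable, and its factor \<open>U ^ i\<close> is sent to 1.\<close>
    have "poly_subst lowest_weight_variable (variable_FU H v) =
        (\<Sum>i\<in>?W. poly_subst lowest_weight_variable (poly_var (Some (set_weight i A))))"
      using A(1,4) coef_of_set_weight
      by (auto simp: variable_FU_def poly_subst_sum poly_subst_mult poly_subst_power U intro!: sum.cong)
    \<comment> \<open>\<open>forget_weight\<close> returns \<open>A\<close>, so the test inside
      \<open>lowest_weight_variable\<close> compares with the least weight of \<open>A\<close>
      itself; a single summand survives.\<close>
    also have "\<dots> = (\<Sum>i\<in>?W. if i = (LEAST i. i \<in> ?W) then poly_var (Some A) else 0)"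
      by (rule sum.cong[OF HOL.refl], subst poly_subst_var) (simp add: lowest_weight_variable_def fw)
    also have "\<dots> = poly_var v"
      using least finite_nonempty_weights[OF A(2)] A(1) by simp
    finally show "poly_subst lowest_weight_variable (variable_FU H v) = poly_var v" .
  qed
  then show ?thesis
    by (metis FU_coef_zero poly_subst_zero)
qed

end

section \<open>Weighted lifts of words\<close>

lemma U_power_eq: "U_coef ^ k = Poly_Mapping.single (Poly_Mapping.single None k) 1"
  unfolding U_coef_def by (rule single_power)

lemma mult_U_power_eq_0_iff: "f * U_coef ^ k = 0 \<longleftrightarrow> f = 0"
  unfolding U_power_eq by (rule mult_single_eq_0_iff)

text \<open>The index set of the expanded image of a word: each letter receives one of the weights
  for which its moduli space is nonempty.\<close>

definition lifts :: "'a heegaard \<Rightarrow> 'a symb list \<Rightarrow> 'a symb list set" where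
  "lifts H As = {Bs. list_all2 (\<lambda>A B. \<exists>i\<in>nonempty_weights H A. B = set_weight i A) As Bs}"

definition total_weight :: "'a symb list \<Rightarrow> nat" where
  "total_weight Bs = (\<Sum>B\<leftarrow>Bs. the (weight B))"

lemma lifts_Nil [simp]: "lifts H [] = {[]}"
  by (simp add: lifts_def)

lemma total_weight_simps [simp]:
  "total_weight [] = 0" "total_weight (B # Bs) = the (weight B) + total_weight Bs"
  "total_weight (Bs @ Cs) = total_weight Bs + total_weight Cs"
  by (simp_all add: total_weight_def)

lemma set_weight_inject [simp]: "set_weight i A = set_weight j A \<longleftrightarrow> i = j"
  by (simp add: set_weight_def)

lemma lifts_Cons: "lifts H (A # As) = (\<lambda>(i, Bs). set_weight i A # Bs) ` (nonempty_weights H A \<times> lifts H As)"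
  by (auto simp: lifts_def list_all2_Cons1)

text \<open>The product of two words alters the last letter of the left one and the first letter of
  the right one, so lifts are decomposed at either end.\<close>

lemma lifts_snoc: "lifts H (As @ [A]) = (\<lambda>(Bs, i). Bs @ [set_weight i A]) ` (lifts H As \<times> nonempty_weights H A)"
proof (rule Set.set_eqI, rule iffI)
  fix Bs assume "Bs \<in> lifts H (As @ [A])"
  then obtain us vs where "Bs = us @ vs" "us \<in> lifts H As" "vs \<in> lifts H [A]"
    unfolding lifts_def mem_Collect_eq list_all2_append1 by blast
  then show "Bs \<in> (\<lambda>(Bs, i). Bs @ [set_weight i A]) ` (lifts H As \<times> nonempty_weights H A)"
    unfolding lifts_Cons by auto
next
  fix Bs assume "Bs \<in> (\<lambda>(Bs, i). Bs @ [set_weight i A]) ` (lifts H As \<times> nonempty_weights H A)"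
  then show "Bs \<in> lifts H (As @ [A])"
    by (auto simp: lifts_def intro: list_all2_appendI)
qed

lemma sum_lifts_Cons:
  "(\<Sum>Bs\<in>lifts H (A # As). g Bs) = (\<Sum>i\<in>nonempty_weights H A. \<Sum>Bs\<in>lifts H As. g (set_weight i A # Bs))"
  unfolding lifts_Cons sum.cartesian_product
  by (subst sum.reindex) (auto simp: inj_on_def intro!: sum.cong)

lemma sum_lifts_snoc:
  "(\<Sum>Bs\<in>lifts H (As @ [A]). g Bs) = (\<Sum>Bs\<in>lifts H As. \<Sum>i\<in>nonempty_weights H A. g (Bs @ [set_weight i A]))"
  unfolding lifts_snoc sum.cartesian_product
  by (subst sum.reindex) (auto simp: inj_on_def intro!: sum.cong)

text \<open>A word is recovered from any of its lifts. Hence different words have disjoint sets of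
  lifts, and images of different words cannot cancel.\<close>

lemma map_forget_weight_lifts:
  "Bs \<in> lifts H As \<Longrightarrow> (\<And>A. A \<in> set As \<Longrightarrow> weight A = None) \<Longrightarrow> map forget_weight Bs = As"
  by (induction As arbitrary: Bs) (auto simp: lifts_Cons forget_weight_set_weight)

lemma flow_type_lifts: "Bs \<in> lifts H As \<Longrightarrow> flow_type (FWord Bs) = flow_type (FWord As)"
proof (induction As arbitrary: Bs)
  case (Cons A As)
  then obtain i Cs where "Bs = set_weight i A # Cs" "flow_type (FWord Cs) = flow_type (FWord As)"
    by (auto simp: lifts_Cons)
  then show ?case
    by (simp add: flow_type_def fun_eq_iff del: split_paired_All)
qed simp

context heegaard_theory
begin

lemma plain_letterD:
  assumes "plain_letter H A"
  shows "plain_symb H A" "weight A = None" "nonempty_weights H A \<noteq> {}"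
    "finite (nonempty_weights H A)" "\<not> fully_pointed A"
  using assms nonempty_weights_eq_empty_iff finite_nonempty_weights
  by (auto simp: plain_letter_def plain_symb_def)

lemma finite_lifts: "(\<And>A. A \<in> set As \<Longrightarrow> plain_letter H A) \<Longrightarrow> finite (lifts H As)"
  by (induction As) (auto simp: lifts_Cons plain_letterD)

lemma lifts_nonempty: "(\<And>A. A \<in> set As \<Longrightarrow> plain_letter H A) \<Longrightarrow> lifts H As \<noteq> {}"
  by (induction As) (auto simp: lifts_Cons plain_letterD)

lemma FU_word_eq_sum_lifts:
  assumes "\<And>A. A \<in> set As \<Longrightarrow> plain_letter H A"
  shows "FU_word H As = (\<Sum>Bs\<in>lifts H As. scal (U_coef ^ total_weight Bs) * word Bs)"
  using assms
proof (induction As)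
  case (Cons A As)
  have "FU_word H (A # As) =
      (\<Sum>i\<in>nonempty_weights H A. scal (U_coef ^ i) * word [set_weight i A]) * FU_word H As"
    using plain_letterD[of A] Cons.prems by (simp add: FU_word_def talg_of_set_weight)
  also have "\<dots> = (\<Sum>i\<in>nonempty_weights H A. \<Sum>Bs\<in>lifts H As.
      (scal (U_coef ^ i) * word [set_weight i A]) * (scal (U_coef ^ total_weight Bs) * word Bs))"
    using Cons by (simp add: sum_product)
  also have "\<dots> = (\<Sum>Bs\<in>lifts H (A # As). scal (U_coef ^ total_weight Bs) * word Bs)"
  proof -
    \<comment> \<open>Centrality of scalars collects the powers of \<open>U\<close> in front, where
      the exponents add up to the total weight.\<close>
    have "(scal (U_coef ^ i) * word [set_weight i A]) * (scal (U_coef ^ total_weight Bs) * word Bs) =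
        scal (U_coef ^ total_weight (set_weight i A # Bs)) * word (set_weight i A # Bs)" for i Bs
      using word_append[of "[set_weight i A]" Bs]
      by (simp add: power_add scal_mult mult.assoc scal_left_commute[of "word _"])
    then show ?thesis
      unfolding sum_lifts_Cons by simp
  qed
  finally show ?case .
qed simp

text \<open>The expansion has one monomial for each word of \<open>a\<close> and each of its lifts.
  Forgetting weights shows that they are pairwise different, so every coefficient comes from a
  single term, and it is nonzero by injectivity on coefficients.\<close>

lemma
  assumes a: "a \<in> plain_talgs H"
  shows keys_FU_talg: "Poly_Mapping.keys (FU_talg H a) = (\<Union>u\<in>Poly_Mapping.keys a. FWord ` lifts H (letters u))"
    and lookup_FU_talg: "u \<in> Poly_Mapping.keys a \<Longrightarrow> Bs \<in> lifts H (letters u) \<Longrightarrow>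
      Poly_Mapping.lookup (FU_talg H a) (FWord Bs) = FU_coef H (Poly_Mapping.lookup a u) * U_coef ^ total_weight Bs"
    and sum_keys_FU_talg: "(\<Sum>w\<in>Poly_Mapping.keys (FU_talg H a). g w) =
      (\<Sum>u\<in>Poly_Mapping.keys a. \<Sum>Bs\<in>lifts H (letters u). g (FWord Bs))"
proof -
  have letters: "plain_letter H A" if "u \<in> Poly_Mapping.keys a" "A \<in> set (letters u)" for u A
    using a that by (auto simp: plain_talgs_def)
  have fin: "finite (lifts H (letters u))" if "u \<in> Poly_Mapping.keys a" for u
    using letters[OF that] finite_lifts by blast
  have forget: "map forget_weight Bs = letters u" if "u \<in> Poly_Mapping.keys a" "Bs \<in> lifts H (letters u)" for u Bs
    using map_forget_weight_lifts[OF that(2)] letters[OF that(1)] plain_letterD(2) by blast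
  have uniq: "u = v" if "u \<in> Poly_Mapping.keys a" "Bs \<in> lifts H (letters u)"
    "v \<in> Poly_Mapping.keys a" "Bs \<in> lifts H (letters v)" for u v Bs
    using forget[OF that(1,2)] forget[OF that(3,4)] by (metis fword.expand)
  have eq: "FU_talg H a = (\<Sum>u\<in>Poly_Mapping.keys a. \<Sum>Bs\<in>lifts H (letters u).
      Poly_Mapping.single (FWord Bs) (FU_coef H (Poly_Mapping.lookup a u) * U_coef ^ total_weight Bs))"
    unfolding FU_talg_eq_lin_ext lin_ext_def
    by (rule sum.cong)
      (simp_all add: FU_word_eq_sum_lifts[OF letters] sum_distrib_left word_def scal_mult_single)
  have lookup_eq: "Poly_Mapping.lookup (FU_talg H a) (FWord Bs) =
      (\<Sum>u\<in>Poly_Mapping.keys a. if Bs \<in> lifts H (letters u)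
        then FU_coef H (Poly_Mapping.lookup a u) * U_coef ^ total_weight Bs else 0)" for Bs
    unfolding eq lookup_sum by (rule sum.cong) (simp_all add: lookup_single when_def fin)
  show lookup: "Poly_Mapping.lookup (FU_talg H a) (FWord Bs) =
      FU_coef H (Poly_Mapping.lookup a u) * U_coef ^ total_weight Bs"
    if "u \<in> Poly_Mapping.keys a" "Bs \<in> lifts H (letters u)" for u Bs
  proof -
    have "(Bs \<in> lifts H (letters v)) = (v = u)" if "v \<in> Poly_Mapping.keys a" for v
      using uniq that \<open>u \<in> _\<close> \<open>Bs \<in> _\<close> by blast
    then show ?thesis
      using \<open>u \<in> _\<close> unfolding lookup_eq by (simp cong: sum.cong)
  qed
  show keys: "Poly_Mapping.keys (FU_talg H a) = (\<Union>u\<in>Poly_Mapping.keys a. FWord ` lifts H (letters u))"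
  proof (rule Set.set_eqI, rule iffI)
    fix w assume w: "w \<in> Poly_Mapping.keys (FU_talg H a)"
    obtain Bs where Bs: "w = FWord Bs" by (cases w)
    have "\<exists>u\<in>Poly_Mapping.keys a. Bs \<in> lifts H (letters u)"
    proof (rule ccontr)
      assume "\<not> ?thesis"
      then have "Poly_Mapping.lookup (FU_talg H a) (FWord Bs) = 0"
        unfolding lookup_eq by (intro sum.neutral) auto
      then show False using w Bs by (simp add: in_keys_iff)
    qed
    then show "w \<in> (\<Union>u\<in>Poly_Mapping.keys a. FWord ` lifts H (letters u))"
      using Bs by auto
  next
    fix w assume "w \<in> (\<Union>u\<in>Poly_Mapping.keys a. FWord ` lifts H (letters u))"
    then obtain u Bs where u: "u \<in> Poly_Mapping.keys a" "Bs \<in> lifts H (letters u)" "w = FWord Bs"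
      by auto
    \<comment> \<open>A key has a nonzero coefficient; the morphism keeps it nonzero, and so does
      multiplication by a power of \<open>U\<close>.\<close>
    have "Poly_Mapping.lookup a u \<in> plain_coefs H" "Poly_Mapping.lookup a u \<noteq> 0"
      using a u(1) by (auto simp: plain_talgs_def in_keys_iff)
    then have "FU_coef H (Poly_Mapping.lookup a u) * U_coef ^ total_weight Bs \<noteq> 0"
      by (simp add: mult_U_power_eq_0_iff FU_coef_eq_0_iff)
    then show "w \<in> Poly_Mapping.keys (FU_talg H a)"
      using lookup[OF u(1,2)] u(3) by (simp add: in_keys_iff)
  qed
  show "(\<Sum>w\<in>Poly_Mapping.keys (FU_talg H a). g w) =
      (\<Sum>u\<in>Poly_Mapping.keys a. \<Sum>Bs\<in>lifts H (letters u). g (FWord Bs))"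
  proof -
    have "(\<Sum>w\<in>Poly_Mapping.keys (FU_talg H a). g w) =
        (\<Sum>u\<in>Poly_Mapping.keys a. \<Sum>w\<in>FWord ` lifts H (letters u). g w)"
      unfolding keys by (rule sum.UNION_disjoint) (use fin uniq in auto)
    also have "\<dots> = (\<Sum>u\<in>Poly_Mapping.keys a. \<Sum>Bs\<in>lifts H (letters u). g (FWord Bs))"
      by (intro sum.cong HOL.refl sum.reindex_cong[where l = FWord]) (auto simp: inj_on_def)
    finally show ?thesis .
  qed
qed

text \<open>Weights do not affect flow vertices, and each word that occurs has at least one lift, so
  no type is gained or lost.\<close>

lemma flow_types_FU_talg:
  assumes "a \<in> plain_talgs H"
  shows "flow_type ` Poly_Mapping.keys (FU_talg H a) = flow_type ` Poly_Mapping.keys a"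
proof -
  have *: "lifts H (letters u) \<noteq> {}" if "u \<in> Poly_Mapping.keys a" for u
    using assms that by (intro lifts_nonempty) (auto simp: plain_talgs_def)
  have "flow_type ` FWord ` lifts H (letters u) = {flow_type u}" if "u \<in> Poly_Mapping.keys a" for u
    using *[OF that] flow_type_lifts[of _ H "letters u"] by (auto simp: image_iff) 
  then show ?thesis
    unfolding keys_FU_talg[OF assms] image_UN by auto
qed

text \<open>An element vanishes exactly if it has no flow types, so injectivity on the tensor
  algebra is read off the preservation of types.\<close>

lemma FU_talg_eq_0_iff:
  assumes "a \<in> plain_talgs H"
  shows "FU_talg H a = 0 \<longleftrightarrow> a = 0"
proof -
  have "Poly_Mapping.keys b = {} \<longleftrightarrow> b = 0" for b :: "'a talg"
    by (metis in_keys_iff keys_zero empty_iff equals0I lookup_zero poly_mapping_eqI)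
  then show ?thesis
    using flow_types_FU_talg[OF assms] by (metis image_is_empty)
qed

end

section \<open>The operations\<close>

lemma FU_simps [simp]: "FU H Omega = Omega" "FU H (Some a) = Some (FU_talg H a)"
  by (simp_all add: FU_def)

lemma FU_eq_Omega_iff [simp]: "FU H x = Omega \<longleftrightarrow> x = Omega"
  by (simp add: FU_def)

lemma coef_scale_simps [simp]:
  "coef_scale f Omega = Omega" "coef_scale f (Some a) = Some (scal f * a)"
  "coef_scale f x = Omega \<longleftrightarrow> x = Omega"
  by (simp_all add: coef_scale_def)

lemma FU_coef_scale: "FU H (coef_scale f x) = coef_scale (FU_coef H f) (FU H x)"
  by (cases x) (simp_all add: FU_talg_mult FU_talg_scal)

section \<open>Flow types and partially defined sums\<close>

definition flow_types :: "'a talg \<Rightarrow> (('a vertex \<Rightarrow> nat) \<times> ('a vertex \<Rightarrow> nat)) set" where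
  "flow_types a = flow_type ` Poly_Mapping.keys a"

lemma flow_types_zero [simp]: "flow_types 0 = {}"
  by (simp add: flow_types_def)

lemma flow_types_add_subset: "flow_types (a + b) \<subseteq> flow_types a \<union> flow_types b"
  using Poly_Mapping.keys_add[of a b] by (auto simp: flow_types_def)

lemma flow_types_eq_empty_iff: "flow_types a = {} \<longleftrightarrow> a = 0"
  by (metis flow_types_def image_is_empty equals0I in_keys_iff keys_zero lookup_zero poly_mapping_eqI empty_iff)

lemma flow_types_sum_subset: "flow_types (sum a I) \<subseteq> (\<Union>i\<in>I. flow_types (a i))"
  by (induction I rule: infinite_finite_induct) (use flow_types_add_subset in fastforce)+

lemma boxsum_eq:
  "boxsum x I = (if (\<exists>i\<in>I. x i = Omega) \<or>
      \<not> (\<forall>s\<in>\<Union>i\<in>I. flow_types (the (x i)). \<forall>t\<in>\<Union>i\<in>I. flow_types (the (x i)). s = t)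
    then Omega else Some (\<Sum>i\<in>I. the (x i)))"
  unfolding boxsum_def flow_types_def by (rule arg_cong[where f = "\<lambda>c. if c then _ else _"]) blast

lemma boxsum_Omega: "\<exists>i\<in>I. x i = Omega \<Longrightarrow> boxsum x I = Omega"
  unfolding boxsum_def by (rule if_P) (rule disjI1)

text \<open>The standard way to show that a sum is defined. The type \<open>t\<close> is only an
  upper bound, because a summand 0 has no flow type and is compatible with everything.\<close>

lemma boxsum_homogeneous:
  assumes "\<And>i. i \<in> I \<Longrightarrow> x i = Some (a i)" "\<And>i. i \<in> I \<Longrightarrow> flow_types (a i) \<subseteq> {t}"
  shows "boxsum x I = Some (\<Sum>i\<in>I. a i)"
proof -
  have "(\<Union>i\<in>I. flow_types (the (x i))) \<subseteq> {t}"
    using assms by fastforce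
  moreover have "(\<Sum>i\<in>I. the (x i)) = (\<Sum>i\<in>I. a i)"
    using assms(1) by simp
  ultimately show ?thesis
    unfolding boxsum_eq using assms(1) by auto
qed

lemma boxplus_homogeneous:
  "flow_types a \<subseteq> {t} \<Longrightarrow> flow_types b \<subseteq> {t} \<Longrightarrow> Some a \<boxplus> Some b = Some (a + b)"
  unfolding boxplus_def
  by (subst boxsum_homogeneous[where a = "\<lambda>c. if c then a else b" and t = t]) (auto simp: UNIV_bool add.commute)

lemma boxplus_Omega [simp]: "Omega \<boxplus> y = Omega" "x \<boxplus> Omega = Omega"
  by (auto simp: boxplus_def boxsum_eq)

lemma boxtimes_Omega [simp]: "boxtimes H Omega y = Omega" "boxtimes H x Omega = Omega"
  by (auto simp: boxtimes_def split: option.split)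

lemma boxplus_zero: "Some 0 \<boxplus> Some 0 = Some 0"
  by (simp add: boxplus_homogeneous)

text \<open>Zero has no monomials: the sum over pairs of words is empty, and no matching of vertices
  is tested.\<close>

lemma boxtimes_zero [simp]: "boxtimes H (Some 0) (Some b) = Some 0" "boxtimes H (Some a) (Some 0) = Some 0"
  by (auto simp: boxtimes_def boxsum_def)

text \<open>The absorbing element counts as plain, so that the set is closed under the operations
  whether or not they are defined.\<close>

definition plain_thats :: "'a heegaard \<Rightarrow> 'a that set" where
  "plain_thats H = {x. \<forall>a. x = Some a \<longrightarrow> a \<in> plain_talgs H}"

lemma plain_thats_simps [simp]: "Omega \<in> plain_thats H" "Some a \<in> plain_thats H \<longleftrightarrow> a \<in> plain_talgs H"
  by (simp_all add: plain_thats_def)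

lemma plain_thats_boxsum:
  assumes "\<And>i. i \<in> I \<Longrightarrow> x i \<in> plain_thats H"
  shows "boxsum x I \<in> plain_thats H"
proof (cases "\<exists>i\<in>I. x i = Omega")
  case False
  then have "the (x i) \<in> plain_talgs H" if "i \<in> I" for i
    using assms[OF that] that by auto
  then show ?thesis
    by (auto simp: boxsum_eq intro: plain_talgs_sum)
qed (simp add: boxsum_eq)

lemma plain_thats_boxplus: "x \<in> plain_thats H \<Longrightarrow> y \<in> plain_thats H \<Longrightarrow> x \<boxplus> y \<in> plain_thats H"
  unfolding boxplus_def by (rule plain_thats_boxsum) simp

lemma plain_thats_coef_scale: "f \<in> plain_coefs H \<Longrightarrow> x \<in> plain_thats H \<Longrightarrow> coef_scale f x \<in> plain_thats H"
  by (cases x) (simp_all add: plain_talgs_mult plain_talgs_scal)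

lemma boxtimes_words_zero [simp]:
  "boxtimes_words H 0 v = Some (word (letters v))" "boxtimes_words H u 0 = Some (word (letters u))"
  by (simp_all add: boxtimes_words_def)

lemma boxtimes_words_snoc_Cons [simp]:
  "boxtimes_words H (FWord (us @ [R])) (FWord (C # vs)) =
    (if fst ` swap_pointings (flow_out R) \<subseteq> flow_in C
     then Some (word us * talg_of H (Kup R) * talg_of H (Kdown (swap_pointings (flow_out R)) C) * word vs)
     else Omega)"
  by (simp add: boxtimes_words_def zero_fword_def Let_def)

text \<open>The case distinction of \<open>boxtimes_words\<close>: the empty word is neutral,
  otherwise only the two letters that meet are altered.\<close>

lemma word_pair_cases:
  fixes u v :: "'b fword"
  obtains "u = 0" | "v = 0" | us R C vs where "u = FWord (us @ [R])" "v = FWord (C # vs)"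
  by (metis fword.exhaust list.exhaust rev_exhaust zero_fword_def)

lemma plain_letter_plain_symb: "plain_letter H A \<Longrightarrow> plain_symb H A"
  by (simp add: plain_letter_def)

lemma plain_thats_boxtimes_words:
  assumes "\<And>A. A \<in> set (letters u) \<Longrightarrow> plain_letter H A" "\<And>A. A \<in> set (letters v) \<Longrightarrow> plain_letter H A"
  shows "boxtimes_words H u v \<in> plain_thats H"
proof (cases rule: word_pair_cases[where u = u and v = v])
  case (3 us R C vs)
  then have "plain_symb H R" "plain_symb H C"
    using assms by (simp_all add: plain_letter_plain_symb)
  then show ?thesis
    using assms 3 by (auto intro!: plain_talgs_word plain_talgs_mult plain_talgs_talg_of)
qed (use assms in \<open>auto intro!: plain_talgs_word\<close>)

lemma plain_thats_boxtimes:
  assumes "x \<in> plain_thats H" "y \<in> plain_thats H"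
  shows "boxtimes H x y \<in> plain_thats H"
proof (cases x; cases y)
  fix a b assume "x = Some a" "y = Some b"
  then show ?thesis
    using assms unfolding boxtimes_def
    by (auto simp: plain_talgs_def intro!: plain_thats_boxsum plain_thats_coef_scale plain_coefs_mult
        plain_thats_boxtimes_words)
qed simp_all

text \<open>
  A product of pre-generators is a monomial with coefficient 1, also after passing to normal forms.
  The word \<open>As\<close> records the flow type; its fully pointed letters do not contribute.
\<close>

definition unit_monomial :: "'a talg \<Rightarrow> 'a symb list \<Rightarrow> bool" where
  "unit_monomial a As \<longleftrightarrow> (\<exists>z m. a = Poly_Mapping.single z (Poly_Mapping.single m 1) \<and>
     flow_type z = flow_type (FWord As))"

lemma flow_type_plus:
  "flow_type (u + v) = (\<lambda>s. fst (flow_type u) s + fst (flow_type v) s, \<lambda>s. snd (flow_type u) s + snd (flow_type v) s)"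
  by (simp add: flow_type_def)

lemma FWord_append: "FWord (As @ Bs) = FWord As + FWord Bs"
  by (simp add: plus_fword_def)

lemma unit_monomial_mult:
  assumes "unit_monomial a As" "unit_monomial b Bs" shows "unit_monomial (a * b) (As @ Bs)"
proof -
  obtain z m where a: "a = Poly_Mapping.single z (Poly_Mapping.single m 1)" "flow_type z = flow_type (FWord As)"
    using assms(1) by (auto simp: unit_monomial_def)
  obtain y n where b: "b = Poly_Mapping.single y (Poly_Mapping.single n 1)" "flow_type y = flow_type (FWord Bs)"
    using assms(2) by (auto simp: unit_monomial_def)
  have "a * b = Poly_Mapping.single (z + y) (Poly_Mapping.single (m + n) 1)"
    by (simp add: a b mult_single)
  moreover have "flow_type (z + y) = flow_type (FWord (As @ Bs))"
    by (simp only: FWord_append flow_type_plus a b)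
  ultimately show ?thesis
    unfolding unit_monomial_def by blast
qed

lemma unit_monomial_word: "unit_monomial (word As) As"
  unfolding unit_monomial_def word_def by (intro exI[of _ "FWord As"] exI[of _ 0]) simp

text \<open>A fully pointed symbol leaves the empty word, and having no flow vertices it has the
  same flow type as the empty word. Its coefficient is 1 or a variable, in either case a
  monomial.\<close>

lemma unit_monomial_talg_of:
  assumes "slot_moduli H A \<noteq> {}" shows "unit_monomial (talg_of H A) [A]"
proof (cases "fully_pointed A")
  case True
  then have "flow_type 0 = flow_type (FWord [A])"
    by (simp add: flow_type_def fully_pointed_def)
  moreover have "\<exists>m. coef_of H A = Poly_Mapping.single m 1"
    unfolding coef_of_def using assms by (auto intro: exI[of _ 0])
  ultimately show ?thesis
    using True unfolding unit_monomial_def talg_of_def scal_def by auto metis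
qed (use assms in \<open>simp add: talg_of_def unit_monomial_word\<close>)

lemma flow_types_scal_unit_monomial:
  assumes "unit_monomial a As"
  shows "flow_types (scal c * a) = (if c = 0 then {} else {flow_type (FWord As)})"
proof -
  obtain z m where a: "a = Poly_Mapping.single z (Poly_Mapping.single m 1)" "flow_type z = flow_type (FWord As)"
    using assms by (auto simp: unit_monomial_def)
  then have "scal c * a = Poly_Mapping.single z (c * Poly_Mapping.single m 1)"
    by (simp add: scal_mult_single)
  then show ?thesis
    using a(2) by (simp add: flow_types_def mult_single_eq_0_iff)
qed

lemma talg_of_empty: "slot_moduli H A = {} \<Longrightarrow> talg_of H A = 0"
  by (simp add: talg_of_def coef_of_def)

lemma lifts_snocE:
  assumes "Bs \<in> lifts H (As @ [A])"
  obtains Bs' i where "Bs = Bs' @ [set_weight i A]" "Bs' \<in> lifts H As" "i \<in> nonempty_weights H A"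
  using assms by (auto simp: lifts_snoc)

lemma lifts_ConsE:
  assumes "Bs \<in> lifts H (A # As)"
  obtains Bs' i where "Bs = set_weight i A # Bs'" "Bs' \<in> lifts H As" "i \<in> nonempty_weights H A"
  using assms by (auto simp: lifts_Cons)

text \<open>Whether the product is defined depends only on the flow-out of the last letter and the
  flow-in of the first one, and weights change neither.\<close>

lemma boxtimes_words_lifts_Omega_iff:
  assumes "Bs \<in> lifts H (letters u)" "Cs \<in> lifts H (letters v)"
  shows "boxtimes_words H (FWord Bs) (FWord Cs) = Omega \<longleftrightarrow> boxtimes_words H u v = Omega"
proof (cases rule: word_pair_cases[where u = u and v = v])
  case (3 us R C vs)
  obtain Bs' i where "Bs = Bs' @ [set_weight i R]"
    using assms(1) 3 by (auto elim: lifts_snocE)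
  moreover obtain Cs' j where "Cs = set_weight j C # Cs'"
    using assms(2) 3 by (auto elim: lifts_ConsE)
  ultimately show ?thesis
    by (simp add: 3)
qed (use assms in \<open>auto simp flip: zero_fword_def\<close>)

lemma sum_product4:
  fixes f g h k :: "_ \<Rightarrow> 'r::semiring_0"
  shows "sum f A * sum g B * sum h C * sum k D = (\<Sum>a\<in>A. \<Sum>b\<in>B. \<Sum>c\<in>C. \<Sum>d\<in>D. f a * g b * h c * k d)"
proof -
  have 1: "sum g B * (sum h C * sum k D) = (\<Sum>b\<in>B. \<Sum>c\<in>C. \<Sum>d\<in>D. g b * (h c * k d))"
    unfolding sum_product[of h] by (subst sum_product) (simp only: sum_distrib_left)
  have "sum f A * (sum g B * (sum h C * sum k D)) = (\<Sum>a\<in>A. \<Sum>b\<in>B. \<Sum>c\<in>C. \<Sum>d\<in>D. f a * (g b * (h c * k d)))"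
    unfolding 1 by (subst sum_product) (simp only: sum_distrib_left)
  then show ?thesis
    by (simp only: mult.assoc)
qed

section \<open>Compatibility of the morphism with the partial operations\<close>

context heegaard_theory
begin

text \<open>A new slot point may empty the space for some weights of \<open>A\<close>, but lifts of
  a word are indexed by the weights of the unconstrained letter. The additional summands are
  0.\<close>

lemma FU_talg_talg_of_Kdown:
  assumes "plain_symb H A"
  shows "FU_talg H (talg_of H (Kdown Q A)) =
    (\<Sum>i\<in>nonempty_weights H A. scal (U_coef ^ i) * talg_of H (Kdown Q (set_weight i A)))"
proof -
  have "FU_talg H (talg_of H (Kdown Q A)) =
      (\<Sum>i\<in>nonempty_weights H (Kdown Q A). scal (U_coef ^ i) * talg_of H (set_weight i (Kdown Q A)))"
    using assms by (intro FU_talg_talg_of) simp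
  also have "\<dots> = (\<Sum>i\<in>nonempty_weights H A. scal (U_coef ^ i) * talg_of H (set_weight i (Kdown Q A)))"
  proof (rule sum.mono_neutral_left)
    show "finite (nonempty_weights H A)"
      using assms by (rule finite_nonempty_weights)
    show "nonempty_weights H (Kdown Q A) \<subseteq> nonempty_weights H A"
      by (rule nonempty_weights_Kdown_subset)
    show "\<forall>i\<in>nonempty_weights H A - nonempty_weights H (Kdown Q A).
        scal (U_coef ^ i) * talg_of H (set_weight i (Kdown Q A)) = 0"
      by (auto simp: nonempty_weights_def talg_of_empty)
  qed
  finally show ?thesis by simp
qed

text \<open>The image of a product of words has four factors: the untouched letters on each side and
  the two letters that meet. Expanding each over its weights gives the sum over pairs of lifts, with
  the powers of \<open>U\<close> collected in front.\<close>

lemma FU_boxtimes_words: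
  assumes u: "\<And>A. A \<in> set (letters u) \<Longrightarrow> plain_letter H A"
    and v: "\<And>A. A \<in> set (letters v) \<Longrightarrow> plain_letter H A"
    and uv: "boxtimes_words H u v \<noteq> Omega"
  shows "(\<Sum>Bs\<in>lifts H (letters u). \<Sum>Cs\<in>lifts H (letters v).
      scal (U_coef ^ total_weight Bs * U_coef ^ total_weight Cs) * the (boxtimes_words H (FWord Bs) (FWord Cs)))
    = FU_talg H (the (boxtimes_words H u v))"
proof (cases rule: word_pair_cases[where u = u and v = v])
  case 1
  then show ?thesis
    using v by (simp add: FU_talg_word FU_word_eq_sum_lifts flip: zero_fword_def)
next
  case 2
  then show ?thesis
    using u by (simp add: FU_talg_word FU_word_eq_sum_lifts flip: zero_fword_def)
next
  case (3 us R C vs)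
  let ?Q = "swap_pointings (flow_out R)"
  have flow: "fst ` ?Q \<subseteq> flow_in C"
    using uv 3 by (auto split: if_splits)
  have R: "plain_symb H (Kup R)" and C: "plain_symb H C"
    using u[of R] v[of C] 3 by (auto dest: plain_letter_plain_symb)
  have "FU_talg H (the (boxtimes_words H u v)) = FU_word H us * FU_talg H (talg_of H (Kup R)) *
      FU_talg H (talg_of H (Kdown ?Q C)) * FU_word H vs"
    using flow by (simp add: 3 FU_talg_mult FU_talg_word)
  also have "\<dots> = (\<Sum>Bs\<in>lifts H us. scal (U_coef ^ total_weight Bs) * word Bs) *
      (\<Sum>i\<in>nonempty_weights H R. scal (U_coef ^ i) * talg_of H (Kup (set_weight i R))) *
      (\<Sum>j\<in>nonempty_weights H C. scal (U_coef ^ j) * talg_of H (Kdown ?Q (set_weight j C))) *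
      (\<Sum>Cs\<in>lifts H vs. scal (U_coef ^ total_weight Cs) * word Cs)"
    using u v 3 FU_talg_talg_of[OF R] FU_talg_talg_of_Kdown[OF C] by (simp add: FU_word_eq_sum_lifts)
  also have "\<dots> = (\<Sum>Bs\<in>lifts H (us @ [R]). \<Sum>Cs\<in>lifts H (C # vs).
      scal (U_coef ^ total_weight Bs * U_coef ^ total_weight Cs) * the (boxtimes_words H (FWord Bs) (FWord Cs)))"
  proof -
    have "(scal (U_coef ^ total_weight Bs) * word Bs) * (scal (U_coef ^ i) * talg_of H (Kup (set_weight i R))) *
        (scal (U_coef ^ j) * talg_of H (Kdown ?Q (set_weight j C))) * (scal (U_coef ^ total_weight Cs) * word Cs)
      = scal (U_coef ^ total_weight (Bs @ [set_weight i R]) * U_coef ^ total_weight (set_weight j C # Cs)) *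
        the (boxtimes_words H (FWord (Bs @ [set_weight i R])) (FWord (set_weight j C # Cs)))" for Bs i j Cs
    proof -
      have "(scal e * w) * (scal f * x) * (scal g * y) * (scal h * z) = scal ((e * f) * (g * h)) * (w * x * y * z)"
        for e f g h and w x y z :: "'a talg"
        by (simp only: scal_mult mult.assoc scal_left_commute[of w] scal_left_commute[of x] scal_left_commute[of y])
      then show ?thesis
        using flow by (simp add: power_add)
    qed
    then show ?thesis
      unfolding sum_product4 sum_lifts_snoc sum_lifts_Cons by simp
  qed
  finally show ?thesis
    by (simp add: 3)
qed

text \<open>Both sides consist of at most one type, the same one, so only emptiness has to be
  compared. An empty moduli space has empty weighted subspaces; conversely, if all weighted terms
  vanish, then so does the original one by injectivity.\<close>

lemma flow_types_lifts:
  assumes u: "\<And>A. A \<in> set (letters u) \<Longrightarrow> plain_letter H A"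
    and v: "\<And>A. A \<in> set (letters v) \<Longrightarrow> plain_letter H A"
    and uv: "boxtimes_words H u v \<noteq> Omega" and c: "c \<in> plain_coefs H"
  shows "(\<Union>Bs\<in>lifts H (letters u). \<Union>Cs\<in>lifts H (letters v).
      flow_types (scal (FU_coef H c * (U_coef ^ total_weight Bs * U_coef ^ total_weight Cs)) *
        the (boxtimes_words H (FWord Bs) (FWord Cs))))
    = flow_types (scal c * the (boxtimes_words H u v))" (is "?L = ?R")
proof -
  let ?t = "\<lambda>Bs Cs. scal (FU_coef H c * (U_coef ^ total_weight Bs * U_coef ^ total_weight Cs)) *
        the (boxtimes_words H (FWord Bs) (FWord Cs))"
  have "\<exists>t. (?R = {} \<longrightarrow> ?L = {}) \<and> ?R \<subseteq> {t} \<and> ?L \<subseteq> {t}"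
  proof (cases "c = 0")
    case False
    show ?thesis
    proof (cases rule: word_pair_cases[where u = u and v = v])
      case 1
      then have "?L \<subseteq> {flow_type (FWord (letters v))}"
        by (auto simp: flow_types_scal_unit_monomial[OF unit_monomial_word] flow_type_lifts
            simp flip: zero_fword_def split: if_splits)
      moreover have "?R = {flow_type (FWord (letters v))}"
        using 1 False by (simp add: flow_types_scal_unit_monomial[OF unit_monomial_word])
      ultimately show ?thesis by auto
    next
      case 2
      then have "?L \<subseteq> {flow_type (FWord (letters u))}"
        by (auto simp: flow_types_scal_unit_monomial[OF unit_monomial_word] flow_type_lifts
            simp flip: zero_fword_def split: if_splits)
      moreover have "?R = {flow_type (FWord (letters u))}"
        using 2 False by (simp add: flow_types_scal_unit_monomial[OF unit_monomial_word])
      ultimately show ?thesis by auto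
    next
      case (3 us R C vs)
      let ?Q = "swap_pointings (flow_out R)"
      let ?As = "\<lambda>us R C vs. us @ [Kup R] @ [Kdown ?Q C] @ vs"
      have flow: "fst ` ?Q \<subseteq> flow_in C"
        using uv 3 by (auto split: if_splits)
      have mono: "unit_monomial (the (boxtimes_words H (FWord (ws @ [S])) (FWord (E # zs)))) (?As ws S E zs)"
        if "flow_out S = flow_out R" "flow_in E = flow_in C" "slot_moduli H S \<noteq> {}"
          "slot_moduli H (Kdown ?Q E) \<noteq> {}" for ws S E zs
      proof -
        have "the (boxtimes_words H (FWord (ws @ [S])) (FWord (E # zs))) =
            word ws * (talg_of H (Kup S) * (talg_of H (Kdown ?Q E) * word zs))"
          using flow that by (simp add: mult.assoc)
        moreover have "unit_monomial \<dots> (?As ws S E zs)"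
          using that by (intro unit_monomial_mult unit_monomial_word unit_monomial_talg_of) simp_all
        ultimately show ?thesis
          by (simp only:)
      qed
      have zero: "the (boxtimes_words H (FWord (ws @ [S])) (FWord (E # zs))) = 0"
        if "flow_out S = flow_out R" "flow_in E = flow_in C" "slot_moduli H (Kdown ?Q E) = {}" for ws S E zs
        using flow that by (simp add: talg_of_empty)
      have "plain_letter H R" "plain_letter H C"
        using u[of R] v[of C] 3 by auto
      then have R: "slot_moduli H R \<noteq> {}" and C: "weight (Kdown ?Q C) = None"
        by (auto simp: plain_letter_def plain_symb_def)
      let ?T = "flow_type (FWord (?As us R C vs))"
      \<comment> \<open>For a particular weight of \<open>C\<close> the constrained space may be
        empty although the unweighted one is not; hence only an inclusion for each pair of
        lifts.\<close>
      have L: "flow_types (?t Bs Cs) \<subseteq> (if slot_moduli H (Kdown ?Q C) = {} then {} else {?T})"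
        if "Bs \<in> lifts H (letters u)" "Cs \<in> lifts H (letters v)" for Bs Cs
      proof -
        obtain Bs' i where Bs: "Bs = Bs' @ [set_weight i R]" "Bs' \<in> lifts H us" "i \<in> nonempty_weights H R"
          using \<open>Bs \<in> _\<close> 3 by (auto elim: lifts_snocE)
        obtain Cs' j where Cs: "Cs = set_weight j C # Cs'" "Cs' \<in> lifts H vs" "j \<in> nonempty_weights H C"
          using \<open>Cs \<in> _\<close> 3 by (auto elim: lifts_ConsE)
        have "slot_moduli H (Kdown ?Q (set_weight j C)) \<subseteq> slot_moduli H (Kdown ?Q C)"
          using slot_moduli_set_weight_subset[OF C] by simp
        moreover have "slot_moduli H (set_weight i R) \<noteq> {}"
          using Bs(3) by (simp add: nonempty_weights_def)
        moreover have "flow_type (FWord (?As Bs' (set_weight i R) (set_weight j C) Cs')) = ?T"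
          using flow_type_lifts[OF Bs(2)] flow_type_lifts[OF Cs(2)]
          by (simp add: flow_type_def fun_eq_iff del: split_paired_All)
        ultimately show ?thesis
          using mono[of "set_weight i R" "set_weight j C" Bs' Cs'] zero[of "set_weight i R" "set_weight j C" Bs' Cs']
          by (cases "slot_moduli H (Kdown ?Q (set_weight j C)) = {}")
            (auto simp: Bs(1) Cs(1) flow_types_scal_unit_monomial simp del: boxtimes_words_snoc_Cons Kdown_set_weight)
      qed
      have "?R = (if slot_moduli H (Kdown ?Q C) = {} then {} else {?T})"
      proof (cases "slot_moduli H (Kdown ?Q C) = {}")
        case True
        then show ?thesis
          unfolding 3 using zero[of R C us vs] by simp
      next
        case nonempty: False
        show ?thesis
          unfolding 3 using flow_types_scal_unit_monomial[OF mono[of R C us vs]] R nonempty False by simp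
      qed
      moreover have "?L \<subseteq> (if slot_moduli H (Kdown ?Q C) = {} then {} else {?T})"
        using L by blast
      moreover have "X = (if P then {} else {t}) \<Longrightarrow> Y \<subseteq> (if P then {} else {t}) \<Longrightarrow>
          (X = {} \<longrightarrow> Y = {}) \<and> X \<subseteq> {t} \<and> Y \<subseteq> {t}" for X Y :: "'b set" and P t
        by (auto split: if_splits)
      ultimately show ?thesis
        by (intro exI[of _ ?T])
    qed
  qed simp
  \<comment> \<open>If no type remained, every weighted term would be 0, and so would their sum,
    which is the image of the original term.\<close>
  moreover have "?L \<noteq> {}" if "?R \<noteq> {}"
  proof
    assume L: "?L = {}"
    have "?t Bs Cs = 0" if "Bs \<in> lifts H (letters u)" "Cs \<in> lifts H (letters v)" for Bs Cs
      using L that flow_types_eq_empty_iff[of "?t Bs Cs"] by blast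
    then have "(\<Sum>Bs\<in>lifts H (letters u). \<Sum>Cs\<in>lifts H (letters v). ?t Bs Cs) = 0"
      by simp
    moreover have "FU_talg H (the (boxtimes_words H u v)) =
        (\<Sum>Bs\<in>lifts H (letters u). \<Sum>Cs\<in>lifts H (letters v).
          scal (U_coef ^ total_weight Bs * U_coef ^ total_weight Cs) * the (boxtimes_words H (FWord Bs) (FWord Cs)))"
      using FU_boxtimes_words[of u v] u v uv by metis
    ultimately have "scal (FU_coef H c) * FU_talg H (the (boxtimes_words H u v)) = 0"
      by (simp only: sum_distrib_left scal_mult mult.assoc)
    then have "FU_talg H (scal c * the (boxtimes_words H u v)) = 0"
      by (simp add: FU_talg_mult FU_talg_scal)
    moreover have "scal c * the (boxtimes_words H u v) \<in> plain_talgs H"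
    proof (intro plain_talgs_mult plain_talgs_scal c)
      have "boxtimes_words H u v \<in> plain_thats H"
        using u v by (rule plain_thats_boxtimes_words)
      then show "the (boxtimes_words H u v) \<in> plain_talgs H"
        using uv by auto
    qed
    ultimately have "scal c * the (boxtimes_words H u v) = 0"
      by (simp add: FU_talg_eq_0_iff)
    then show False
      using that by simp
  qed
  ultimately show ?thesis by blast
qed

text \<open>A partial sum is determined by three data: whether a summand is undefined, the types
  that occur, and the total. The index sets may differ, since the summands on the equivariant side
  are indexed by lifts.\<close>

lemma FU_boxsum:
  assumes "(\<exists>j\<in>J. y j = Omega) \<longleftrightarrow> (\<exists>i\<in>I. x i = Omega)"
    and "(\<And>i. i \<in> I \<Longrightarrow> x i \<noteq> Omega) \<Longrightarrow> (\<Union>j\<in>J. flow_types (the (y j))) = (\<Union>i\<in>I. flow_types (the (x i)))"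
    and "(\<And>i. i \<in> I \<Longrightarrow> x i \<noteq> Omega) \<Longrightarrow> (\<Sum>j\<in>J. the (y j)) = FU_talg H (\<Sum>i\<in>I. the (x i))"
  shows "FU H (boxsum x I) = boxsum y J"
proof (cases "\<exists>i\<in>I. x i = Omega")
  case True
  then have "boxsum x I = Omega" "boxsum y J = Omega"
    using assms(1) by (blast intro: boxsum_Omega)+
  then show ?thesis by simp
next
  case False
  have x: "x i \<noteq> Omega" if "i \<in> I" for i
    using False that by auto
  have *: "\<not> (\<exists>j\<in>J. y j = Omega)" "(\<Union>j\<in>J. flow_types (the (y j))) = (\<Union>i\<in>I. flow_types (the (x i)))"
    "(\<Sum>j\<in>J. the (y j)) = FU_talg H (\<Sum>i\<in>I. the (x i))"
    using False assms(1) assms(2)[OF x] assms(3)[OF x] by simp_all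
  show ?thesis
    unfolding boxsum_eq *(2,3) using False *(1) by (simp only: FU_simps if_distrib[of "FU H"] if_False simp_thms)
qed

lemma FU_boxplus:
  assumes "x \<in> plain_thats H" "y \<in> plain_thats H"
  shows "FU H (x \<boxplus> y) = FU H x \<boxplus> FU H y"
  unfolding boxplus_def
proof (rule FU_boxsum)
  assume *: "\<And>b. b \<in> UNIV \<Longrightarrow> (if b then x else y) \<noteq> Omega"
  obtain c d where "x = Some c" "y = Some d"
    using *[of True] *[of False] by auto
  then show "(\<Union>b. flow_types (the (if b then FU H x else FU H y))) = (\<Union>b. flow_types (the (if b then x else y)))"
    and "(\<Sum>b\<in>UNIV. the (if b then FU H x else FU H y)) = FU_talg H (\<Sum>b\<in>UNIV. the (if b then x else y))"
    using assms flow_types_FU_talg by (simp_all add: UNIV_bool FU_talg_add flow_types_def)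
qed (auto simp: UNIV_bool)

lemma FU_boxtimes:
  assumes "x \<in> plain_thats H" "y \<in> plain_thats H"
  shows "FU H (boxtimes H x y) = boxtimes H (FU H x) (FU H y)"
proof (cases x; cases y)
  fix a b assume xy: "x = Some a" "y = Some b"
  then have a: "a \<in> plain_talgs H" and b: "b \<in> plain_talgs H"
    using assms by auto
  have letters: "\<And>u A. u \<in> Poly_Mapping.keys a \<Longrightarrow> A \<in> set (letters u) \<Longrightarrow> plain_letter H A"
      "\<And>u A. u \<in> Poly_Mapping.keys b \<Longrightarrow> A \<in> set (letters u) \<Longrightarrow> plain_letter H A"
    using a b by (auto simp: plain_talgs_def)
  let ?ka = "Poly_Mapping.keys a" and ?kb = "Poly_Mapping.keys b"
  let ?c = "\<lambda>u v. Poly_Mapping.lookup a u * Poly_Mapping.lookup b v"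
  let ?B = "boxtimes_words H"
  let ?x = "\<lambda>(u, v). coef_scale (?c u v) (?B u v)"
  let ?y = "\<lambda>(u, v). coef_scale (Poly_Mapping.lookup (FU_talg H a) u * Poly_Mapping.lookup (FU_talg H b) v) (?B u v)"
  let ?t = "\<lambda>u v Bs Cs. scal (FU_coef H (?c u v) * (U_coef ^ total_weight Bs * U_coef ^ total_weight Cs)) *
      the (?B (FWord Bs) (FWord Cs))"
  have plain_c: "?c u v \<in> plain_coefs H" if "u \<in> ?ka" "v \<in> ?kb" for u v
    using a b that by (auto simp: plain_talgs_def intro: plain_coefs_mult)
  have lookups: "Poly_Mapping.lookup (FU_talg H a) (FWord Bs) * Poly_Mapping.lookup (FU_talg H b) (FWord Cs) =
      FU_coef H (?c u v) * (U_coef ^ total_weight Bs * U_coef ^ total_weight Cs)"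
    if "u \<in> ?ka" "v \<in> ?kb" "Bs \<in> lifts H (letters u)" "Cs \<in> lifts H (letters v)" for u v Bs Cs
    using that by (simp add: lookup_FU_talg[OF a] lookup_FU_talg[OF b] FU_coef_mult mult_ac)
  have "FU H (boxsum ?x (?ka \<times> ?kb)) =
      boxsum ?y (Poly_Mapping.keys (FU_talg H a) \<times> Poly_Mapping.keys (FU_talg H b))"
  proof (rule FU_boxsum)
    have "(\<exists>w\<in>Poly_Mapping.keys (FU_talg H a). \<exists>z\<in>Poly_Mapping.keys (FU_talg H b). ?B w z = Omega) \<longleftrightarrow>
        (\<exists>u\<in>?ka. \<exists>v\<in>?kb. ?B u v = Omega)"
    proof
      assume "\<exists>u\<in>?ka. \<exists>v\<in>?kb. ?B u v = Omega"
      then obtain u v where uv: "u \<in> ?ka" "v \<in> ?kb" "?B u v = Omega" by blast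
      moreover obtain Bs Cs where "Bs \<in> lifts H (letters u)" "Cs \<in> lifts H (letters v)"
        using lifts_nonempty letters uv(1,2) by blast
      ultimately show "\<exists>w\<in>Poly_Mapping.keys (FU_talg H a). \<exists>z\<in>Poly_Mapping.keys (FU_talg H b). ?B w z = Omega"
        unfolding keys_FU_talg[OF a] keys_FU_talg[OF b] using boxtimes_words_lifts_Omega_iff by blast
    qed (auto simp: keys_FU_talg[OF a] keys_FU_talg[OF b] boxtimes_words_lifts_Omega_iff)
    then show "(\<exists>j\<in>Poly_Mapping.keys (FU_talg H a) \<times> Poly_Mapping.keys (FU_talg H b). ?y j = Omega) \<longleftrightarrow>
        (\<exists>i\<in>?ka \<times> ?kb. ?x i = Omega)"
      by auto
  next
    assume "\<And>i. i \<in> ?ka \<times> ?kb \<Longrightarrow> ?x i \<noteq> Omega"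
    then have def: "?B u v \<noteq> Omega" if "u \<in> ?ka" "v \<in> ?kb" for u v
      using \<open>\<And>i. i \<in> ?ka \<times> ?kb \<Longrightarrow> ?x i \<noteq> Omega\<close>[of "(u, v)"] that by simp
    have the_x: "the (?x (u, v)) = scal (?c u v) * the (?B u v)" if "u \<in> ?ka" "v \<in> ?kb" for u v
      using def[OF that] by auto
    have the_y: "the (?y (FWord Bs, FWord Cs)) = ?t u v Bs Cs"
      if "u \<in> ?ka" "v \<in> ?kb" "Bs \<in> lifts H (letters u)" "Cs \<in> lifts H (letters v)" for u v Bs Cs
      using def[OF that(1,2)] boxtimes_words_lifts_Omega_iff[OF that(3,4)] lookups[OF that] by auto
    have flow: "(\<Union>Bs\<in>lifts H (letters u). \<Union>Cs\<in>lifts H (letters v). flow_types (the (?y (FWord Bs, FWord Cs))))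
        = flow_types (the (?x (u, v)))" if "u \<in> ?ka" "v \<in> ?kb" for u v
    proof -
      have "(\<Union>Bs\<in>lifts H (letters u). \<Union>Cs\<in>lifts H (letters v). flow_types (?t u v Bs Cs)) =
          flow_types (scal (?c u v) * the (?B u v))"
        by (rule flow_types_lifts) (use letters that def plain_c in auto)
      then show ?thesis
        using the_x[OF that] the_y[OF that] by simp
    qed
    have "(\<Union>j\<in>Poly_Mapping.keys (FU_talg H a) \<times> Poly_Mapping.keys (FU_talg H b). flow_types (the (?y j))) =
        (\<Union>u\<in>?ka. \<Union>v\<in>?kb. \<Union>Bs\<in>lifts H (letters u). \<Union>Cs\<in>lifts H (letters v).
          flow_types (the (?y (FWord Bs, FWord Cs))))"
      unfolding keys_FU_talg[OF a] keys_FU_talg[OF b] by blast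
    also have "\<dots> = (\<Union>u\<in>?ka. \<Union>v\<in>?kb. flow_types (the (?x (u, v))))"
      using flow by (intro SUP_cong HOL.refl) 
    also have "\<dots> = (\<Union>i\<in>?ka \<times> ?kb. flow_types (the (?x i)))"
      by blast
    finally show "(\<Union>j\<in>Poly_Mapping.keys (FU_talg H a) \<times> Poly_Mapping.keys (FU_talg H b). flow_types (the (?y j))) =
        (\<Union>i\<in>?ka \<times> ?kb. flow_types (the (?x i)))" .
    have "(\<Sum>j\<in>Poly_Mapping.keys (FU_talg H a) \<times> Poly_Mapping.keys (FU_talg H b). the (?y j)) =
        (\<Sum>w\<in>Poly_Mapping.keys (FU_talg H a). \<Sum>z\<in>Poly_Mapping.keys (FU_talg H b). the (?y (w, z)))"
      unfolding sum.cartesian_product by (simp add: case_prod_beta)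
    also have "\<dots> = (\<Sum>u\<in>?ka. \<Sum>Bs\<in>lifts H (letters u). \<Sum>v\<in>?kb. \<Sum>Cs\<in>lifts H (letters v).
        the (?y (FWord Bs, FWord Cs)))"
      by (simp only: sum_keys_FU_talg[OF a] sum_keys_FU_talg[OF b])
    also have "\<dots> = (\<Sum>u\<in>?ka. \<Sum>Bs\<in>lifts H (letters u). \<Sum>v\<in>?kb. \<Sum>Cs\<in>lifts H (letters v). ?t u v Bs Cs)"
      using the_y by (intro sum.cong HOL.refl) 
    \<comment> \<open>The order of summation is changed so that all lifts of one pair
      \<open>(u, v)\<close> stand together and the result for single words applies.\<close>
    also have "\<dots> = (\<Sum>u\<in>?ka. \<Sum>v\<in>?kb. \<Sum>Bs\<in>lifts H (letters u). \<Sum>Cs\<in>lifts H (letters v). ?t u v Bs Cs)"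
      by (intro sum.cong HOL.refl sum.swap)
    also have "\<dots> = (\<Sum>u\<in>?ka. \<Sum>v\<in>?kb. FU_talg H (scal (?c u v) * the (?B u v)))"
    proof (intro sum.cong HOL.refl)
      fix u v assume uv: "u \<in> ?ka" "v \<in> ?kb"
      show "(\<Sum>Bs\<in>lifts H (letters u). \<Sum>Cs\<in>lifts H (letters v). ?t u v Bs Cs) =
          FU_talg H (scal (?c u v) * the (?B u v))"
      proof -
        have FU_B: "FU_talg H (the (?B u v)) = (\<Sum>Bs\<in>lifts H (letters u). \<Sum>Cs\<in>lifts H (letters v).
            scal (U_coef ^ total_weight Bs * U_coef ^ total_weight Cs) * the (?B (FWord Bs) (FWord Cs)))"
          using FU_boxtimes_words[of u v] letters uv def[OF uv] by metis
        show ?thesis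
          unfolding FU_talg_mult FU_talg_scal FU_B by (simp only: sum_distrib_left scal_mult mult.assoc)
      qed
    qed
    also have "\<dots> = FU_talg H (\<Sum>u\<in>?ka. \<Sum>v\<in>?kb. the (?x (u, v)))"
      unfolding FU_talg_sum using the_x by (intro sum.cong HOL.refl) simp
    also have "\<dots> = FU_talg H (\<Sum>i\<in>?ka \<times> ?kb. the (?x i))"
      unfolding sum.cartesian_product by (simp add: case_prod_beta)
    finally show "(\<Sum>j\<in>Poly_Mapping.keys (FU_talg H a) \<times> Poly_Mapping.keys (FU_talg H b). the (?y j)) =
        FU_talg H (\<Sum>i\<in>?ka \<times> ?kb. the (?x i))" .
  qed
  then show ?thesis
    by (simp add: xy boxtimes_def)
qed simp_all

end

section \<open>Cutting a polygon\<close>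

text \<open>With distinct entries the head of a rotation reveals the amount of rotation modulo the
  length.\<close>

lemma rot_class_hd_unique:
  assumes "distinct (a # xs)" "a # ys \<in> rot_class (a # xs)" shows "ys = xs"
proof -
  obtain k where k: "a # ys = rotate k (a # xs)"
    using assms(2) by (auto simp: rot_class_def)
  let ?n = "length (a # xs)"
  have "(a # xs) ! (k mod ?n) = (a # xs) ! 0"
    using arg_cong[OF k, of hd] by (simp add: hd_rotate_conv_nth)
  then have "k mod ?n = 0"
    using nth_eq_iff_index_eq[OF assms(1), of "k mod ?n" 0] by simp
  then show ?thesis
    using k rotate_conv_mod[of k "a # xs"] by simp
qed

lemma rot_class_swap: "us @ vs \<in> B' \<Longrightarrow> B' = rot_class as \<Longrightarrow> vs @ us \<in> B'"
  using rot_class_rotate[of "us @ vs" as] unfolding rot_class_def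
  by (metis (mono_tags, lifting) CollectI rotate_append)

text \<open>The description by \<open>THE\<close> is unique: only one rotation starts with
  \<open>a\<close>, and \<open>b\<close> occurs only once in it.\<close>

lemma edge_arc_eq:
  assumes "boundary_condition H (bdry A)" "a # us @ b # vs \<in> bdry A"
  shows "edge_arc A a b = a # us @ [b]"
proof -
  have B': "bdry A = rot_class (a # us @ b # vs)" "distinct (a # us @ b # vs)"
    using boundary_conditionD[OF assms] by auto
  show ?thesis
    unfolding edge_arc_def
  proof (rule the_equality)
    show "\<exists>us' vs'. a # us @ [b] = a # us' @ [b] \<and> a # us' @ b # vs' \<in> bdry A"
      using assms(2) by blast
    fix es assume "\<exists>us' vs'. es = a # us' @ [b] \<and> a # us' @ b # vs' \<in> bdry A"
    then obtain us' vs' where es: "es = a # us' @ [b]" "a # us' @ b # vs' \<in> bdry A"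
      by blast
    then have eq: "us' @ b # vs' = us @ b # vs"
      using rot_class_hd_unique B' by metis
    then have "us' = us"
      using append_Cons_eq_iff[of b us vs us' vs'] B'(2) by auto
    then show "es = a # us @ [b]"
      using es by simp
  qed
qed

lemma linear_pairs_simps [simp]:
  "linear_pairs (a # b # cs) = insert (a, b) (linear_pairs (b # cs))" "linear_pairs [a] = {}"
  by (auto simp: linear_pairs_def)

lemma linear_pairs_append: "linear_pairs (us @ b # vs) = linear_pairs (us @ [b]) \<union> linear_pairs (b # vs)"
proof (induction us)
  case (Cons a us)
  then show ?case by (cases us) auto
qed simp

lemma fst_linear_pairs: "fst ` linear_pairs (us @ [b]) = set us"
proof (induction us)
  case (Cons a us)
  then show ?case by (cases us) auto
qed simp

lemma cyclic_pairs_eq_linear_pairs: "cyclic_pairs (a # as) = linear_pairs (a # as @ [a])"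
proof -
  have "zip (a # as) (as @ [a]) = zip (a # as @ [a]) (as @ [a])"
    using zip_append1[of "a # as" "[a]" "as @ [a]"] by simp
  then show ?thesis
    by (simp add: cyclic_pairs_def linear_pairs_def)
qed

lemma cyclic_pairs_cut:
  "cyclic_pairs (a # us @ b # vs) = linear_pairs (a # us @ [b]) \<union> linear_pairs (b # vs @ [a])"
  using linear_pairs_append[of "a # us" b "vs @ [a]"] by (simp add: cyclic_pairs_eq_linear_pairs)

lemma base_vertex_set_weight [simp]: "base_vertex (set_weight i A) = base_vertex A"
  and edge_arc_set_weight [simp]: "edge_arc (set_weight i A) a b = edge_arc A a b"
  by (simp_all add: base_vertex_def edge_arc_def)

lemma cuts_set_weight [simp]: "cuts (set_weight i A) = cuts A"
  by (simp add: cuts_def)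

lemma nice_set_weight [simp]: "nice (set_weight i A) a b = nice A a b"
  by (simp add: nice_def)

lemma piece_set_weight [simp]:
  "piece1 (set_weight i A) a b q j = piece1 A a b q j" "piece2 (set_weight i A) a b q j = piece2 A a b q j"
  by (simp_all add: piece1_def piece2_def)

lemma piece_Some:
  "piece1 A a b q (Some j) = set_weight j (piece1 A a b q None)"
  "piece2 A a b q (Some j) = set_weight j (piece2 A a b q None)"
  by (simp_all add: piece1_def piece2_def set_weight_def Let_def)

text \<open>The two factors of a piece of the boundary, after imposing the slot point at the new vertices.\<close>

definition factor1 :: "'a symb \<Rightarrow> 'a circles \<Rightarrow> 'a circles \<Rightarrow> 'a multiset \<Rightarrow> nat option \<Rightarrow> 'a symb" where
  "factor1 A a b q j = (if nice A a b then Kup (piece1 A a b q j) else piece1 A a b q j)"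

definition factor2 :: "'a symb \<Rightarrow> 'a circles \<Rightarrow> 'a circles \<Rightarrow> 'a multiset \<Rightarrow> nat option \<Rightarrow> 'a symb" where
  "factor2 A a b q k = (if nice A a b then Kdown {((b, a), q)} (piece2 A a b q k) else piece2 A a b q k)"

lemma factor_set_weight [simp]:
  "factor1 (set_weight i A) a b q j = factor1 A a b q j" "factor2 (set_weight i A) a b q j = factor2 A a b q j"
  by (simp_all add: factor1_def factor2_def)

lemma factor_Some:
  "factor1 A a b q (Some j) = set_weight j (factor1 A a b q None)"
  "factor2 A a b q (Some j) = set_weight j (factor2 A a b q None)"
  by (simp_all add: factor1_def factor2_def piece_Some)

lemma slot_moduli_factor1: "slot_moduli H (factor1 A a b q j) = slot_moduli H (piece1 A a b q j)"
  by (simp add: factor1_def)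

text \<open>For a cut that is not nice, the slot point is already among the pointings of the second
  piece, so \<open>Kdown\<close> imposes nothing new. Both cases thus have the form used by the
  gluing assumption.\<close>

lemma slot_moduli_factor2:
  "slot_moduli H (factor2 A a b q k) = slot_moduli H (Kdown {((b, a), q)} (piece2 A a b q k))"
  by (auto simp: factor2_def slot_moduli_def piece2_def Let_def)

text \<open>Choosing the rotation that starts with \<open>a\<close> makes both arcs explicit lists:
  \<open>a # us @ [b]\<close>, which carries the base vertex, and
  \<open>b # vs @ [a]\<close>.\<close>

locale cut =
  fixes H :: "'a heegaard" and A :: "'a symb" and a b us vs
  assumes boundary: "boundary_condition H (bdry A)" and edges: "a # us @ b # vs \<in> bdry A"
    and base: "base_vertex A \<in> linear_pairs (a # us @ [b])"
begin

lemma edges': "bdry A = rot_class (a # us @ b # vs)" "distinct (a # us @ b # vs)"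
    "set (a # us @ b # vs) \<subseteq> circle_sets H" "length (a # us @ b # vs) \<le> card (circle_sets H)"
  using boundary_conditionD[OF boundary edges] by auto

lemma arcs: "edge_arc A a b = a # us @ [b]" "edge_arc A b a = b # vs @ [a]"
  using edge_arc_eq[OF boundary edges] edge_arc_eq[OF boundary, of b vs a us]
    rot_class_swap[of "a # us" "b # vs" "bdry A", OF _ edges'(1)] edges by simp_all

lemma vertices_cut: "vertices A = linear_pairs (a # us @ [b]) \<union> linear_pairs (b # vs @ [a])"
  using vertices_rot_class[OF edges'(1)] by (simp add: cyclic_pairs_cut)

lemma arcs_disjoint: "linear_pairs (a # us @ [b]) \<inter> linear_pairs (b # vs @ [a]) = {}"
proof -
  have "fst ` linear_pairs (a # us @ [b]) \<inter> fst ` linear_pairs (b # vs @ [a]) = {}"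
    using fst_linear_pairs[of "a # us" b] fst_linear_pairs[of "b # vs" a] edges'(2) by auto
  then show ?thesis by blast
qed

text \<open>Ensures that removing the new flow-in vertex by \<open>Kdown\<close> does not delete an
  old one. Here \<open>b\<close> is the last edge of the arc and hence not a first
  component.\<close>

lemma new_vertex_notin: "(b, a) \<notin> linear_pairs (a # us @ [b])"
proof
  assume "(b, a) \<in> linear_pairs (a # us @ [b])"
  then have "fst (b, a) \<in> fst ` linear_pairs ((a # us) @ [b])"
    by (intro imageI) simp
  then show False
    unfolding fst_linear_pairs using edges'(2) by simp
qed

lemma boundary_condition_arc:
  "boundary_condition H (rot_class (a # us @ [b]))" "boundary_condition H (rot_class (b # vs @ [a]))"
  unfolding boundary_condition_def using edges'
  by (intro exI[of _ "a # us @ [b]"] exI[of _ "b # vs @ [a]"]; auto)+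

lemma plain_symb_pieces: "plain_symb H (piece1 A a b q None)" "plain_symb H (piece2 A a b q None)"
  using boundary_condition_arc by (simp_all add: plain_symb_def piece1_def piece2_def Let_def arcs)

lemma plain_symb_factors: "plain_symb H (factor1 A a b q None)" "plain_symb H (factor2 A a b q None)"
  using plain_symb_pieces by (simp_all add: factor1_def factor2_def)

text \<open>Once the slot point is imposed, the new vertices are pointed in both factors, so the old
  flow vertices are merely distributed over the two arcs.\<close>

lemma flow_factors:
  "flow_in (factor1 A a b q j) = flow_in A \<inter> linear_pairs (b # vs @ [a])"
  "flow_in (factor2 A a b q j) = flow_in A \<inter> linear_pairs (a # us @ [b])"
  "flow_out (factor1 A a b q j) = {}"
  "flow_out (factor2 A a b q j) = {(v, p) \<in> flow_out A. v \<in> linear_pairs (a # us @ [b])}"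
  using new_vertex_notin
  by (auto simp: factor1_def factor2_def piece1_def piece2_def Let_def arcs Kup_def Kdown_def nice_def)

lemma not_nice: "\<not> nice A a b \<Longrightarrow> fully_pointed (piece1 A a b q j)"
  by (simp add: fully_pointed_def piece1_def Let_def arcs nice_def)

end

lemma cut_of_cuts:
  assumes "boundary_condition H (bdry A)" "(a, b, q) \<in> cuts A"
  shows "\<exists>us vs. cut H A a b us vs"
proof -
  obtain us vs where "a # us @ b # vs \<in> bdry A" "base_vertex A \<in> linear_pairs (edge_arc A a b)"
    using assms(2) by (auto simp: cuts_def)
  then have "cut H A a b us vs"
    using edge_arc_eq[OF assms(1)] assms(1) by unfold_locales auto
  then show ?thesis by blast
qed

text \<open>With exactly one flow-out vertex the choice in \<open>base_vertex\<close> is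
  forced.\<close>

lemma generator_flow_out:
  assumes "generator H ver A" obtains r where "flow_out A = {(base_vertex A, r)}"
proof -
  obtain v r where "flow_out A = {(v, r)}"
    using assms by (metis card_1_singletonE generator_def surj_pair)
  moreover from this have "base_vertex A = v"
    by (simp add: base_vertex_def)
  ultimately show ?thesis using that by blast
qed

text \<open>The arcs partition the vertices, so each flow-in vertex is counted once, and the
  flow-out vertex lies on the second arc. Thus all boundary pieces have the type of
  \<open>A\<close>, and their sum is defined.\<close>

lemma (in cut) flow_type_factors:
  assumes "generator H ver A"
  shows "flow_type (FWord [factor1 A a b q j, factor2 A a b q k]) = flow_type (FWord [A])"
proof -
  obtain r where r: "flow_out A = {(base_vertex A, r)}"
    using assms by (rule generator_flow_out)
  have "flow_out (factor2 A a b q k) = flow_out A"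
    using base by (auto simp: flow_factors r)
  moreover have "length (filter (\<lambda>B. s \<in> flow_in B) [factor1 A a b q j, factor2 A a b q k]) =
      length (filter (\<lambda>B. s \<in> flow_in B) [A])" for s
  proof -
    have "s \<in> flow_in A \<Longrightarrow> s \<in> linear_pairs (b # vs @ [a]) \<longleftrightarrow> s \<notin> linear_pairs (a # us @ [b])"
      using assms arcs_disjoint vertices_cut by (auto simp: generator_def pre_generator_def)
    then show ?thesis
      by (cases "s \<in> flow_in A"; cases "s \<in> linear_pairs (a # us @ [b])") (simp_all add: flow_factors)
  qed
  ultimately show ?thesis
    by (simp add: flow_type_def fun_eq_iff flow_factors(3) del: split_paired_All filter.simps)
      (simp add: flow_factors(3))
qed

text \<open>Nice and other cuts are treated alike from here on: if the first piece is fully pointed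
  it is a scalar in normal form, and multiplication in the tensor algebra covers this case as
  well.\<close>

lemma (in cut) boundary_term:
  assumes "generator H ver A"
  shows "(if nice A a b
      then boxtimes H (Some (talg_of H (piece1 A a b q j))) (Some (talg_of H (piece2 A a b q k)))
      else coef_scale (coef_of H (piece1 A a b q j)) (Some (talg_of H (piece2 A a b q k))))
    = Some (talg_of H (factor1 A a b q j) * talg_of H (factor2 A a b q k))" (is ?eq)
    and "flow_types (talg_of H (factor1 A a b q j) * talg_of H (factor2 A a b q k)) \<subseteq> {flow_type (FWord [A])}"
      (is ?flow)
proof -
  let ?p1 = "piece1 A a b q j" and ?p2 = "piece2 A a b q k"
  let ?S = "talg_of H (factor1 A a b q j) * talg_of H (factor2 A a b q k)"
  show flow: ?flow
  proof (cases "slot_moduli H (factor1 A a b q j) = {} \<or> slot_moduli H (factor2 A a b q k) = {}")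
    case True
    then show ?thesis by (auto simp: talg_of_empty)
  next
    case False
    then have "unit_monomial ?S ([factor1 A a b q j] @ [factor2 A a b q k])"
      by (intro unit_monomial_mult unit_monomial_talg_of) auto
    then show ?thesis
      using flow_types_scal_unit_monomial[of _ _ 1] flow_type_factors[OF assms] by fastforce
  qed
  show ?eq
  proof (cases "nice A a b")
    case False
    then show ?thesis
      using not_nice by (simp add: factor1_def factor2_def talg_of_def[of H ?p1])
  next
    case True
    then have flows: "flow_out ?p1 = {((a, b), q)}" "(b, a) \<in> flow_in ?p2"
      by (simp_all add: piece1_def piece2_def Let_def)
    then have nfp: "\<not> fully_pointed ?p1" "\<not> fully_pointed ?p2"
      by (auto simp: fully_pointed_def)
    show ?thesis
    proof (cases "slot_moduli H ?p1 = {} \<or> slot_moduli H ?p2 = {}")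
      case empty: True
      then have "talg_of H ?p1 = 0 \<or> talg_of H ?p2 = 0"
        by (auto simp: talg_of_empty)
      \<comment> \<open>An operand 0 gives the product 0, and the right side agrees: imposing
        further slot points on an empty piece leaves it empty.\<close>
      moreover have "?S = 0"
        using empty True slot_moduli_Kdown_subset[of H "{((b, a), q)}" ?p2]
        by (auto simp: factor1_def factor2_def talg_of_empty)
      ultimately show ?thesis
        using True by auto
    next
      case nonempty: False
      have Q: "swap_pointings {((a, b), q)} = {((b, a), q)}"
        by (simp add: swap_pointings_def)
      have I: "Poly_Mapping.keys (word [?p1]) \<times> Poly_Mapping.keys (word [?p2]) = {(FWord [?p1], FWord [?p2])}"
        by (simp add: word_def)
      have "boxtimes_words H (FWord [?p1]) (FWord [?p2]) = Some ?S"
        using boxtimes_words_snoc_Cons[of H "[]" ?p1 ?p2 "[]"] flows True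
        by (simp add: Q factor1_def factor2_def)
      then have "boxtimes H (Some (word [?p1])) (Some (word [?p2])) = Some (\<Sum>i\<in>{(FWord [?p1], FWord [?p2])}. ?S)"
        unfolding boxtimes_def prod.case option.case I using flow
        by (intro boxsum_homogeneous) (auto simp: word_def)
      then have "boxtimes H (Some (word [?p1])) (Some (word [?p2])) = Some ?S"
        by simp
      then show ?thesis
        using True nonempty nfp by (simp add: talg_of_def[of H ?p1] talg_of_def[of H ?p2])
    qed
  qed
qed

text \<open>The differential of a generator as a total sum in the tensor algebra, which allows
  ordinary manipulation of sums; homogeneity shows below that it agrees with the partial
  sum.\<close>

definition boundary_talg :: "'a heegaard \<Rightarrow> 'a symb \<Rightarrow> 'a talg" where
  "boundary_talg H A = (if expected_dim A = 1 then
     \<Sum>((a, b, q), (j, k))\<in>cuts A \<times> weight_splits (weight A).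
       talg_of H (factor1 A a b q j) * talg_of H (factor2 A a b q k) else 0)"

lemma
  assumes "generator H ver A"
  shows boundary_gen_eq: "boundary_gen H A = Some (boundary_talg H A)"
    and flow_types_boundary_talg: "flow_types (boundary_talg H A) \<subseteq> {flow_type (FWord [A])}"
proof -
  have bc: "boundary_condition H (bdry A)"
    using assms by (simp add: generator_def pre_generator_def)
  let ?I = "cuts A \<times> weight_splits (weight A)"
  let ?S = "\<lambda>((a, b, q), (j, k)). talg_of H (factor1 A a b q j) * talg_of H (factor2 A a b q k)"
  let ?T = "\<lambda>((a, b, q), (j, k)). if nice A a b
    then boxtimes H (Some (talg_of H (piece1 A a b q j))) (Some (talg_of H (piece2 A a b q k)))
    else coef_scale (coef_of H (piece1 A a b q j)) (Some (talg_of H (piece2 A a b q k)))"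
  have flow: "flow_types (?S i) \<subseteq> {flow_type (FWord [A])}" if i_in: "i \<in> ?I" for i
  proof -
    obtain a b q j k where i: "i = ((a, b, q), (j, k))"
      by (metis surj_pair)
    then obtain us vs where "cut H A a b us vs"
      using i_in cut_of_cuts[OF bc, of a b q] by auto
    then show ?thesis
      using cut.boundary_term(2)[OF _ assms] unfolding i prod.case by blast
  qed
  have "boundary_gen H A = Some (\<Sum>i\<in>?I. ?S i)" if "expected_dim A = 1"
    unfolding boundary_gen_def if_P[OF that]
  proof (rule boxsum_homogeneous)
    fix i assume "i \<in> ?I"
    obtain a b q j k where i: "i = ((a, b, q), (j, k))"
      by (metis surj_pair)
    then obtain us vs where "cut H A a b us vs"
      using \<open>i \<in> ?I\<close> cut_of_cuts[OF bc, of a b q] by auto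
    then show "?T i = Some (?S i)"
      using cut.boundary_term(1)[OF _ assms] unfolding i prod.case by blast
    show "flow_types (?S i) \<subseteq> {flow_type (FWord [A])}"
      using flow[OF \<open>i \<in> ?I\<close>] .
  qed
  then show "boundary_gen H A = Some (boundary_talg H A)"
    by (simp add: boundary_talg_def boundary_gen_def)
  show "flow_types (boundary_talg H A) \<subseteq> {flow_type (FWord [A])}"
  proof (cases "expected_dim A = 1")
    case True
    have "flow_types (\<Sum>i\<in>?I. ?S i) \<subseteq> (\<Union>i\<in>?I. flow_types (?S i))"
      by (rule flow_types_sum_subset)
    also have "\<dots> \<subseteq> {flow_type (FWord [A])}"
      by (rule UN_least) (rule flow)
    finally show ?thesis
      unfolding boundary_talg_def if_P[OF True] .
  qed (simp add: boundary_talg_def)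
qed

section \<open>Distribution of the weight over the factors of a boundary piece\<close>

lemma sum_Times_singleton: "(\<Sum>p\<in>A \<times> {x}. f p) = (\<Sum>a\<in>A. f (a, x))"
proof -
  have "A \<times> {x} = (\<lambda>a. (a, x)) ` A" by auto
  then show ?thesis
    by (simp add: sum.reindex inj_on_def)
qed

text \<open>A double sum regrouped by the value of \<open>j + k\<close>. Every such value lies in
  \<open>N\<close>, so nothing is omitted; splits outside \<open>J \<times> K\<close> contribute
  0.\<close>

lemma sum_weight_splits:
  fixes G :: "nat \<Rightarrow> nat \<Rightarrow> 'r::comm_monoid_add"
  assumes "finite N" "finite J" "finite K" "\<And>j k. j \<in> J \<Longrightarrow> k \<in> K \<Longrightarrow> j + k \<in> N"
    and "\<And>j k. j \<notin> J \<or> k \<notin> K \<Longrightarrow> G j k = 0"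
  shows "(\<Sum>i\<in>N. \<Sum>(j, k)\<in>weight_splits (Some i). G (the j) (the k)) = (\<Sum>j\<in>J. \<Sum>k\<in>K. G j k)"
proof -
  have "(\<Sum>(j, k)\<in>weight_splits (Some i). G (the j) (the k)) =
      (\<Sum>(j, k)\<in>{p. p \<in> J \<times> K \<and> fst p + snd p = i}. G j k)" for i
  proof -
    let ?W = "{(j, k) | j k. j + k = i}"
    have "weight_splits (Some i) = map_prod Some Some ` ?W"
      by (auto simp: image_iff)
    then have "(\<Sum>(j, k)\<in>weight_splits (Some i). G (the j) (the k)) = (\<Sum>(j, k)\<in>?W. G j k)"
      by (simp only:) (subst sum.reindex, auto simp: inj_on_def intro!: sum.cong)
    also have "\<dots> = (\<Sum>(j, k)\<in>{p. p \<in> J \<times> K \<and> fst p + snd p = i}. G j k)"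
    proof (rule sum.mono_neutral_right)
      have "?W \<subseteq> {..i} \<times> {..i}" by auto
      then show "finite ?W" by (rule finite_subset) simp
    qed (use assms(5) in auto)
    finally show ?thesis .
  qed
  then have "(\<Sum>i\<in>N. \<Sum>(j, k)\<in>weight_splits (Some i). G (the j) (the k)) =
      (\<Sum>i\<in>N. \<Sum>(j, k)\<in>{p. p \<in> J \<times> K \<and> fst p + snd p = i}. G j k)"
    by simp
  also have "\<dots> = (\<Sum>(j, k)\<in>J \<times> K. G j k)"
    using assms by (intro sum.group) auto
  finally show ?thesis
    by (simp add: sum.cartesian_product)
qed

lemma pointings_set_weight [simp]: "pointings (set_weight i A) Q = pointings A Q"
  by (simp add: pointings_def)

lemma pre_generator_set_weight: "pre_generator H Plain A \<Longrightarrow> pre_generator H Equivariant (set_weight i A)"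
  by (simp add: pre_generator_def)

lemma generator_set_weight: "generator H Plain A \<Longrightarrow> generator H Equivariant (set_weight i A)"
  by (simp add: generator_def pre_generator_set_weight)

lemma plain_symb_pre_generator: "pre_generator H Plain A \<Longrightarrow> plain_symb H A"
  by (simp add: pre_generator_def plain_symb_def)

lemma diff_coef_U_power: "diff_coef H Equivariant (U_coef ^ i) 0"
proof (induction i)
  case (Suc i)
  have "diff_coef H Equivariant (U_coef * U_coef ^ i) (0 * U_coef ^ i + U_coef * 0)"
    by (intro diff_coef.intros(4,6) Suc HOL.refl)
  then show ?case by simp
qed (simp add: diff_coef.intros)

lemma diff_coef_sum:
  assumes "\<And>i. i \<in> I \<Longrightarrow> diff_coef H ver (f i) (f' i)"
  shows "diff_coef H ver (sum f I) (sum f' I)"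
  using assms by (induction I rule: infinite_finite_induct) (auto intro: diff_coef.intros)

context heegaard_theory
begin

text \<open>By gluing, the weights of the two factors of a boundary piece add up to a weight of \<open>A\<close>.\<close>

lemma sum_weights_cut:
  fixes G :: "nat \<Rightarrow> nat \<Rightarrow> 'r::comm_monoid_add"
  assumes A: "generator H Plain A \<or> pre_generator H Plain A \<and> fully_pointed A"
    and dim: "expected_dim A = 1" and cut: "(a, b, q) \<in> cuts A"
    and zero: "\<And>j k. slot_moduli H (factor1 A a b q (Some j)) = {} \<or> slot_moduli H (factor2 A a b q (Some k)) = {}
      \<Longrightarrow> G j k = 0"
  shows "(\<Sum>i\<in>nonempty_weights H A. \<Sum>(j, k)\<in>weight_splits (Some i). G (the j) (the k)) =
    (\<Sum>j\<in>nonempty_weights H (factor1 A a b q None). \<Sum>k\<in>nonempty_weights H (factor2 A a b q None). G j k)"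
proof (rule sum_weight_splits)
  have pre: "pre_generator H Plain A"
    using A by (auto simp: generator_def)
  then have bc: "boundary_condition H (bdry A)"
    by (simp add: pre_generator_def)
  obtain us vs where "cut H A a b us vs"
    using cut_of_cuts[OF bc cut] by blast
  then interpret cut H A a b us vs .
  show "finite (nonempty_weights H A)"
    using pre by (intro finite_nonempty_weights plain_symb_pre_generator)
  show "finite (nonempty_weights H (factor1 A a b q None))" "finite (nonempty_weights H (factor2 A a b q None))"
    using plain_symb_factors by (simp_all add: finite_nonempty_weights)
  show "G j k = 0" if "j \<notin> nonempty_weights H (factor1 A a b q None) \<or> k \<notin> nonempty_weights H (factor2 A a b q None)" for j k
    using that by (intro zero) (simp add: nonempty_weights_def factor_Some)
  show "j + k \<in> nonempty_weights H A"
    if "j \<in> nonempty_weights H (factor1 A a b q None)" "k \<in> nonempty_weights H (factor2 A a b q None)" for j k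
  proof -
    have "slot_moduli H (factor1 A a b q (Some j)) \<noteq> {}" "slot_moduli H (factor2 A a b q (Some k)) \<noteq> {}"
      using that by (simp_all add: nonempty_weights_def factor_Some)
    \<comment> \<open>Gluing is applied in the equivariant theory, to the symbol of weight
      \<open>j + k\<close>, which has the same cuts and pieces as \<open>A\<close>.\<close>
    then have "slot_moduli H (set_weight (j + k) A) \<noteq> {}"
      using gluing[of Equivariant "set_weight (j + k) A" a b q "Some j" "Some k"] A dim cut
      by (auto simp: generator_set_weight pre_generator_set_weight slot_moduli_factor1 slot_moduli_factor2)
    then show ?thesis
      by (simp add: nonempty_weights_def)
  qed
qed

text \<open>For a fixed cut, the product of the images of the factors runs over pairs
  \<open>(j, k)\<close> of weights, which are regrouped by the total weight. As cuts do not depend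
  on weights, the sums over cuts and over weights may be exchanged.\<close>

lemma FU_talg_boundary_talg:
  assumes A: "generator H Plain A"
  shows "FU_talg H (boundary_talg H A) =
    (\<Sum>i\<in>nonempty_weights H A. scal (U_coef ^ i) * boundary_talg H (set_weight i A))"
proof (cases "expected_dim A = 1")
  case dim: True
  have w: "weight A = None" and bc: "boundary_condition H (bdry A)"
    using A by (auto simp: generator_def pre_generator_def)
  let ?f = "\<lambda>(a, b, q) j k. scal (U_coef ^ (j + k)) *
    (talg_of H (factor1 A a b q (Some j)) * talg_of H (factor2 A a b q (Some k)))"
  have "FU_talg H (boundary_talg H A) = (\<Sum>(a, b, q)\<in>cuts A.
      FU_talg H (talg_of H (factor1 A a b q None)) * FU_talg H (talg_of H (factor2 A a b q None)))"
    using dim by (simp add: boundary_talg_def w FU_talg_sum FU_talg_mult case_prod_beta sum_Times_singleton)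
  also have "\<dots> = (\<Sum>c\<in>cuts A. \<Sum>i\<in>nonempty_weights H A. \<Sum>(j, k)\<in>weight_splits (Some i). ?f c (the j) (the k))"
  proof (rule sum.cong[OF HOL.refl])
    fix c assume c: "c \<in> cuts A"
    obtain a b q where abq: "c = (a, b, q)" by (metis surj_pair)
    obtain us vs where "cut H A a b us vs"
      using cut_of_cuts[OF bc] c abq by blast
    then interpret cut H A a b us vs .
    have "(scal (U_coef ^ j) * x) * (scal (U_coef ^ k) * y) = scal (U_coef ^ (j + k)) * (x * y)" for j k and x y :: "'a talg"
      by (simp only: power_add scal_mult mult.assoc scal_left_commute[of x])
    then have "FU_talg H (talg_of H (factor1 A a b q None)) * FU_talg H (talg_of H (factor2 A a b q None)) =
        (\<Sum>j\<in>nonempty_weights H (factor1 A a b q None). \<Sum>k\<in>nonempty_weights H (factor2 A a b q None). ?f c j k)"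
      unfolding FU_talg_talg_of[OF plain_symb_factors(1)] FU_talg_talg_of[OF plain_symb_factors(2)] sum_product
      by (simp add: abq factor_Some)
    \<comment> \<open>Terms with an empty factor are 0, as the regrouping by total weight
      requires.\<close>
    also have "\<dots> = (\<Sum>i\<in>nonempty_weights H A. \<Sum>(j, k)\<in>weight_splits (Some i). ?f c (the j) (the k))"
      using A dim c abq by (intro sum_weights_cut[symmetric]) (auto simp: talg_of_empty)
    finally show "(case c of (a, b, q) \<Rightarrow>
        FU_talg H (talg_of H (factor1 A a b q None)) * FU_talg H (talg_of H (factor2 A a b q None))) =
        (\<Sum>i\<in>nonempty_weights H A. \<Sum>(j, k)\<in>weight_splits (Some i). ?f c (the j) (the k))"
      by (simp add: abq)
  qed
  also have "\<dots> = (\<Sum>i\<in>nonempty_weights H A. \<Sum>c\<in>cuts A. \<Sum>(j, k)\<in>weight_splits (Some i). ?f c (the j) (the k))"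
    by (rule sum.swap)
  also have "\<dots> = (\<Sum>i\<in>nonempty_weights H A. scal (U_coef ^ i) * boundary_talg H (set_weight i A))"
  proof (rule sum.cong[OF HOL.refl])
    fix i
    have "scal (U_coef ^ i) * boundary_talg H (set_weight i A) =
        (\<Sum>c\<in>cuts A. \<Sum>s\<in>weight_splits (Some i). scal (U_coef ^ i) * (case (c, s) of ((a, b, q), (j, k)) \<Rightarrow>
          talg_of H (factor1 A a b q j) * talg_of H (factor2 A a b q k)))"
      using dim by (simp add: boundary_talg_def sum.cartesian_product sum_distrib_left case_prod_beta del: weight_splits.simps)
    also have "\<dots> = (\<Sum>c\<in>cuts A. \<Sum>(j, k)\<in>weight_splits (Some i). ?f c (the j) (the k))"
      by (intro sum.cong HOL.refl) auto
    finally show "(\<Sum>c\<in>cuts A. \<Sum>(j, k)\<in>weight_splits (Some i). ?f c (the j) (the k)) =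
        scal (U_coef ^ i) * boundary_talg H (set_weight i A)" by simp
  qed
  finally show ?thesis .
qed (simp add: boundary_talg_def)

text \<open>The same regrouping in the commutative coefficient algebra. Without flow-in vertices no
  cut is nice, so the factors are the pieces themselves.\<close>

lemma FU_coef_boundary_pointed:
  assumes A: "pre_generator H Plain A" "fully_pointed A"
  shows "FU_coef H (boundary_pointed H A) =
    (\<Sum>i\<in>nonempty_weights H A. U_coef ^ i * boundary_pointed H (set_weight i A))"
proof (cases "expected_dim A = 1")
  case dim: True
  have w: "weight A = None" and bc: "boundary_condition H (bdry A)"
    using A by (auto simp: pre_generator_def)
  have "\<not> nice A a b" for a b
    using A(2) by (simp add: nice_def fully_pointed_def)
  then have factor: "factor1 A a b q j = piece1 A a b q j" "factor2 A a b q j = piece2 A a b q j" for a b q j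
    by (simp_all add: factor1_def factor2_def)
  let ?f = "\<lambda>(a, b, q) j k. U_coef ^ (j + k) *
    (coef_of H (piece1 A a b q (Some j)) * coef_of H (piece2 A a b q (Some k)))"
  have "FU_coef H (boundary_pointed H A) = (\<Sum>(a, b, q)\<in>cuts A.
      FU_coef H (coef_of H (piece1 A a b q None)) * FU_coef H (coef_of H (piece2 A a b q None)))"
    using dim by (simp add: boundary_pointed_def w FU_coef_sum FU_coef_mult case_prod_beta sum_Times_singleton)
  also have "\<dots> = (\<Sum>c\<in>cuts A. \<Sum>i\<in>nonempty_weights H A. \<Sum>(j, k)\<in>weight_splits (Some i). ?f c (the j) (the k))"
  proof (rule sum.cong[OF HOL.refl])
    fix c assume c: "c \<in> cuts A"
    obtain a b q where abq: "c = (a, b, q)" by (metis surj_pair)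
    obtain us vs where "cut H A a b us vs"
      using cut_of_cuts[OF bc] c abq by blast
    then interpret cut H A a b us vs .
    have "FU_coef H (coef_of H (piece1 A a b q None)) * FU_coef H (coef_of H (piece2 A a b q None)) =
        (\<Sum>j\<in>nonempty_weights H (piece1 A a b q None). \<Sum>k\<in>nonempty_weights H (piece2 A a b q None). ?f c j k)"
      unfolding FU_coef_coef_of[OF plain_symb_pieces(1)] FU_coef_coef_of[OF plain_symb_pieces(2)] sum_product
      by (simp add: abq piece_Some power_add mult_ac)
    also have "\<dots> = (\<Sum>i\<in>nonempty_weights H A. \<Sum>(j, k)\<in>weight_splits (Some i). ?f c (the j) (the k))"
      using A dim c abq
      by (subst sum_weights_cut[where a = a and b = b and q = q]) (auto simp: factor coef_of_def)
    finally show "(case c of (a, b, q) \<Rightarrow>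
        FU_coef H (coef_of H (piece1 A a b q None)) * FU_coef H (coef_of H (piece2 A a b q None))) =
        (\<Sum>i\<in>nonempty_weights H A. \<Sum>(j, k)\<in>weight_splits (Some i). ?f c (the j) (the k))"
      by (simp add: abq)
  qed
  also have "\<dots> = (\<Sum>i\<in>nonempty_weights H A. \<Sum>c\<in>cuts A. \<Sum>(j, k)\<in>weight_splits (Some i). ?f c (the j) (the k))"
    by (rule sum.swap)
  also have "\<dots> = (\<Sum>i\<in>nonempty_weights H A. U_coef ^ i * boundary_pointed H (set_weight i A))"
  proof (rule sum.cong[OF HOL.refl])
    fix i
    have "U_coef ^ i * boundary_pointed H (set_weight i A) =
        (\<Sum>c\<in>cuts A. \<Sum>s\<in>weight_splits (Some i). U_coef ^ i * (case (c, s) of ((a, b, q), (j, k)) \<Rightarrow>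
          coef_of H (piece1 A a b q j) * coef_of H (piece2 A a b q k)))"
      using dim by (simp add: boundary_pointed_def sum.cartesian_product sum_distrib_left case_prod_beta del: weight_splits.simps)
    also have "\<dots> = (\<Sum>c\<in>cuts A. \<Sum>(j, k)\<in>weight_splits (Some i). ?f c (the j) (the k))"
      by (intro sum.cong HOL.refl) auto
    finally show "(\<Sum>c\<in>cuts A. \<Sum>(j, k)\<in>weight_splits (Some i). ?f c (the j) (the k)) =
        U_coef ^ i * boundary_pointed H (set_weight i A)" by simp
  qed
  finally show ?thesis .
qed (simp add: boundary_pointed_def)

section \<open>The chain map property\<close>

lemma plain_boundary_talg:
  assumes "generator H Plain A" shows "boundary_talg H A \<in> plain_talgs H"
proof -
  have w: "weight A = None" and bc: "boundary_condition H (bdry A)"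
    using assms by (auto simp: generator_def pre_generator_def)
  have "talg_of H (factor1 A a b q None) * talg_of H (factor2 A a b q None) \<in> plain_talgs H"
    if abq: "(a, b, q) \<in> cuts A" for a b q
  proof -
    obtain us vs where "cut H A a b us vs"
      using cut_of_cuts[OF bc abq] by blast
    then interpret cut H A a b us vs .
    show ?thesis
      by (intro plain_talgs_mult plain_talgs_talg_of plain_symb_factors)
  qed
  then show ?thesis
    unfolding boundary_talg_def w by (auto intro!: plain_talgs_sum)
qed

lemma plain_boundary_pointed:
  assumes "pre_generator H Plain A" shows "boundary_pointed H A \<in> plain_coefs H"
proof -
  have w: "weight A = None" and bc: "boundary_condition H (bdry A)"
    using assms by (auto simp: pre_generator_def)
  have "coef_of H (piece1 A a b q None) * coef_of H (piece2 A a b q None) \<in> plain_coefs H"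
    if abq: "(a, b, q) \<in> cuts A" for a b q
  proof -
    obtain us vs where "cut H A a b us vs"
      using cut_of_cuts[OF bc abq] by blast
    then interpret cut H A a b us vs .
    show ?thesis
      by (intro plain_coefs_mult plain_coefs_coef_of plain_symb_pieces)
  qed
  then show ?thesis
    unfolding boundary_pointed_def w by (auto intro!: plain_coefs_sum)
qed

text \<open>The morphism respects sums and products, so the Leibniz rule passes through, and the
  work lies in a fully pointed symbol. Membership in the normal forms is part of the claim because
  the differential of a symbol uses it for the scaling rule.\<close>

lemma diff_coef_FU:
  assumes "diff_coef H Plain f f'"
  shows "f \<in> plain_coefs H \<and> f' \<in> plain_coefs H \<and> diff_coef H Equivariant (FU_coef H f) (FU_coef H f')"
  using assms
proof induction
  case (3 A)
  then have A: "plain_symb H A"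
    by (simp add: plain_symb_pre_generator)
  have "diff_coef H Equivariant (U_coef ^ i * coef_of H (set_weight i A)) (U_coef ^ i * boundary_pointed H (set_weight i A))" for i
  proof -
    \<comment> \<open>The summand with factor 0 is the Leibniz term of \<open>U ^ i\<close>, whose
      differential vanishes.\<close>
    have "diff_coef H Equivariant (U_coef ^ i * coef_of H (set_weight i A))
        (0 * coef_of H (set_weight i A) + U_coef ^ i * boundary_pointed H (set_weight i A))"
      using 3 by (intro diff_coef.intros(3,6) diff_coef_U_power pre_generator_set_weight) simp_all
    then show ?thesis by simp
  qed
  then have "diff_coef H Equivariant (FU_coef H (coef_of H A)) (FU_coef H (boundary_pointed H A))"
    unfolding FU_coef_coef_of[OF A] FU_coef_boundary_pointed[OF 3] by (rule diff_coef_sum)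
  then show ?case
    using 3 A by (simp add: plain_coefs_coef_of plain_boundary_pointed)
qed (auto simp: FU_coef_add FU_coef_mult intro!: diff_coef.intros plain_coefs_add plain_coefs_mult)

text \<open>The differential of the image is derived from the scaling rule for each weight, followed
  by the sum rule one weight at a time. All these sums are defined, because every weighted version
  and its boundary have the flow type of \<open>A\<close>.\<close>

lemma sh_diff_FU_generator:
  assumes A: "generator H Plain A"
  shows "sh_diff H Equivariant (FU H (Some (talg_of H A))) (FU H (boundary_gen H A))"
proof -
  let ?t = "flow_type (FWord [A])"
  let ?x = "\<lambda>i. scal (U_coef ^ i) * talg_of H (set_weight i A)"
  let ?y = "\<lambda>i. scal (U_coef ^ i) * boundary_talg H (set_weight i A)"
  have gen: "generator H Equivariant (set_weight i A)" for i
    using A by (rule generator_set_weight)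
  have scal_flow: "flow_types (scal f * a) \<subseteq> flow_types a" for f and a :: "'a talg"
    unfolding flow_types_def scal_def using keys_mult[of "Poly_Mapping.single 0 f" a] by (auto split: if_splits)
  have ft: "flow_type (FWord [set_weight i A]) = ?t" for i
    by (simp add: flow_type_def fun_eq_iff del: split_paired_All)
  have nfp: "\<not> fully_pointed A"
    using A by (auto simp: generator_def fully_pointed_def)
  then have "flow_types (talg_of H (set_weight i A)) \<subseteq> {?t}" for i
    by (simp add: talg_of_def flow_types_def word_def ft)
  then have x: "flow_types (?x i) \<subseteq> {?t}" for i
    using scal_flow by blast
  have y: "flow_types (?y i) \<subseteq> {?t}" for i
    using scal_flow flow_types_boundary_talg[OF gen] ft by blast
  have xs: "flow_types (sum ?x I) \<subseteq> {?t}" and ys: "flow_types (sum ?y I) \<subseteq> {?t}" for I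
    using flow_types_sum_subset[of ?x I] flow_types_sum_subset[of ?y I] x y by blast+
  have summand: "sh_diff H Equivariant (Some (?x i)) (Some (?y i))" for i
  proof -
    have "sh_diff H Equivariant (coef_scale (U_coef ^ i) (Some (talg_of H (set_weight i A))))
        (coef_scale 0 (Some (talg_of H (set_weight i A))) \<boxplus> coef_scale (U_coef ^ i) (boundary_gen H (set_weight i A)))"
      using gen by (intro sh_diff.intros(1,6) diff_coef_U_power) simp_all
    then show ?thesis
      using y[of i] by (simp add: boundary_gen_eq[OF gen] boxplus_homogeneous[where t = ?t])
  qed
  have "sh_diff H Equivariant (Some (sum ?x I)) (Some (sum ?y I))" if "finite I" for I
    using that
  proof (induction I)
    case (insert i I)
    have "Some (?x i) \<boxplus> Some (sum ?x I) = Some (?x i + sum ?x I)" "Some (?y i) \<boxplus> Some (sum ?y I) = Some (?y i + sum ?y I)"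
      using x y xs ys by (blast intro: boxplus_homogeneous)+
    then show ?case
      using sh_diff.intros(4)[OF summand[of i] insert.IH] insert.hyps by simp
  qed (simp add: sh_diff.intros)
  moreover have "plain_symb H A"
    using A by (simp add: generator_def plain_symb_pre_generator)
  ultimately show ?thesis
    by (simp add: FU_talg_talg_of FU_talg_boundary_talg boundary_gen_eq[OF A] A finite_nonempty_weights)
qed

text \<open>Normal forms are part of the induction, since the morphism is shown to commute with the
  operations only there. It takes the value \<open>Omega\<close> only at \<open>Omega\<close>, so
  the definedness premises transfer; the differentials themselves may be undefined.\<close>

lemma sh_diff_FU:
  assumes "sh_diff H Plain x x'"
  shows "x \<in> plain_thats H \<and> x' \<in> plain_thats H \<and> sh_diff H Equivariant (FU H x) (FU H x')"
  using assms
proof induction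
  case (1 A)
  then have "plain_symb H A"
    by (simp add: generator_def plain_symb_pre_generator)
  then have "Some (talg_of H A) \<in> plain_thats H"
    by (simp add: plain_talgs_talg_of)
  moreover have "boundary_gen H A \<in> plain_thats H"
    using plain_boundary_talg[OF 1] by (simp add: boundary_gen_eq[OF 1])
  ultimately show ?case
    using sh_diff_FU_generator[OF 1] by blast
next
  case (4 x x' y y')
  then have "sh_diff H Equivariant (FU H x \<boxplus> FU H y) (FU H x' \<boxplus> FU H y')"
    by (intro sh_diff.intros(4)) (auto simp flip: FU_boxplus)
  then show ?case
    using 4 by (simp add: FU_boxplus plain_thats_boxplus)
next
  case (5 x x' y y')
  then have "sh_diff H Equivariant (boxtimes H (FU H x) (FU H y))
      (boxtimes H (FU H x') (FU H y) \<boxplus> boxtimes H (FU H x) (FU H y'))"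
    by (intro sh_diff.intros(5)) (auto simp flip: FU_boxtimes)
  then show ?case
    using 5 by (simp add: FU_boxplus FU_boxtimes plain_thats_boxplus plain_thats_boxtimes)
next
  case (6 f f' x x')
  then have f: "f \<in> plain_coefs H" "f' \<in> plain_coefs H" "diff_coef H Equivariant (FU_coef H f) (FU_coef H f')"
    using diff_coef_FU by blast+
  then have "sh_diff H Equivariant (coef_scale (FU_coef H f) (FU H x))
      (coef_scale (FU_coef H f') (FU H x) \<boxplus> coef_scale (FU_coef H f) (FU H x'))"
    using 6 by (intro sh_diff.intros(6)) auto
  then show ?case
    using 6 f by (simp add: FU_boxplus FU_coef_scale plain_thats_boxplus plain_thats_coef_scale)
qed (simp_all add: sh_diff.intros)

end

section \<open>Symbol homology\<close>

lemma cycles_zero: "Some 0 \<in> cycles H ver"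
  by (simp add: cycles_def sh_diff.intros)

lemma cycles_Omega: "Omega \<in> cycles H ver"
  by (simp add: cycles_def sh_diff.intros)

lemma cycles_boxplus:
  assumes "x \<in> cycles H ver" "y \<in> cycles H ver" "x \<boxplus> y \<noteq> Omega"
  shows "x \<boxplus> y \<in> cycles H ver"
  using sh_diff.intros(4)[of H ver x "Some 0" y "Some 0"] assms by (simp add: cycles_def boxplus_zero)

text \<open>A defined product has defined operands, so both Leibniz terms are products of an actual
  element with 0 and hence 0, not \<open>Omega\<close>.\<close>

lemma cycles_boxtimes:
  assumes "x \<in> cycles H ver" "y \<in> cycles H ver" "boxtimes H x y \<noteq> Omega"
  shows "boxtimes H x y \<in> cycles H ver"
proof -
  obtain a b where "x = Some a" "y = Some b"
    using assms(3) by (cases x; cases y) simp_all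
  then show ?thesis
    using sh_diff.intros(5)[of H ver x "Some 0" y "Some 0"] assms by (simp add: cycles_def boxplus_zero)
qed

lemma homologous_cycles: "homologous H ver x y \<Longrightarrow> x \<in> cycles H ver \<and> y \<in> cycles H ver"
  by (induction rule: homologous.induct) (auto simp: cycles_zero cycles_boxplus cycles_boxtimes)

text \<open>Each generating rule other than reflexivity, symmetry and transitivity relates only
  defined elements, so \<open>Omega\<close> is alone in its class.\<close>

lemma homologous_Omega_iff: "homologous H ver x y \<Longrightarrow> x = Omega \<longleftrightarrow> y = Omega"
  by (induction rule: homologous.induct) auto

lemma hclass_Omega: "hclass H ver Omega = {Omega}"
  using homologous_Omega_iff[of H ver Omega] homologous.refl[OF cycles_Omega] by (auto simp: hclass_def)

lemma self_in_hclass: "x \<in> cycles H ver \<Longrightarrow> x \<in> hclass H ver x"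
  by (simp add: hclass_def homologous.refl)

lemma hclass_eq: "homologous H ver x y \<Longrightarrow> hclass H ver x = hclass H ver y"
  unfolding hclass_def by (blast intro: homologous.sym homologous.trans)

lemma symbol_homologyE:
  assumes "X \<in> symbol_homology H ver" obtains x where "x \<in> cycles H ver" "X = hclass H ver x"
  using assms by (auto simp: symbol_homology_def)

lemma symbol_homology_eq_hclass:
  assumes "X \<in> symbol_homology H ver" "x \<in> X" shows "x \<in> cycles H ver" "X = hclass H ver x"
proof -
  obtain y where "X = hclass H ver y"
    using assms(1) by (rule symbol_homologyE)
  then have "homologous H ver y x"
    using assms(2) by (simp add: hclass_def)
  then show "x \<in> cycles H ver" "X = hclass H ver x"
    using homologous_cycles hclass_eq \<open>X = _\<close> by blast+
qed

section \<open>Operations on homology classes\<close>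

definition congruent_op :: "'a heegaard \<Rightarrow> version \<Rightarrow> ('a that \<Rightarrow> 'a that \<Rightarrow> 'a that) \<Rightarrow> bool" where
  "congruent_op H ver opr \<longleftrightarrow> (\<forall>x y. x = Omega \<or> y = Omega \<longrightarrow> opr x y = Omega) \<and>
     (\<forall>x x' y y'. homologous H ver x x' \<longrightarrow> homologous H ver y y' \<longrightarrow> opr x y \<noteq> Omega \<longrightarrow> opr x' y' \<noteq> Omega \<longrightarrow>
        homologous H ver (opr x y) (opr x' y'))"

lemma congruent_op_Omega: "congruent_op H ver opr \<Longrightarrow> opr x y \<noteq> Omega \<Longrightarrow> x \<noteq> Omega \<and> y \<noteq> Omega"
  unfolding congruent_op_def by metis

lemma congruent_op_boxplus: "congruent_op H ver (\<boxplus>)"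
  by (auto simp: congruent_op_def intro: homologous.plus)

lemma congruent_op_boxtimes: "congruent_op H ver (boxtimes H)"
  by (auto simp: congruent_op_def intro: homologous.times)

text \<open>All defined values on representatives are homologous, so the union in
  \<open>induced_op\<close> collapses to one class, which any defined pair computes.\<close>

lemma induced_op_eq_hclass:
  assumes opr: "congruent_op H ver opr" and XY: "X \<in> symbol_homology H ver" "Y \<in> symbol_homology H ver"
    and xy: "x \<in> X" "y \<in> Y" "opr x y \<noteq> Omega"
  shows "induced_op H ver opr X Y = hclass H ver (opr x y)"
proof -
  have "hclass H ver (opr x' y') = hclass H ver (opr x y)"
    if "x' \<in> X" "y' \<in> Y" "opr x' y' \<noteq> Omega" for x' y'
  proof (rule hclass_eq)
    have "homologous H ver x' x" "homologous H ver y' y"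
      using symbol_homology_eq_hclass[OF XY(1) that(1)] symbol_homology_eq_hclass[OF XY(2) that(2)] xy
      by (auto simp: hclass_def)
    then show "homologous H ver (opr x' y') (opr x y)"
      using opr that(3) xy(3) unfolding congruent_op_def by blast
  qed
  then have "{hclass H ver (opr x y) | x y. x \<in> X \<and> y \<in> Y \<and> opr x y \<noteq> Omega} = {hclass H ver (opr x y)}"
    using xy by blast
  moreover have "\<exists>x\<in>X. \<exists>y\<in>Y. opr x y \<noteq> Omega"
    using xy by blast
  ultimately show ?thesis
    unfolding induced_op_def by simp
qed

lemma induced_op_defined:
  assumes "congruent_op H ver opr" "induced_op H ver opr X Y \<noteq> {Omega}"
  obtains x y where "x \<in> X" "y \<in> Y" "opr x y \<noteq> Omega" "x \<noteq> Omega" "y \<noteq> Omega"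
proof -
  have "\<exists>x\<in>X. \<exists>y\<in>Y. opr x y \<noteq> Omega"
    using assms(2) unfolding induced_op_def hclass_Omega by (auto split: if_splits)
  then show ?thesis
    using that congruent_op_Omega[OF assms(1)] by blast
qed

lemma hclass_zero_neq_Omega: "hclass H ver (Some 0) \<noteq> {Omega}"
  using self_in_hclass[OF cycles_zero] by fastforce

section \<open>The induced map on homology\<close>

context heegaard_theory
begin

lemma cycles_FU:
  assumes "x \<in> cycles H Plain" shows "x \<in> plain_thats H" "FU H x \<in> cycles H Equivariant"
  using sh_diff_FU[of x "Some 0"] assms by (simp_all add: cycles_def)

text \<open>Boundaries go to boundaries by the chain map property. For sums and products, the side
  conditions survive because the morphism commutes with the operation and reflects
  \<open>Omega\<close>.\<close>

lemma homologous_FU: "homologous H Plain x y \<Longrightarrow> homologous H Equivariant (FU H x) (FU H y)"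
proof (induction rule: homologous.induct)
  case (boundary b c)
  then have "homologous H Equivariant (FU H b) (Some 0)"
    using sh_diff_FU[of c b] cycles_FU by (intro homologous.boundary) auto
  then show ?case by simp
next
  case (refl x)
  then show ?case
    by (intro homologous.refl cycles_FU)
next
  case (sym x y)
  then show ?case
    by (blast intro: homologous.sym)
next
  case (trans x y z)
  then show ?case
    by (blast intro: homologous.trans)
next
  case (plus x x' y y')
  then have "x \<in> plain_thats H" "x' \<in> plain_thats H" "y \<in> plain_thats H" "y' \<in> plain_thats H"
    using homologous_cycles cycles_FU(1) by blast+
  note * = FU_boxplus[OF this(1,3)] FU_boxplus[OF this(2,4)]
  show ?case
    unfolding * using plus by (intro homologous.plus) (simp_all flip: *)
next
  case (times x x' y y')
  then have "x \<in> plain_thats H" "x' \<in> plain_thats H" "y \<in> plain_thats H" "y' \<in> plain_thats H"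
    using homologous_cycles cycles_FU(1) by blast+
  note * = FU_boxtimes[OF this(1,3)] FU_boxtimes[OF this(2,4)]
  show ?case
    unfolding * using times by (intro homologous.times) (simp_all flip: *)
qed

lemma FU_homology_hclass:
  assumes "x \<in> cycles H Plain"
  shows "FU_homology H (hclass H Plain x) = hclass H Equivariant (FU H x)"
proof -
  have "hclass H Equivariant (FU H y) = hclass H Equivariant (FU H x)" if "y \<in> hclass H Plain x" for y
    using that hclass_eq[OF homologous_FU[of x y]] by (simp add: hclass_def)
  then have "FU_homology H (hclass H Plain x) = (\<Union>y\<in>hclass H Plain x. hclass H Equivariant (FU H x))"
    unfolding FU_homology_def by (intro SUP_cong) auto
  then show ?thesis
    using self_in_hclass[OF assms] by auto
qed

lemma FU_in_FU_homology:
  assumes "X \<in> symbol_homology H Plain" "x \<in> X" shows "FU H x \<in> FU_homology H X"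
  using symbol_homology_eq_hclass(1)[OF assms] assms(2) cycles_FU(2) self_in_hclass
  unfolding FU_homology_def by blast

lemma FU_homology_symbol_homology:
  assumes "X \<in> symbol_homology H Plain" shows "FU_homology H X \<in> symbol_homology H Equivariant"
proof -
  obtain x where "x \<in> cycles H Plain" "X = hclass H Plain x"
    using assms by (rule symbol_homologyE)
  then show ?thesis
    using cycles_FU(2) by (simp add: FU_homology_hclass symbol_homology_def)
qed

text \<open>A value other than the class of \<open>Omega\<close> provides representatives on which
  the operation is defined. Their images are representatives on the equivariant side, where the
  operation is again defined and computes the class.\<close>

lemma FU_homology_induced_op:
  assumes opr: "congruent_op H Plain opr" "congruent_op H Equivariant opr"
    and cyc: "\<And>x y. x \<in> cycles H Plain \<Longrightarrow> y \<in> cycles H Plain \<Longrightarrow> opr x y \<noteq> Omega \<Longrightarrow> opr x y \<in> cycles H Plain"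
    and FU: "\<And>x y. x \<in> plain_thats H \<Longrightarrow> y \<in> plain_thats H \<Longrightarrow> FU H (opr x y) = opr (FU H x) (FU H y)"
    and XY: "X \<in> symbol_homology H Plain" "Y \<in> symbol_homology H Plain"
    and ne: "induced_op H Plain opr X Y \<noteq> {Omega}"
  shows "induced_op H Plain opr X Y \<in> symbol_homology H Plain \<and>
    FU_homology H (induced_op H Plain opr X Y) = induced_op H Equivariant opr (FU_homology H X) (FU_homology H Y)"
proof -
  obtain x y where xy: "x \<in> X" "y \<in> Y" "opr x y \<noteq> Omega"
    using induced_op_defined[OF opr(1) ne] by blast
  have x: "x \<in> cycles H Plain" and y: "y \<in> cycles H Plain"
    using symbol_homology_eq_hclass(1) XY xy by blast+
  have eq: "induced_op H Plain opr X Y = hclass H Plain (opr x y)"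
    using opr(1) XY xy by (rule induced_op_eq_hclass)
  have c: "opr x y \<in> cycles H Plain"
    using x y xy(3) by (rule cyc)
  have FU_xy: "FU H (opr x y) = opr (FU H x) (FU H y)"
    using x y by (intro FU cycles_FU)
  have "induced_op H Plain opr X Y \<in> symbol_homology H Plain"
    using c by (simp add: eq symbol_homology_def)
  moreover have "FU_homology H (induced_op H Plain opr X Y) = hclass H Equivariant (opr (FU H x) (FU H y))"
    using FU_homology_hclass[OF c] by (simp add: eq FU_xy)
  moreover have "hclass H Equivariant (opr (FU H x) (FU H y)) =
      induced_op H Equivariant opr (FU_homology H X) (FU_homology H Y)"
    using opr(2) XY xy
    by (intro induced_op_eq_hclass[symmetric] FU_homology_symbol_homology FU_in_FU_homology) (simp_all flip: FU_xy)
  ultimately show ?thesis by simp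
qed

lemma FU_homology_boxplus:
  assumes "X \<in> symbol_homology H Plain" "Y \<in> symbol_homology H Plain" "induced_op H Plain (\<boxplus>) X Y \<noteq> {Omega}"
  shows "induced_op H Plain (\<boxplus>) X Y \<in> symbol_homology H Plain \<and>
    FU_homology H (induced_op H Plain (\<boxplus>) X Y) = induced_op H Equivariant (\<boxplus>) (FU_homology H X) (FU_homology H Y)"
  by (rule FU_homology_induced_op[OF congruent_op_boxplus congruent_op_boxplus _ _ assms])
    (rule cycles_boxplus FU_boxplus; assumption)+

lemma FU_homology_boxtimes:
  assumes "X \<in> symbol_homology H Plain" "Y \<in> symbol_homology H Plain" "induced_op H Plain (boxtimes H) X Y \<noteq> {Omega}"
  shows "induced_op H Plain (boxtimes H) X Y \<in> symbol_homology H Plain \<and>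
    FU_homology H (induced_op H Plain (boxtimes H) X Y) =
      induced_op H Equivariant (boxtimes H) (FU_homology H X) (FU_homology H Y)"
  by (rule FU_homology_induced_op[OF congruent_op_boxtimes congruent_op_boxtimes _ _ assms])
    (rule cycles_boxtimes FU_boxtimes; assumption)+

text \<open>
  An undefined operation may become defined in the equivariant theory, where classes can be larger.
  This is harmless because \<open>\<Omega>\<close> is absorbing: no subexpression of a polynomial with value
  different from the class of \<open>\<Omega>\<close> is undefined.
\<close>

lemma FU_homology_npoly_value:
  assumes s: "s \<in> symbol_homology H Plain" and "set_npoly P \<subseteq> symbol_homology H Plain"
    and "npoly_value H Plain P s \<noteq> {Omega}"
  shows "npoly_value H Plain P s \<in> symbol_homology H Plain \<and>
    npoly_value H Equivariant (map_npoly (FU_homology H) P) (FU_homology H s) = FU_homology H (npoly_value H Plain P s)"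
  using assms(2,3)
proof (induction P)
  case (NSum P Q)
  obtain x y where "x \<in> npoly_value H Plain P s" "y \<in> npoly_value H Plain Q s" "x \<noteq> Omega" "y \<noteq> Omega"
    using NSum.prems(2) unfolding npoly_value.simps by (rule induced_op_defined[OF congruent_op_boxplus])
  then have "npoly_value H Plain P s \<noteq> {Omega}" "npoly_value H Plain Q s \<noteq> {Omega}"
    by auto
  then have IH: "npoly_value H Plain P s \<in> symbol_homology H Plain"
      "npoly_value H Plain Q s \<in> symbol_homology H Plain"
      "npoly_value H Equivariant (map_npoly (FU_homology H) P) (FU_homology H s) = FU_homology H (npoly_value H Plain P s)"
      "npoly_value H Equivariant (map_npoly (FU_homology H) Q) (FU_homology H s) = FU_homology H (npoly_value H Plain Q s)"
    using NSum by simp_all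
  show ?case
    using FU_homology_boxplus[OF IH(1,2)] NSum.prems(2) IH(3,4) by simp
next
  case (NProd P Q)
  obtain x y where "x \<in> npoly_value H Plain P s" "y \<in> npoly_value H Plain Q s" "x \<noteq> Omega" "y \<noteq> Omega"
    using NProd.prems(2) unfolding npoly_value.simps by (rule induced_op_defined[OF congruent_op_boxtimes])
  then have "npoly_value H Plain P s \<noteq> {Omega}" "npoly_value H Plain Q s \<noteq> {Omega}"
    by auto
  then have IH: "npoly_value H Plain P s \<in> symbol_homology H Plain"
      "npoly_value H Plain Q s \<in> symbol_homology H Plain"
      "npoly_value H Equivariant (map_npoly (FU_homology H) P) (FU_homology H s) = FU_homology H (npoly_value H Plain P s)"
      "npoly_value H Equivariant (map_npoly (FU_homology H) Q) (FU_homology H s) = FU_homology H (npoly_value H Plain Q s)"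
    using NProd by simp_all
  show ?case
    using FU_homology_boxtimes[OF IH(1,2)] NProd.prems(2) IH(3,4) by simp
qed (use s in auto)

text \<open>The image of a homogeneous representative has the same flow type, hence represents a map
  between the modules attached to the same vertices.\<close>

lemma represents_map_FU_homology:
  assumes "s \<in> symbol_homology H Plain" "represents_map H s D f"
  shows "\<exists>f'. represents_map H (FU_homology H s) D f'"
proof -
  obtain a where a: "Some a \<in> s" "flow_types a \<subseteq> {D}"
    using assms(2) by (auto simp: represents_map_def flow_types_def)
  have "a \<in> plain_talgs H"
    using symbol_homology_eq_hclass(1)[OF assms(1) a(1)] cycles_FU(1) by fastforce
  then have "flow_types (FU_talg H a) \<subseteq> {D}"
    using flow_types_FU_talg a(2) by (simp add: flow_types_def)
  moreover have "Some (FU_talg H a) \<in> FU_homology H s"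
    using FU_in_FU_homology[OF assms(1) a(1)] by simp
  ultimately have "represents_map H (FU_homology H s) D (ev H (FU_talg H a))"
    unfolding represents_map_def flow_types_def by blast
  then show ?thesis by (intro exI[of _ "ev H (FU_talg H a)"])
qed

end

theorem theorem7p2:
  fixes H :: "'a heegaard"
    and s :: "'a that set"
    and P :: "'a that set npoly"
    and D :: "('a vertex \<Rightarrow> nat) \<times> ('a vertex \<Rightarrow> nat)"
    and f :: "'a floer_map"
  assumes "heegaard_setup H"
    and "s \<in> symbol_homology H Plain"
    and "represents_map H s D f"
    and "P \<in> property_polys H Plain"
    and "has_property H Plain P s"
  shows "FU_homology H s \<in> symbol_homology H Equivariant \<and>
    (\<exists>f'. represents_map H (FU_homology H s) D f') \<and>
    has_property H Equivariant (map_npoly (FU_homology H) P) (FU_homology H s)"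
proof -
  interpret heegaard_theory H
    using assms(1) by unfold_locales
  have zero_value: "npoly_value H Plain P s = hclass H Plain (Some 0)"
    using assms(5) by (simp add: has_property_def)
  \<comment> \<open>The class of 0 is not that of \<open>Omega\<close>, so the comparison of
    polynomial values applies.\<close>
  then have "npoly_value H Equivariant (map_npoly (FU_homology H) P) (FU_homology H s) =
      FU_homology H (hclass H Plain (Some 0))"
    using FU_homology_npoly_value[OF assms(2), of P] assms(4) hclass_zero_neq_Omega[of H Plain] by (simp add: property_polys_def)
  also have "\<dots> = hclass H Equivariant (Some 0)"
    using FU_homology_hclass[OF cycles_zero] by simp
  finally have "has_property H Equivariant (map_npoly (FU_homology H) P) (FU_homology H s)"
    by (simp add: has_property_def)
  then show ?thesis
    using FU_homology_symbol_homology[OF assms(2)] represents_map_FU_homology[OF assms(2,3)] by blast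
qed

end
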